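(* Let $G$ be a finite group with $\lambda(G)\leqslant 30$. Then $G$ is solvable.
   Context: A covering of a finite group $G$ is a family of subgroups $X_1,\dots,X_n$ ($n\geq 2$) with $\bigcup_{i=1}^n X_i = G$. It is irredundant if $X_i \nsubseteq \bigcup_{j\neq i} X_j$ for every $i$. For a non-cyclic finite group $G$, $\lambda(G)$ denotes the maximum number of subgroups in an irredundant covering of $G$. For cyclic $G$ (which has no irredundant covering with $n\ge 2$) the convention is $\lambda(G)=1$. *)

theory Defs
  imports "HOL-Algebra.Algebra"
begin

definition group_covering :: "('a, 'b) monoid_scheme \<Rightarrow> nat \<Rightarrow> (nat \<Rightarrow> 'a set) \<Rightarrow> bool" where
  "group_covering G n A \<longleftrightarrow>
     n \<ge> 2 \<and> (\<forall>i\<in>{1..n}. subgroup (A i) G) \<and> (\<Union>i\<in>{1..n}. A i) = carrier G"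

definition irredundant_covering :: "('a, 'b) monoid_scheme \<Rightarrow> nat \<Rightarrow> (nat \<Rightarrow> 'a set) \<Rightarrow> bool" where
  "irredundant_covering G n A \<longleftrightarrow>
     group_covering G n A \<and> (\<forall>i\<in>{1..n}. \<not> A i \<subseteq> (\<Union>j\<in>{1..n} - {i}. A j))"

text \<open>
  For a finite non-cyclic group the maximum is taken over a finite nonempty set, by
  \<open>finite_irredundant_covering_sizes\<close> and \<open>irredundant_covering_exists\<close> below.
\<close>

definition covering_lambda :: "('a, 'b) monoid_scheme \<Rightarrow> nat" where
  "covering_lambda G =
     (if cyclic_group G then 1 else Max {n. \<exists>A. irredundant_covering G n A})"

lemma irredundant_covering_le_card:
  assumes fin: "finite (carrier G)" and irr: "irredundant_covering G n A"
  shows "n \<le> card (carrier G)"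
proof -
  have "\<forall>i\<in>{1..n}. \<exists>x. x \<in> A i \<and> x \<notin> (\<Union>j\<in>{1..n} - {i}. A j)"
    using irr unfolding irredundant_covering_def by blast
  then obtain f where f: "\<forall>i\<in>{1..n}. f i \<in> A i \<and> f i \<notin> (\<Union>j\<in>{1..n} - {i}. A j)"
    by metis
  have "inj_on f {1..n}"
  proof (rule inj_onI)
    fix i j assume i: "i \<in> {1..n}" and j: "j \<in> {1..n}" and eq: "f i = f j"
    have "f i \<in> A i" "f j \<notin> (\<Union>k\<in>{1..n} - {j}. A k)" using f i j by auto
    then show "i = j" using eq i by auto
  qed
  moreover have "f ` {1..n} \<subseteq> carrier G"
    using f irr unfolding irredundant_covering_def group_covering_def by blast
  ultimately have "card {1..n} \<le> card (carrier G)"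
    using card_inj_on_le fin by blast
  then show ?thesis by simp
qed

lemma finite_irredundant_covering_sizes:
  assumes "finite (carrier G)"
  shows "finite {n. \<exists>A. irredundant_covering G n A}"
proof (rule finite_subset)
  show "{n. \<exists>A. irredundant_covering G n A} \<subseteq> {..card (carrier G)}"
    using irredundant_covering_le_card[OF assms] by blast
qed simp

lemma (in group) irredundant_covering_exists:
  assumes fin: "finite (carrier G)" and nc: "\<not> cyclic_group G"
  shows "\<exists>n A. irredundant_covering G n A"
proof -
  define P where "P n \<longleftrightarrow> (\<exists>A. (\<forall>i\<in>{1..n}. \<exists>x\<in>carrier G. A i = generate G {x}) \<and>
    (\<Union>i\<in>{1..n}. A i) = carrier G)" for n :: nat
  obtain h where h: "bij_betw h {1..card (carrier G)} (carrier G)"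
    using ex_bij_betw_nat_finite_1[OF fin] by blast
  have gen: "x \<in> generate G {x}" for x
    by (rule generate.incl) simp
  have sub: "subgroup (generate G {x}) G" if "x \<in> carrier G" for x
    using that by (intro generate_is_subgroup) simp
  have "P (card (carrier G))"
    unfolding P_def
  proof (intro exI[of _ "\<lambda>i. generate G {h i}"] conjI ballI)
    fix i assume "i \<in> {1..card (carrier G)}"
    then show "\<exists>x\<in>carrier G. generate G {h i} = generate G {x}"
      using h bij_betwE by blast
  next
    show "(\<Union>i\<in>{1..card (carrier G)}. generate G {h i}) = carrier G"
    proof (intro equalityI subsetI)
      fix y assume "y \<in> (\<Union>i\<in>{1..card (carrier G)}. generate G {h i})"
      then obtain i where i: "i \<in> {1..card (carrier G)}" "y \<in> generate G {h i}" by blast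
      then have "h i \<in> carrier G" using h bij_betwE by blast
      then show "y \<in> carrier G" using i(2) by (rule subgroup.mem_carrier[OF sub])
    next
      fix y assume "y \<in> carrier G"
      then obtain i where "i \<in> {1..card (carrier G)}" "h i = y"
        using h by (metis bij_betw_imp_surj_on imageE)
      then show "y \<in> (\<Union>i\<in>{1..card (carrier G)}. generate G {h i})"
        using gen by blast
    qed
  qed
  then obtain n where Pn: "P n" and least: "\<And>m. m < n \<Longrightarrow> \<not> P m"
    using exists_least_iff[of P] by blast
  obtain A where A: "\<forall>i\<in>{1..n}. \<exists>x\<in>carrier G. A i = generate G {x}"
    and U: "(\<Union>i\<in>{1..n}. A i) = carrier G"
    using Pn unfolding P_def by blast
  have "n \<noteq> 0" using U one_closed by auto
  moreover have "n \<noteq> 1"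
  proof
    assume "n = 1"
    then obtain x where "x \<in> carrier G" "generate G {x} = carrier G"
      using A U by auto
    moreover from this have "carrier G \<inter> {x} = {x}" by blast
    ultimately have "subgroup_generated G {x} = G"
      unfolding subgroup_generated_def by simp
    with \<open>x \<in> carrier G\<close> have "cyclic_group G"
      unfolding cyclic_group_def by blast
    then show False using nc by simp
  qed
  ultimately have n2: "n \<ge> 2" by simp
  have "\<not> A i \<subseteq> (\<Union>j\<in>{1..n} - {i}. A j)" if i: "i \<in> {1..n}" for i
  proof
    assume red: "A i \<subseteq> (\<Union>j\<in>{1..n} - {i}. A j)"
    have cov: "(\<Union>j\<in>{1..n} - {i}. A j) = carrier G"
      using red U i by blast
    have "card ({1..n} - {i}) = n - 1" using i by simp
    then obtain g where g: "bij_betw g {1..n - 1} ({1..n} - {i})"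
      using ex_bij_betw_nat_finite_1[of "{1..n} - {i}"] by auto
    then have im: "g ` {1..n - 1} = {1..n} - {i}"
      by (rule bij_betw_imp_surj_on)
    have "P (n - 1)"
      unfolding P_def
    proof (intro exI[of _ "\<lambda>k. A (g k)"] conjI ballI)
      fix k assume "k \<in> {1..n - 1}"
      then show "\<exists>x\<in>carrier G. A (g k) = generate G {x}" using im A by blast
    next
      have "(\<Union>k\<in>{1..n - 1}. A (g k)) = (\<Union>j\<in>g ` {1..n - 1}. A j)" by blast
      then show "(\<Union>k\<in>{1..n - 1}. A (g k)) = carrier G" unfolding im cov .
    qed
    moreover have "n - 1 < n" using n2 by simp
    ultimately show False using least by blast
  qed
  moreover have "\<forall>i\<in>{1..n}. subgroup (A i) G"
  proof
    fix i assume "i \<in> {1..n}"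
    then obtain x where "x \<in> carrier G" "A i = generate G {x}" using A by blast
    then show "subgroup (A i) G" using sub by simp
  qed
  ultimately have "irredundant_covering G n A"
    unfolding irredundant_covering_def group_covering_def using n2 U by blast
  then show ?thesis by blast
qed

end

(* A finite group G is covered irredundantly by its maximal cyclic subgroups, so the hypothesis bounds
   their number by 30. Having a cover by at most 30 cyclic subgroups passes to subgroups and quotients,
   and a non-solvable G has a non-abelian simple section (the quotient of its perfect core by a maximal
   normal subgroup). So let G be non-abelian simple of order N and let it act by conjugation on its
   maximal cyclic subgroups. Record for every orbit its length n and the common order c of its members.
   Every conjugacy class of size m > 1 embeds G into the alternating group of degree m; together with
   Sylow's theorems, the centre of a Sylow subgroup, a Landau-type bound on c and the count of the
   elements of G this leaves only N = 144, or N = 60 with an orbit (10, 6) or (5, 4). These cases are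
   excluded by hand. *)

theory Submission
  imports Defs "HOL-Library.Code_Binary_Nat"
begin

text \<open>Finiteness of the search rests on three bounds. An index \<open>m > 1\<close> of the
  kind considered satisfies \<open>2 * N dvd fact m\<close>, which together with the class of a
  central element of prime order forces \<open>m \<ge> 5\<close>; a total length of 30 thus leaves
  at most six orbits. A single orbit \<open>(n, c)\<close> would give
  \<open>N + n \<le> 1 + n * c \<le> 1 + N\<close>, absurd for \<open>n > 1\<close>, so there are at
  least two and the least length \<open>k\<close> is at most 15. A maximal cyclic subgroup of order
  \<open>c\<close> acts faithfully on the orbit of length \<open>k\<close>, so the prime power parts
  of \<open>c\<close> sum to at most \<open>k\<close>, whence \<open>c ^ 3 \<le> 3 ^ k\<close>;
  counting elements then bounds \<open>N\<close>. The slack is small: the alternating group on five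
  letters has 15 + 10 + 6 = 31 maximal cyclic subgroups. The arithmetic is kept apart from the
  groups: a locale lists the numerical facts, a computation in the kernel exhausts them, and the
  group theory only has to instantiate the locale.\<close>

hide_const (open) Divisibility.prime

section \<open>Arithmetic of the orbit lengths\<close>

text \<open>The \<open>p\<close>-part of \<open>n\<close> by repeated division, which
  \<open>code_simp\<close> can evaluate; the guards make it terminate. \<open>ppart_prime\<close>
  identifies it with a power of \<open>multiplicity\<close>.\<close>

function ppart :: "nat \<Rightarrow> nat \<Rightarrow> nat" where
 "ppart p n = (if 1 < p \<and> 0 < n \<and> p dvd n then p * ppart p (n div p) else 1)"
  by auto
termination by (relation "measure snd") (auto intro: div_less_dividend)
declare ppart.simps [simp del]

text \<open>The list is the fuel of the recursion: its length bounds the number of entries. The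
  results are sorted because each chosen entry becomes the new lower bound \<open>m\<close>. The
  empty list always comes first.\<close>

primrec partitions :: "nat list \<Rightarrow> nat \<Rightarrow> nat \<Rightarrow> nat list list" where
  "partitions [] m s = [[]]"
| "partitions (_ # k) m s = [] # concat (map (\<lambda>a. map ((#) a) (partitions k a (s - a))) [m..<Suc s])"

text \<open>A prime divisor of \<open>N\<close> divides \<open>fact k\<close> with
  \<open>k \<le> 15\<close>, hence is at most 13.\<close>

definition small_primes :: "nat list" where "small_primes = [2, 3, 5, 7, 11, 13]"

text \<open>Entry \<open>k\<close> is the largest \<open>c\<close> with \<open>c ^ 3 \<le> 3 ^ k\<close>.\<close>

definition order_bounds :: "nat list" where
  "order_bounds = [1, 1, 2, 3, 4, 6, 9, 12, 18, 27, 38, 56, 81, 116, 168, 243]"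

text \<open>Here \<open>k\<close> is the least orbit length, for which \<open>2 * N dvd fact k\<close> is known. Conditionals stand
  for conjunctions because the simplifier evaluates both arguments of a conjunction.\<close>

definition factorial_ok :: "nat \<Rightarrow> nat \<Rightarrow> nat \<Rightarrow> bool" where
  "factorial_ok k N m = (if k \<le> m then True else 2 * N dvd fact m)"

text \<open>Candidates for class lengths of subgroups of maximal cyclic subgroups: such a length
  divides an orbit length, and it is at least 5 by \<open>index_ge_5\<close>.\<close>

definition indices :: "nat list \<Rightarrow> nat list" where
  "indices ns = remdups (concat (map (\<lambda>n. filter (\<lambda>m. m dvd n) [5..<Suc n]) ns))"

text \<open>Candidates for the number of Sylow \<open>p\<close>-subgroups, meant for the case that
  these have order \<open>p\<close>. Such a subgroup lies in a maximal cyclic one, so its class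
  length is found among the indices \<open>ms\<close>.\<close>

definition sylow_numbers :: "nat \<Rightarrow> nat list \<Rightarrow> nat \<Rightarrow> nat \<Rightarrow> nat list" where
  "sylow_numbers k ms N p = filter (\<lambda>m. if m mod p = 1 then if m * ppart p N dvd N then factorial_ok k N m else False else False) ms"

text \<open>\<open>N\<close> is a multiple of the lcm \<open>L\<close> of the orbit lengths, bounded
  by counting elements. Tests that already make sense for \<open>L\<close> come first, to avoid
  running through its multiples. The filter on \<open>N\<close> asks that each prime divisor
  \<open>p\<close> have an index prime to \<open>p\<close> (the class of a central element) and, for
  Sylow subgroups of order \<open>p\<close>, an admissible Sylow number; finally the elements of
  prime power order must fit into \<open>N\<close>.\<close>

definition order_candidates :: "nat list \<Rightarrow> nat list" where
  "order_candidates ns = (let k = hd ns; L = foldr lcm ns 1 in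
     if k \<le> 15 then
       let f = fact k in
       if 2 * L dvd f then
         let ms = indices ns in
         if list_all (\<lambda>p. if p dvd L then list_ex (\<lambda>m. if p \<le> m then \<not> p dvd m else False) ms else True) small_primes
         then filter (\<lambda>N. if 2 * N dvd f then
            if list_all (\<lambda>p. if p dvd N then
              if list_ex (\<lambda>m. if p dvd m then False else factorial_ok k N m) ms then
              (if ppart p N = p then sylow_numbers k ms N p \<noteq> [] else True) else False else True) small_primes then
            1 + sum_list (map (\<lambda>p. if p dvd N then
               if ppart p N = p then Min (set (sylow_numbers k ms N p)) * (p - 1) else ppart p N else 0) small_primes) \<le> N
            else False else False)
          (map ((*) L) [1..<Suc ((1 + sum_list ns * (order_bounds ! k - 1)) div L)])
         else []
       else []
     else [])"

text \<open>The least degree of a permutation of order \<open>c\<close>, provided the primes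
  dividing \<open>c\<close> are listed in \<open>small_primes\<close>.\<close>

definition landau :: "nat \<Rightarrow> nat" where
  "landau c = sum_list (map (\<lambda>p. if p dvd c then ppart p c else 0) small_primes)"

text \<open>The product of the choices is formed only if the largest order for every orbit satisfies
  the counting inequality. The entry 1 in \<open>1 # cs\<close> keeps \<open>Max\<close> defined
  when an orbit has no possible order.\<close>

definition order_choices :: "nat \<Rightarrow> nat list \<Rightarrow> nat list list" where
  "order_choices N ns = (let k = hd ns;
      css = map (\<lambda>n. filter (\<lambda>c. if n * c dvd N then landau c \<le> k else False) [2..<Suc (order_bounds ! k)]) ns in
     if N + sum_list ns \<le> 1 + sum_list (map (\<lambda>(n, cs). n * Max (set (1 # cs))) (zip ns css))
     then product_lists css else [])"

text \<open>Tests \<open>m\<close> as a value of \<open>\<nu> p\<close> against the assumptions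
  \<open>sylow\<close>, \<open>sylow_orbit\<close>, \<open>sylow_unique\<close> and
  \<open>sylow_gt\<close> of the locale \<open>orbit_data\<close>. The orbits in \<open>ks\<close>
  are those whose members contain a Sylow \<open>p\<close>-subgroup.\<close>

definition sylow_ok :: "nat \<Rightarrow> (nat \<times> nat) list \<Rightarrow> nat \<Rightarrow> nat \<Rightarrow> bool" where
  "sylow_ok N os p m = (let a = ppart p N; ks = filter (\<lambda>(n, c). a dvd c) os in
     m * a dvd N \<and> m mod p = 1 \<and> factorial_ok (fst (hd os)) N m \<and> length (filter (\<lambda>(n, c). c = a) os) \<le> 1 \<and>
     list_all (\<lambda>(n, c). if m dvd n then (if c = a then n = m else True) \<and>
       (if a = p then list_all (\<lambda>q. if q = p then True else if q dvd c then p * ppart q c < m else True) small_primes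
        else True) else False) ks)"

text \<open>Discards a configuration if the elements cannot be counted, or if some prime has no
  class of a central element or no possible Sylow number. When an orbit member contains a Sylow
  subgroup, the Sylow number divides an orbit length and is at most 30; otherwise it is bounded by
  the index of a Sylow subgroup.\<close>

definition excluded :: "nat \<Rightarrow> (nat \<times> nat) list \<Rightarrow> bool" where
  "excluded N os \<longleftrightarrow> (if N + sum_list (map fst os) \<le> 1 + sum_list (map (\<lambda>(n, c). n * c) os) then
     list_ex (\<lambda>p. if p dvd N then
       if list_ex (\<lambda>(n, c). if p dvd c then list_ex (\<lambda>m. if m dvd n then if p dvd m then False else factorial_ok (fst (hd os)) N m else False) [5..<Suc n] else False) os
       then \<not> list_ex (sylow_ok N os p) (if list_ex (\<lambda>(n, c). ppart p N dvd c) os then [5..<31] else [5..<Suc (N div ppart p N)])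
       else True
      else False) small_primes
     else True)"

definition outcome :: "nat \<Rightarrow> (nat \<times> nat) list \<Rightarrow> bool" where
  "outcome N os \<longleftrightarrow> N = 144 \<or> N = 60 \<and> ((10, 6) \<in> set os \<or> (5, 4) \<in> set os)"

text \<open>The whole case distinction, evaluated by simplification with code equations and hence
  checked by the kernel; \<open>Code_Binary_Nat\<close> supplies binary arithmetic. Fuel 6 suffices
  since six lengths of at least 5 already sum to 30, and \<open>tl\<close> drops the empty
  list.\<close>

lemma enumeration:
  "list_all (\<lambda>ns. list_all (\<lambda>N. list_all (\<lambda>cs. if excluded N (zip ns cs) then True else outcome N (zip ns cs))
     (order_choices N ns)) (order_candidates ns)) (tl (partitions [1,2,3,4,5,6] 5 30))"
  by code_simp

section \<open>Correctness of the executable functions\<close>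

lemma ppart_prime:
  assumes p: "prime (p::nat)" and n: "n > 0"
  shows "ppart p n = p ^ multiplicity p n"
  using n
proof (induction n rule: less_induct)
  case (less n)
  show ?case
  proof (cases "p dvd n")
    case True
    have "n div p < n" "n div p > 0"
      using True less.prems prime_gt_1_nat[OF p] by (auto intro: div_less_dividend simp: dvd_imp_le div_greater_zero_iff)
    then have "ppart p (n div p) = p ^ multiplicity p (n div p)" by (rule less.IH)
    moreover have "multiplicity p n = Suc (multiplicity p (n div p))"
      using multiplicity_times_same[of "n div p" p] \<open>n div p > 0\<close> True prime_gt_1_nat[OF p] by simp
    ultimately show ?thesis using True less.prems prime_gt_1_nat[OF p] by (simp add: ppart.simps[of p n])
  next
    case False
    then show ?thesis by (simp add: ppart.simps[of p n] not_dvd_imp_multiplicity_0)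
  qed
qed

lemma partitions_complete:
  assumes "sorted xs" "\<And>x. x \<in> set xs \<Longrightarrow> m \<le> x" "sum_list xs \<le> s" "length xs \<le> length ks"
  shows "xs \<in> set (partitions ks m s)"
  using assms
proof (induction ks arbitrary: xs m s)
  case (Cons k ks)
  show ?case
  proof (cases xs)
    case (Cons x ys)
    have "ys \<in> set (partitions ks x (s - x))"
      by (rule Cons.IH) (use Cons.prems \<open>xs = x # ys\<close> in auto)
    moreover have "m \<le> x" "x \<le> s" using Cons Cons.prems(2)[of x] Cons.prems(3) by auto
    then have "x \<in> set [m..<Suc s]" by (simp del: upt_Suc)
    ultimately have "xs \<in> (\<Union>a\<in>set [m..<Suc s]. (#) a ` set (partitions ks a (s - a)))"
      using Cons by blast
    then show ?thesis by (simp del: upt_Suc)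
  qed simp
qed simp

text \<open>Among positive integers, \<open>x\<close> to the power \<open>1 / x\<close> is largest
  at 3. Cubing keeps the inequality inside \<open>nat\<close>.\<close>

lemma cube_le_power_3: "(x::nat) ^ 3 \<le> 3 ^ x"
proof (cases "x < 3")
  case True
  then consider "x = 0" | "x = 1" | "x = 2" by linarith
  then show ?thesis by cases auto
next
  case False
  then have "3 \<le> x" by simp
  then show ?thesis
  proof (induction x rule: dec_induct)
    case (step x)
    have "Suc x ^ 3 = x ^ 3 + 3 * x ^ 2 + 3 * x + 1" by (simp add: power3_eq_cube power2_eq_square algebra_simps)
    moreover have "3 * x ^ 2 \<le> x ^ 3" using step by (simp add: power3_eq_cube power2_eq_square)
    moreover have "3 * x + 1 \<le> x ^ 3"
    proof -
      have "3 * x + 1 \<le> 3 * 3 * x" using step by simp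
      also have "\<dots> \<le> x * x * x" using step by (intro mult_mono) auto
      finally show ?thesis by (simp add: power3_eq_cube)
    qed
    ultimately show ?case using step.IH by simp
  qed simp
qed

text \<open>Factors with sum at most \<open>k\<close> have product at most 3 to the power
  \<open>k / 3\<close>; here the factors are the prime power parts of \<open>c\<close>. This is the
  origin of \<open>order_bounds\<close>.\<close>

lemma cube_le_power_prime_powers:
  assumes "c > 0" and "(\<Sum>q\<in>prime_factors c. q ^ multiplicity q c) \<le> k"
  shows "(c::nat) ^ 3 \<le> 3 ^ k"
proof -
  have "c = (\<Prod>q\<in>prime_factors c. q ^ multiplicity q c)" using prime_factorization_nat[OF assms(1)] .
  then have "c ^ 3 = (\<Prod>q\<in>prime_factors c. (q ^ multiplicity q c) ^ 3)" by (metis prod_power_distrib)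
  also have "\<dots> \<le> (\<Prod>q\<in>prime_factors c. 3 ^ (q ^ multiplicity q c))"
    by (rule prod_mono) (use cube_le_power_3 in auto)
  also have "\<dots> = 3 ^ (\<Sum>q\<in>prime_factors c. q ^ multiplicity q c)" by (simp add: power_sum)
  also have "\<dots> \<le> 3 ^ k" using assms(2) by (intro power_increasing) auto
  finally show ?thesis .
qed

lemma order_bounds_cube: "list_all (\<lambda>k. 3 ^ k < Suc (order_bounds ! k) ^ 3) [0..<16]"
  by code_simp

lemma le_order_bounds:
  assumes "k \<le> 15" "c ^ 3 \<le> 3 ^ k" shows "c \<le> order_bounds ! k"
proof (rule ccontr)
  assume "\<not> ?thesis"
  then have "Suc (order_bounds ! k) ^ 3 \<le> c ^ 3" by (intro power_mono) auto
  moreover have "3 ^ k < Suc (order_bounds ! k) ^ 3"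
    using order_bounds_cube assms(1) by (simp add: list_all_iff del: upt_Suc)
  ultimately show False using assms(2) by linarith
qed

lemma small_primes_complete: "prime p \<Longrightarrow> p \<le> 15 \<Longrightarrow> p \<in> set small_primes"
proof -
  assume p: "prime p" "p \<le> 15"
  have "2 dvd p \<longrightarrow> p = 2" "3 dvd p \<longrightarrow> p = 3" using p(1) by (auto simp: prime_nat_iff)
  moreover have "p \<ge> 2" using prime_ge_2_nat[OF p(1)] .
  moreover have "p \<in> {2..15}" using p calculation by simp
  then have "p \<in> {2,3,4,5,6,7,8,9,10,11,12,13,14,15}"
    unfolding insert_iff empty_iff atLeastAtMost_iff by presburger
  ultimately show ?thesis by (auto simp: small_primes_def)
qed

lemma small_primes_prime: "p \<in> set small_primes \<Longrightarrow> prime p"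
  by (auto simp: small_primes_def)

text \<open>Turns the executable sums in \<open>landau\<close> and \<open>order_candidates\<close>
  into sums over \<open>prime_factors\<close>.\<close>

lemma sum_list_small_primes:
  assumes "n > 0" "\<And>p. prime p \<Longrightarrow> p dvd n \<Longrightarrow> p \<le> 15"
  shows "sum_list (map (\<lambda>p. if p dvd n then f p else 0) small_primes) = (\<Sum>p\<in>prime_factors n. f p :: nat)"
proof -
  have "distinct small_primes" by (simp add: small_primes_def)
  then have "sum_list (map (\<lambda>p. if p dvd n then f p else 0) small_primes) = (\<Sum>p\<in>set small_primes. if p dvd n then f p else 0)"
    by (rule sum_list_distinct_conv_sum_set)
  also have "\<dots> = (\<Sum>p\<in>{p \<in> set small_primes. p dvd n}. f p)" by (simp add: sum.inter_filter)
  also have "{p \<in> set small_primes. p dvd n} = prime_factors n"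
    using assms small_primes_complete small_primes_prime by (auto simp: in_prime_factors_iff)
  finally show ?thesis .
qed

lemma product_lists_memI:
  "length xs = length xss \<Longrightarrow> (\<And>i. i < length xs \<Longrightarrow> xs ! i \<in> set (xss ! i)) \<Longrightarrow> xs \<in> set (product_lists xss)"
  by (simp add: product_lists_set list_all2_conv_all_nth in_set_conv_nth)

text \<open>An entry \<open>(n, c)\<close> of \<open>os\<close> stands for a conjugacy class of \<open>n\<close> maximal cyclic subgroups of
  order \<open>c\<close> in a simple group of order \<open>N\<close>, and \<open>\<nu> p\<close> for the number of Sylow \<open>p\<close>-subgroups.\<close>

locale orbit_data =
  fixes N :: nat and os :: "(nat \<times> nat) list" and \<nu> :: "nat \<Rightarrow> nat"
  assumes nonempty: "os \<noteq> []" and sorted: "sorted (map fst os)" and sum: "sum_list (map fst os) \<le> 30"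
    and orbit: "\<And>n c. (n, c) \<in> set os \<Longrightarrow> 1 < n \<and> 1 < c \<and> n * c dvd N \<and> 2 * N dvd fact n"
    and count: "N + sum_list (map fst os) \<le> 1 + sum_list (map (\<lambda>(n, c). n * c) os)"
    and central: "\<And>p. prime p \<Longrightarrow> p dvd N \<Longrightarrow>
      \<exists>(n, c)\<in>set os. \<exists>m. m dvd n \<and> 1 < m \<and> \<not> p dvd m \<and> p dvd c \<and> 2 * N dvd fact m"
    and sylow: "\<And>p. prime p \<Longrightarrow> p dvd N \<Longrightarrow>
      \<nu> p mod p = 1 \<and> 1 < \<nu> p \<and> \<nu> p * p ^ multiplicity p N dvd N \<and> 2 * N dvd fact (\<nu> p)"
    and sylow_orbit: "\<And>p n c. prime p \<Longrightarrow> p dvd N \<Longrightarrow> (n, c) \<in> set os \<Longrightarrow> p ^ multiplicity p N dvd c \<Longrightarrow>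
      \<nu> p dvd n \<and> (c = p ^ multiplicity p N \<longrightarrow> n = \<nu> p)"
    and sylow_unique: "\<And>p. prime p \<Longrightarrow> p dvd N \<Longrightarrow> length (filter (\<lambda>(n, c). c = p ^ multiplicity p N) os) \<le> 1"
    and sylow_gt: "\<And>p q n c. prime p \<Longrightarrow> multiplicity p N = 1 \<Longrightarrow> (n, c) \<in> set os \<Longrightarrow> p dvd c \<Longrightarrow>
      prime q \<Longrightarrow> q \<noteq> p \<Longrightarrow> q dvd c \<Longrightarrow> p * q ^ multiplicity q c < \<nu> p"
    and landau: "\<And>n c n' c'. (n, c) \<in> set os \<Longrightarrow> (n', c') \<in> set os \<Longrightarrow>
      (\<Sum>q\<in>prime_factors c. q ^ multiplicity q c) \<le> n'"
    and prime_count: "1 + (\<Sum>p\<in>prime_factors N. if multiplicity p N = 1 then \<nu> p * (p - 1) else p ^ multiplicity p N) \<le> N"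
begin

section \<open>Bounds on the orbit lengths\<close>

lemma N_pos: "0 < N"
proof -
  obtain n c where "(n, c) \<in> set os" using nonempty by (metis list.set_sel(1) surj_pair)
  then have "2 * N dvd fact n" using orbit by blast
  then show ?thesis by (cases "N = 0") (auto simp: fact_nonzero)
qed

text \<open>Numerical counterpart of the solvability of the alternating group of degree 4. No group
  is at hand, so degrees 2, 3, 4 are refuted by size and by \<open>central\<close>: for
  \<open>m = 3\<close> one gets \<open>N = 3\<close>, with no index prime to 3; for
  \<open>m = 4\<close> the index at the prime 2 must be 3, which makes 12 divide \<open>N\<close>
  against \<open>2 * N dvd fact 3\<close>.\<close>

lemma index_ge_5:
  assumes m: "1 < m" "m dvd N" "2 * N dvd fact m" shows "5 \<le> m"
proof (rule ccontr)
  assume "\<not> 5 \<le> m"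
  then consider "m = 2" | "m = 3" | "m = 4" using m(1) by linarith
  then show False
  proof cases
    case 1
    then have "N \<le> 1" using m(3) dvd_imp_le[OF m(3)] by (simp add: fact_numeral)
    then show False using 1 m(2) N_pos dvd_imp_le[of m N] by simp
  next
    case 2
    have "2 * N \<le> 6" using dvd_imp_le[OF m(3)] 2 by (simp add: fact_numeral)
    then have "N = 3" using 2 m(2) N_pos dvd_imp_le[of m N] by simp
    then obtain n c k where "(n, c) \<in> set os" "k dvd n" "1 < k" "\<not> 3 dvd k"
      using central[of 3] by auto
    then have "k dvd 3" using orbit[of n c] \<open>N = 3\<close> by (metis dvd_mult_left dvd_trans)
    then have "k \<le> 3" by (simp add: dvd_imp_le)
    then have "k = 2 \<or> k = 3" using \<open>1 < k\<close> by auto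
    then have "k = 3" using \<open>k dvd 3\<close> by auto
    then show False using \<open>\<not> 3 dvd k\<close> by simp
  next
    case 3
    have "2 * N dvd 24" using m(3) 3 by (simp add: fact_numeral)
    then have N: "N dvd 12" "4 dvd N" using m(2) 3 by auto
    then have "2 dvd N" by auto
    then obtain n c k where k: "(n, c) \<in> set os" "k dvd n" "1 < k" "\<not> 2 dvd k" "2 * N dvd fact k"
      using central[of 2] by auto
    then have "k dvd N" using orbit[of n c] by (metis dvd_mult_left dvd_trans)
    then have "k dvd 12" using N(1) by (rule dvd_trans)
    then have "k \<le> 12" by (simp add: dvd_imp_le)
    then have "k \<in> {2,3,4,5,6,7,8,9,10,11,12}"
      unfolding insert_iff empty_iff using k(3) by presburger
    then have k3: "k = 3" using \<open>k dvd 12\<close> k(4) by auto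
    have "3 dvd N" using \<open>k dvd N\<close> k3 by simp
    then have "12 dvd N" using N(2) by presburger
    then have "12 \<le> N" using N_pos dvd_imp_le by fastforce
    moreover have "2 * N \<le> 6" using k(5) k3 dvd_imp_le by (fastforce simp: fact_numeral)
    ultimately show False by simp
  qed
qed


definition k where "k = fst (hd os)"
definition ns where "ns = map fst os"
definition cs where "cs = map snd os"

lemma zip_ns_cs: "zip ns cs = os"
  by (simp add: ns_def cs_def zip_map_fst_snd)

lemma ns_nonempty: "ns \<noteq> []" "hd ns = k"
  using nonempty by (auto simp: ns_def k_def hd_map)

lemma k_orbit: obtains c where "(k, c) \<in> set os"
  using nonempty unfolding k_def by (metis hd_in_set prod.collapse)

lemma orbit_dvd: "(n, c) \<in> set os \<Longrightarrow> n dvd N" "(n, c) \<in> set os \<Longrightarrow> c dvd N"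
  using orbit[of n c] by (metis dvd_mult_left dvd_trans, metis dvd_mult_right dvd_trans)

lemma orbit_ge_5: "(n, c) \<in> set os \<Longrightarrow> 5 \<le> n"
  using index_ge_5[of n] orbit[of n c] orbit_dvd[of n c] by blast

lemma length_ns: "length ns \<le> 6"
proof -
  have "sum_list (map (\<lambda>x. 5) ns) \<le> sum_list (map (\<lambda>x. x) ns)"
    by (rule sum_list_mono) (use orbit_ge_5 in \<open>auto simp: ns_def\<close>)
  then show ?thesis using sum by (simp add: ns_def sum_list_triv o_def)
qed

lemma ns_partition: "ns \<in> set (tl (partitions [1, 2, 3, 4, 5, 6] 5 30))"
proof -
  have "ns \<in> set (partitions [1, 2, 3, 4, 5, 6] 5 30)"
    by (rule partitions_complete)
      (use sorted sum length_ns orbit_ge_5 in \<open>auto simp: ns_def\<close>)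
  moreover have "partitions [1, 2, 3, 4, 5, 6] 5 30 = [] # tl (partitions [1, 2, 3, 4, 5, 6] 5 30)"
    by (simp only: partitions.simps append_Cons append_Nil list.sel)
  ultimately show ?thesis using ns_nonempty(1) by (metis set_ConsD)
qed

text \<open>With one orbit, \<open>count\<close> contradicts \<open>n * c dvd N\<close>. With two or
  more, the smallest length is at most half of 30.\<close>

lemma k_le_15: "k \<le> 15"
proof (cases os)
  case Nil
  then show ?thesis using nonempty by simp
next
  case (Cons x xs)
  obtain n c where x: "x = (n, c)" by force
  show ?thesis
  proof (cases xs)
    case Nil
    then have "N + n \<le> 1 + n * c" "1 < n" "n * c dvd N"
      using count orbit[of n c] Cons x by auto
    moreover from this have "n * c \<le> N" using N_pos by (simp add: dvd_imp_le)
    ultimately show ?thesis by linarith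
  next
    case (Cons y ys)
    then have "fst x + fst y \<le> 30" using sum \<open>os = x # xs\<close> by simp
    moreover have "fst x \<le> fst y" using sorted \<open>os = x # xs\<close> Cons by simp
    ultimately show ?thesis unfolding k_def using \<open>os = x # xs\<close> by simp
  qed
qed

section \<open>Soundness of the search filters\<close>

lemma N_dvd_fact: "2 * N dvd fact k"
  using k_orbit orbit by blast

lemma factorial_okI: "2 * N dvd fact m \<Longrightarrow> factorial_ok k N m"
  by (simp add: factorial_ok_def)

lemma prime_le_index: "prime p \<Longrightarrow> p dvd N \<Longrightarrow> 2 * N dvd fact m \<Longrightarrow> p \<le> m"
  by (metis dvd_trans dvd_triv_right prime_dvd_fact_iff)

lemma prime_le_15: "prime p \<Longrightarrow> p dvd N \<Longrightarrow> p \<le> 15"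
  using prime_le_index[OF _ _ N_dvd_fact] k_le_15 le_trans by blast

lemma indices_mem: "m \<in> set (indices ns) \<longleftrightarrow> 5 \<le> m \<and> (\<exists>n\<in>set ns. m \<le> n \<and> m dvd n)"
  by (auto simp: indices_def less_Suc_eq_le simp del: upt_Suc)

lemma index_listed:
  assumes "(n, c) \<in> set os" "m dvd n" "5 \<le> m" "m \<le> n" shows "m \<in> set (indices ns)"
proof -
  have "n \<in> set ns" unfolding ns_def using imageI[OF assms(1), of fst] by simp
  then show ?thesis using assms indices_mem by blast
qed

lemma central_index:
  assumes "prime p" "p dvd N"
  obtains n c m where "(n, c) \<in> set os" "m dvd n" "5 \<le> m" "m \<le> n" "\<not> p dvd m" "p dvd c" "2 * N dvd fact m"
proof -
  obtain n c m where *: "(n, c) \<in> set os" "m dvd n" "1 < m" "\<not> p dvd m" "p dvd c" "2 * N dvd fact m"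
    using central[OF assms] by auto
  have "m dvd N" using * orbit_dvd(1) dvd_trans by blast
  then have "5 \<le> m" using index_ge_5 * by blast
  moreover have "m \<le> n" using *(2) orbit_ge_5[OF *(1)] by (intro dvd_imp_le) auto
  ultimately show thesis using that * by blast
qed

lemma sylow_number_listed:
  assumes p: "prime p" "p dvd N" "ppart p N = p"
  shows "\<nu> p \<in> set (sylow_numbers k (indices ns) N p)"
proof -
  have m: "p ^ multiplicity p N = p" using ppart_prime[OF p(1) N_pos] p(3) by simp
  obtain n c where o: "(n, c) \<in> set os" "p dvd c" using central_index[OF p(1,2)] by metis
  have "\<nu> p dvd n" using sylow_orbit[OF p(1,2) o(1)] o(2) m by simp
  moreover have "\<nu> p \<le> n" using calculation orbit_ge_5[OF o(1)] by (intro dvd_imp_le) auto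
  moreover have s: "\<nu> p mod p = 1" "1 < \<nu> p" "\<nu> p * p dvd N" "2 * N dvd fact (\<nu> p)"
    using sylow[OF p(1,2)] m by auto
  moreover have "5 \<le> \<nu> p" using index_ge_5 s dvd_mult_left by blast
  ultimately show ?thesis using index_listed[OF o(1)] factorial_okI p(3) by (simp add: sylow_numbers_def)
qed

text \<open>The assumption \<open>landau\<close> is applied to the shortest orbit, which gives the
  sharpest bound.\<close>

lemma order_le_bound: "(n, c) \<in> set os \<Longrightarrow> c \<le> order_bounds ! k"
proof -
  assume o: "(n, c) \<in> set os"
  obtain c' where "(k, c') \<in> set os" using k_orbit by blast
  then have "c ^ 3 \<le> 3 ^ k" using cube_le_power_prime_powers[of c k] landau[OF o] orbit[OF o] by simp
  then show ?thesis by (rule le_order_bounds[OF k_le_15])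
qed

lemma N_le: "N \<le> 1 + sum_list ns * (order_bounds ! k - 1)"
proof -
  \<comment> \<open>Writing the bound on \<open>c\<close> as
    \<open>(order_bounds ! k - 1) + 1\<close> splits off the sum of the lengths, which cancels
    against the left side of \<open>count\<close>.\<close>
  have "sum_list (map (\<lambda>(n, c). n * c) os) \<le> sum_list (map (\<lambda>(n, c). n * (order_bounds ! k - 1) + n) os)"
  proof (rule sum_list_mono)
    fix x assume "x \<in> set os"
    moreover obtain n c where "x = (n, c)" by force
    ultimately have "1 < c" "c \<le> order_bounds ! k" using orbit order_le_bound by blast+
    then have "n * c \<le> n * ((order_bounds ! k - 1) + 1)" by (intro mult_le_mono) auto
    then show "(case x of (n, c) \<Rightarrow> n * c) \<le> (case x of (n, c) \<Rightarrow> n * (order_bounds ! k - 1) + n)"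
      using \<open>x = (n, c)\<close> by simp
  qed
  also have "\<dots> = sum_list ns * (order_bounds ! k - 1) + sum_list ns"
  proof -
    have "sum_list (map (\<lambda>(n, c). n * b + n) xs) = sum_list (map fst xs) * b + sum_list (map fst xs)"
      for b and xs :: "(nat \<times> nat) list"
      by (induction xs) (auto simp: algebra_simps)
    then show ?thesis unfolding ns_def .
  qed
  finally show ?thesis using count by (simp add: ns_def)
qed

lemma order_candidate: "N \<in> set (order_candidates ns)"
proof -
  define L where "L = foldr lcm ns 1"
  have L: "L dvd N"
  proof -
    have lcm: "foldr lcm xs 1 dvd N" if "\<forall>n\<in>set xs. n dvd N" for xs
      using that by (induction xs) auto
    show ?thesis unfolding L_def by (rule lcm) (use orbit_dvd(1) in \<open>auto simp: ns_def\<close>)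
  qed
  have "0 < L" using L N_pos by (metis dvd_0_left_iff gr0I less_irrefl)
  have Lf: "2 * L dvd fact k" using L N_dvd_fact by (metis dvd_trans mult_dvd_mono dvd_refl)
  \<comment> \<open>For a prime dividing \<open>L\<close> the index supplied by
    \<open>central\<close> is at least \<open>p\<close>, because \<open>p\<close> divides
    \<open>N\<close> and \<open>2 * N\<close> divides the factorial of that index.\<close>
  have ms: "list_all (\<lambda>p. if p dvd L then list_ex (\<lambda>m. if p \<le> m then \<not> p dvd m else False) (indices ns) else True) small_primes"
    unfolding list_all_iff list_ex_iff
  proof (intro ballI)
    fix p assume "p \<in> set small_primes"
    then have p: "prime p" by (rule small_primes_prime)
    show "if p dvd L then \<exists>m\<in>set (indices ns). if p \<le> m then \<not> p dvd m else False else True"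
    proof (cases "p dvd L")
      case True
      then have pN: "p dvd N" using L by (rule dvd_trans)
      obtain n c m where "(n, c) \<in> set os" "m dvd n" "5 \<le> m" "m \<le> n" "\<not> p dvd m" "2 * N dvd fact m"
        using central_index[OF p pN] by metis
      moreover from this have "p \<le> m" using prime_le_index[OF p pN] by blast
      ultimately show ?thesis using index_listed by (metis (full_types))
    qed simp
  qed
  have c1: "list_all (\<lambda>p. if p dvd N then
      if list_ex (\<lambda>m. if p dvd m then False else factorial_ok k N m) (indices ns) then
        (if ppart p N = p then sylow_numbers k (indices ns) N p \<noteq> [] else True) else False else True) small_primes"
    unfolding list_all_iff list_ex_iff
  proof (intro ballI)
    fix p assume "p \<in> set small_primes"
    then have p: "prime p" by (rule small_primes_prime)
    show "if p dvd N then
      if \<exists>m\<in>set (indices ns). if p dvd m then False else factorial_ok k N m then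
        (if ppart p N = p then sylow_numbers k (indices ns) N p \<noteq> [] else True) else False else True"
    proof (cases "p dvd N")
      case True
      obtain n c m where "(n, c) \<in> set os" "m dvd n" "5 \<le> m" "m \<le> n" "\<not> p dvd m" "2 * N dvd fact m"
        using central_index[OF p True] by metis
      then have "\<exists>m\<in>set (indices ns). if p dvd m then False else factorial_ok k N m"
        using factorial_okI index_listed by (metis (full_types))
      then show ?thesis using sylow_number_listed[OF p True] by auto
    qed simp
  qed
  have "1 + sum_list (map (\<lambda>p. if p dvd N then
       if ppart p N = p then Min (set (sylow_numbers k (indices ns) N p)) * (p - 1) else ppart p N else 0) small_primes)
     = 1 + (\<Sum>p\<in>prime_factors N. if ppart p N = p then Min (set (sylow_numbers k (indices ns) N p)) * (p - 1) else ppart p N)"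
    using sum_list_small_primes[OF N_pos prime_le_15] by simp
  \<comment> \<open>The smallest candidate is at most the true Sylow number, so the executable sum
    stays below the one in \<open>prime_count\<close>.\<close>
  also have "\<dots> \<le> 1 + (\<Sum>p\<in>prime_factors N. if multiplicity p N = 1 then \<nu> p * (p - 1) else p ^ multiplicity p N)"
  proof (intro add_left_mono sum_mono)
    fix p assume "p \<in> prime_factors N"
    then have p: "prime p" "p dvd N" by auto
    have pp: "ppart p N = p ^ multiplicity p N" by (rule ppart_prime[OF p(1) N_pos])
    have iff: "ppart p N = p \<longleftrightarrow> multiplicity p N = 1"
      unfolding pp using prime_gt_1_nat[OF p(1)] by (metis power_inject_exp power_one_right)
    show "(if ppart p N = p then Min (set (sylow_numbers k (indices ns) N p)) * (p - 1) else ppart p N)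
      \<le> (if multiplicity p N = 1 then \<nu> p * (p - 1) else p ^ multiplicity p N)"
      using iff pp sylow_number_listed[OF p] by (auto intro: mult_le_mono)
  qed
  also have "\<dots> \<le> N" by (rule prime_count)
  finally have c2: "1 + sum_list (map (\<lambda>p. if p dvd N then
       if ppart p N = p then Min (set (sylow_numbers k (indices ns) N p)) * (p - 1) else ppart p N else 0) small_primes) \<le> N" .
  obtain t where t: "N = L * t" using L by blast
  have "t \<le> (1 + sum_list ns * (order_bounds ! k - 1)) div L"
    using N_le \<open>0 < L\<close> unfolding t by (simp add: less_eq_div_iff_mult_less_eq mult.commute)
  moreover have "1 \<le> t" using t N_pos by (cases t) auto
  ultimately have "N \<in> set (map ((*) L) [1..<Suc ((1 + sum_list ns * (order_bounds ! k - 1)) div L)])"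
    using t by (auto simp del: upt_Suc)
  then show ?thesis
    unfolding order_candidates_def Let_def ns_nonempty(2) L_def[symmetric]
    using k_le_15 Lf ms c1 c2 N_dvd_fact by (simp del: upt_Suc set_map)
qed


lemma landau_le: assumes o: "(n, c) \<in> set os" shows "landau c \<le> k"
proof -
  have c: "0 < c" "c dvd N" using orbit[OF o] orbit_dvd[OF o] by auto
  have "landau c = (\<Sum>p\<in>prime_factors c. ppart p c)"
    unfolding landau_def
    by (rule sum_list_small_primes[OF c(1)]) (use prime_le_15 c(2) dvd_trans in blast)
  also have "\<dots> = (\<Sum>p\<in>prime_factors c. p ^ multiplicity p c)"
    by (rule sum.cong[OF refl]) (use ppart_prime[OF _ c(1)] in auto)
  also have "\<dots> \<le> k" using k_orbit landau[OF o] by metis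
  finally show ?thesis .
qed

lemma order_choice: "cs \<in> set (order_choices N ns)"
proof -
  define g where "g n = filter (\<lambda>c. if n * c dvd N then landau c \<le> k else False) [2..<Suc (order_bounds ! k)]" for n
  have g: "c \<in> set (g n)" if o: "(n, c) \<in> set os" for n c
    using orbit[OF o] landau_le[OF o] order_le_bound[OF o] by (auto simp: g_def simp del: upt_Suc)
  have "sum_list (map (\<lambda>(n, c). n * c) os) \<le> sum_list (map (\<lambda>(n, c). n * Max (set (1 # g n))) os)"
  proof (rule sum_list_mono)
    fix x assume x: "x \<in> set os"
    obtain n c where nc: "x = (n, c)" by force
    have "c \<le> Max (set (1 # g n))" using g[of n c] x nc by (intro Max_ge) auto
    then show "(case x of (n, c) \<Rightarrow> n * c) \<le> (case x of (n, c) \<Rightarrow> n * Max (set (1 # g n)))"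
      using nc by simp
  qed
  also have "map (\<lambda>(n, c). n * Max (set (1 # g n))) os = map (\<lambda>(n, cs). n * Max (set (1 # cs))) (zip ns (map g ns))"
  proof -
    have zip: "zip xs (map g xs) = map (\<lambda>n. (n, g n)) xs" for xs by (induction xs) auto
    show ?thesis unfolding zip by (simp add: ns_def o_def case_prod_beta)
  qed
  finally have "N + sum_list ns \<le> 1 + sum_list (map (\<lambda>(n, cs). n * Max (set (1 # cs))) (zip ns (map g ns)))"
    using count by (simp add: ns_def)
  moreover have "cs \<in> set (product_lists (map g ns))"
  proof (rule product_lists_memI)
    show "length cs = length (map g ns)" by (simp add: cs_def ns_def)
    fix i assume "i < length cs"
    then have i: "i < length os" by (simp add: cs_def)
    then have "(fst (os ! i), snd (os ! i)) \<in> set os" by simp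
    from g[OF this] show "cs ! i \<in> set (map g ns ! i)" using i by (simp add: cs_def ns_def)
  qed
  ultimately show ?thesis
    unfolding order_choices_def Let_def ns_nonempty(2) g_def[symmetric] by simp
qed

lemma sylow_number_ok:
  assumes p: "prime p" "p dvd N" shows "sylow_ok N os p (\<nu> p)"
proof -
  define a where "a = ppart p N"
  have a: "a = p ^ multiplicity p N" unfolding a_def by (rule ppart_prime[OF p(1) N_pos])
  note s = sylow[OF p, folded a]
  have "list_all (\<lambda>(n, c). if \<nu> p dvd n then (if c = a then n = \<nu> p else True) \<and>
       (if a = p then list_all (\<lambda>q. if q = p then True else if q dvd c then p * ppart q c < \<nu> p else True) small_primes
        else True) else False) (filter (\<lambda>(n, c). a dvd c) os)"
    unfolding list_all_iff
  proof (rule ballI, clarify)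
    fix n c assume "(n, c) \<in> set (filter (\<lambda>(n, c). a dvd c) os)"
    then have o: "(n, c) \<in> set os" "a dvd c" by auto
    have 1: "\<nu> p dvd n" "c = a \<longrightarrow> n = \<nu> p" using sylow_orbit[OF p o(1)] o(2) a by auto
    have 2: "\<forall>q\<in>set small_primes. if q = p then True else if q dvd c then p * ppart q c < \<nu> p else True" if ap: "a = p"
    proof
      fix q assume "q \<in> set small_primes"
      then have q: "prime q" by (rule small_primes_prime)
      have "multiplicity p N = 1" using ap a prime_gt_1_nat[OF p(1)] by (metis power_inject_exp power_one_right)
      moreover have "0 < c" using orbit[OF o(1)] by simp
      ultimately show "if q = p then True else if q dvd c then p * ppart q c < \<nu> p else True"
        using sylow_gt[OF p(1) _ o(1) _ q] o(2) ap ppart_prime[OF q] by auto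
    qed
    show "if \<nu> p dvd n then (if c = a then n = \<nu> p else True) \<and>
       (if a = p then \<forall>q\<in>set small_primes. if q = p then True else if q dvd c then p * ppart q c < \<nu> p else True
        else True) else False" using 1 2 by simp
  qed
  moreover have "length (filter (\<lambda>(n, c). c = a) os) \<le> 1" using sylow_unique[OF p] a by simp
  ultimately show ?thesis
    unfolding sylow_ok_def Let_def a_def[symmetric] k_def[symmetric]
    using s factorial_okI by simp
qed

lemma not_excluded: "\<not> excluded N os"
proof -
  have "\<not> (if p dvd N then
       if list_ex (\<lambda>(n, c). if p dvd c then list_ex (\<lambda>m. if m dvd n then if p dvd m then False else factorial_ok (fst (hd os)) N m else False) [5..<Suc n] else False) os
       then \<not> list_ex (sylow_ok N os p) (if list_ex (\<lambda>(n, c). ppart p N dvd c) os then [5..<31] else [5..<Suc (N div ppart p N)])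
       else True
      else False)" if "p \<in> set small_primes" for p
  proof (cases "p dvd N")
    case True
    have p: "prime p" using that by (rule small_primes_prime)
    obtain n c m where o: "(n, c) \<in> set os" "m dvd n" "5 \<le> m" "m \<le> n" "\<not> p dvd m" "p dvd c" "2 * N dvd fact m"
      using central_index[OF p True] by metis
    have "list_ex (\<lambda>m. if m dvd n then if p dvd m then False else factorial_ok (fst (hd os)) N m else False) [5..<Suc n]"
      unfolding list_ex_iff using o factorial_okI[OF o(7)]
      by (intro bexI[of _ m]) (auto simp: k_def simp del: upt_Suc)
    then have 1: "list_ex (\<lambda>(n, c). if p dvd c then list_ex (\<lambda>m. if m dvd n then if p dvd m then False else factorial_ok (fst (hd os)) N m else False) [5..<Suc n] else False) os"
      unfolding list_ex_iff[of _ os] using o(1,6) by (intro bexI[of _ "(n, c)"]) auto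
    have a: "ppart p N = p ^ multiplicity p N" by (rule ppart_prime[OF p N_pos])
    note s = sylow[OF p True]
    have s5: "5 \<le> \<nu> p" using index_ge_5 s dvd_mult_left by blast
    \<comment> \<open>Either \<open>\<nu> p\<close> divides the length of an orbit and the lengths
      sum to at most 30, or the index of a Sylow subgroup bounds it.\<close>
    have "\<nu> p \<in> set (if list_ex (\<lambda>(n, c). ppart p N dvd c) os then [5..<31] else [5..<Suc (N div ppart p N)])"
    proof (cases "list_ex (\<lambda>(n, c). ppart p N dvd c) os")
      case True
      then obtain n c where nc: "(n, c) \<in> set os" "ppart p N dvd c" by (auto simp: list_ex_iff)
      have "\<nu> p dvd n" using sylow_orbit[OF p \<open>p dvd N\<close> nc(1)] nc(2) a by simp
      then have "\<nu> p \<le> n" using orbit_ge_5[OF nc(1)] by (intro dvd_imp_le) auto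
      also have "n \<le> sum_list ns" using imageI[OF nc(1), of fst] by (intro member_le_sum_list) (simp_all add: ns_def)
      also have "\<dots> \<le> 30" using sum by (simp add: ns_def)
      finally have "\<nu> p \<in> set [5..<31]" unfolding set_upt using s5 by simp
      then show ?thesis by (simp only: True if_True)
    next
      case False
      have "\<nu> p * ppart p N \<le> N" using s N_pos a by (simp add: dvd_imp_le)
      moreover have "0 < ppart p N" using a prime_gt_0_nat[OF p] by simp
      ultimately have "\<nu> p \<le> N div ppart p N" by (simp add: less_eq_div_iff_mult_less_eq)
      then show ?thesis using False s5 by (simp del: upt_Suc)
    qed
    then have 2: "list_ex (sylow_ok N os p) (if list_ex (\<lambda>(n, c). ppart p N dvd c) os then [5..<31] else [5..<Suc (N div ppart p N)])"
      unfolding list_ex_iff[of "sylow_ok N os p"] using sylow_number_ok[OF p True] by blast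
    show ?thesis by (simp only: 1 2 True if_True not_True_eq_False not_False_eq_True)
  qed simp
  then show ?thesis
    unfolding excluded_def using count by (auto simp: list_ex_iff simp del: upt_Suc)
qed

lemma outcome: "outcome N os"
proof -
  have "if excluded N (zip ns cs) then True else outcome N (zip ns cs)"
    using enumeration ns_partition order_candidate order_choice unfolding list_all_iff by blast
  then show ?thesis using not_excluded zip_ns_cs by simp
qed

end

section \<open>Conjugation of subsets\<close>

context group
begin

definition conj_set :: "'a \<Rightarrow> 'a set \<Rightarrow> 'a set" where
  "conj_set g S = (\<lambda>x. g \<otimes> x \<otimes> inv g) ` S"

text \<open>The stabilizer of a set under conjugation: the normalizer for a subgroup, the
  centralizer of \<open>y\<close> for the singleton \<open>{y}\<close>. Both occur below.\<close>

definition normr :: "'a set \<Rightarrow> 'a set" where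
  "normr S = {g \<in> carrier G. conj_set g S = S}"

text \<open>The acting subgroup is a parameter because the whole group, Sylow subgroups, maximal
  cyclic subgroups and a normalizer all act later on.\<close>

definition conj_orbit :: "'a set \<Rightarrow> 'a set \<Rightarrow> 'a set set" where
  "conj_orbit H S = (\<lambda>g. conj_set g S) ` H"

lemma conj_set_subset: "g \<in> carrier G \<Longrightarrow> S \<subseteq> carrier G \<Longrightarrow> conj_set g S \<subseteq> carrier G"
  by (auto simp: conj_set_def)

lemma conj_set_one: "S \<subseteq> carrier G \<Longrightarrow> conj_set \<one> S = S"
  by (force simp: conj_set_def)

lemma conj_set_mult:
  assumes "g \<in> carrier G" "h \<in> carrier G" "S \<subseteq> carrier G"
  shows "conj_set g (conj_set h S) = conj_set (g \<otimes> h) S"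
proof -
  have "g \<otimes> (h \<otimes> x \<otimes> inv h) \<otimes> inv g = g \<otimes> h \<otimes> x \<otimes> inv (g \<otimes> h)" if "x \<in> S" for x
    using assms that by (simp add: inv_mult_group m_assoc subset_iff)
  then show ?thesis unfolding conj_set_def image_image by (rule image_cong[OF refl])
qed

lemma conj_set_inv:
  "g \<in> carrier G \<Longrightarrow> S \<subseteq> carrier G \<Longrightarrow> conj_set (inv g) (conj_set g S) = S"
  "g \<in> carrier G \<Longrightarrow> S \<subseteq> carrier G \<Longrightarrow> conj_set g (conj_set (inv g) S) = S"
  by (simp_all add: conj_set_mult conj_set_one)

lemma inj_on_conj: "g \<in> carrier G \<Longrightarrow> S \<subseteq> carrier G \<Longrightarrow> inj_on (\<lambda>x. g \<otimes> x \<otimes> inv g) S"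
  by (auto simp: inj_on_def subset_iff)

lemma card_conj_set: "g \<in> carrier G \<Longrightarrow> S \<subseteq> carrier G \<Longrightarrow> card (conj_set g S) = card S"
  unfolding conj_set_def by (rule card_image[OF inj_on_conj])

lemma conj_mult:
  "g \<in> carrier G \<Longrightarrow> x \<in> carrier G \<Longrightarrow> y \<in> carrier G \<Longrightarrow>
   g \<otimes> (x \<otimes> y) \<otimes> inv g = (g \<otimes> x \<otimes> inv g) \<otimes> (g \<otimes> y \<otimes> inv g)"
  by (simp add: m_assoc inv_solve_left)

lemma conj_pow:
  "g \<in> carrier G \<Longrightarrow> x \<in> carrier G \<Longrightarrow> (g \<otimes> x \<otimes> inv g) [^] (n::nat) = g \<otimes> x [^] n \<otimes> inv g"
  by (induction n) (simp_all add: conj_mult)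

lemma conj_inv:
  "g \<in> carrier G \<Longrightarrow> x \<in> carrier G \<Longrightarrow> inv (g \<otimes> x \<otimes> inv g) = g \<otimes> inv x \<otimes> inv g"
  by (simp add: inv_mult_group m_assoc)

lemma subgroup_conj_set:
  assumes "subgroup H G" "g \<in> carrier G"
  shows "subgroup (conj_set g H) G"
proof (rule subgroupI)
  show "conj_set g H \<subseteq> carrier G"
    using conj_set_subset[OF assms(2) subgroup.subset[OF assms(1)]] .
  show "conj_set g H \<noteq> {}"
    using subgroup.one_closed[OF assms(1)] by (auto simp: conj_set_def)
next
  fix a assume "a \<in> conj_set g H"
  then obtain x where "x \<in> H" "a = g \<otimes> x \<otimes> inv g" by (auto simp: conj_set_def)
  then show "inv a \<in> conj_set g H"
    unfolding conj_set_def
    using assms subgroup.mem_carrier[OF assms(1)] subgroup.m_inv_closed[OF assms(1)]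
    by (intro image_eqI[of _ _ "inv x"]) (simp_all add: conj_inv)
next
  fix a b assume "a \<in> conj_set g H" "b \<in> conj_set g H"
  then obtain x y where "x \<in> H" "a = g \<otimes> x \<otimes> inv g" "y \<in> H" "b = g \<otimes> y \<otimes> inv g"
    by (auto simp: conj_set_def)
  then show "a \<otimes> b \<in> conj_set g H"
    unfolding conj_set_def
    using assms subgroup.mem_carrier[OF assms(1)] subgroup.m_closed[OF assms(1)]
    by (intro image_eqI[of _ _ "x \<otimes> y"]) (simp_all add: conj_mult)
qed

lemma subgroup_normr: "S \<subseteq> carrier G \<Longrightarrow> subgroup (normr S) G"
proof (rule subgroupI)
  assume S: "S \<subseteq> carrier G"
  show "normr S \<subseteq> carrier G" by (auto simp: normr_def)
  show "normr S \<noteq> {}" using conj_set_one[OF S] by (auto simp: normr_def)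
  show "inv a \<in> normr S" if "a \<in> normr S" for a
    using that conj_set_inv(1)[of a S] S by (auto simp: normr_def)
  show "a \<otimes> b \<in> normr S" if "a \<in> normr S" "b \<in> normr S" for a b
    using that conj_set_mult[of a b S] S by (auto simp: normr_def)
qed

lemma subgroup_subset_normr:
  assumes "subgroup H G" shows "H \<subseteq> normr H"
proof
  fix g assume g: "g \<in> H"
  have H: "H \<subseteq> carrier G" using subgroup.subset[OF assms] .
  have sub: "conj_set h H \<subseteq> H" if "h \<in> H" for h
    using that subgroup.m_closed[OF assms] subgroup.m_inv_closed[OF assms] by (auto simp: conj_set_def)
  have "H = conj_set g (conj_set (inv g) H)" using g H by (simp add: conj_set_inv subset_iff)
  also have "\<dots> \<subseteq> conj_set g H"
    using image_mono[OF sub[OF subgroup.m_inv_closed[OF assms g]]] by (simp add: conj_set_def)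
  finally show "g \<in> normr H" using sub[OF g] g H by (auto simp: normr_def)
qed

lemma conj_orbit_subset:
  "H \<subseteq> carrier G \<Longrightarrow> S \<subseteq> carrier G \<Longrightarrow> conj_orbit H S \<subseteq> Pow (carrier G)"
  using conj_set_subset unfolding conj_orbit_def by blast

lemma finite_conj_orbit: "finite H \<Longrightarrow> finite (conj_orbit H S)"
  by (simp add: conj_orbit_def)

lemma conj_orbit_self: "subgroup H G \<Longrightarrow> S \<subseteq> carrier G \<Longrightarrow> S \<in> conj_orbit H S"
  unfolding conj_orbit_def by (rule image_eqI[of _ _ \<one>]) (simp_all add: conj_set_one subgroup.one_closed)

lemma conj_orbit_closed:
  assumes "subgroup H G" "S \<subseteq> carrier G" "T \<in> conj_orbit H S" "g \<in> H"
  shows "conj_set g T \<in> conj_orbit H S"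
  using assms subgroup.mem_carrier[OF assms(1)] subgroup.m_closed[OF assms(1)]
  by (auto simp: conj_orbit_def conj_set_mult)

lemma conj_orbit_eq:
  assumes H: "subgroup H G" and S: "S \<subseteq> carrier G" and T: "T \<in> conj_orbit H S"
  shows "conj_orbit H T = conj_orbit H S"
proof -
  obtain g where g: "g \<in> H" "T = conj_set g S" using T by (auto simp: conj_orbit_def)
  have gc: "g \<in> carrier G" and TS: "T \<subseteq> carrier G"
    using g S subgroup.mem_carrier[OF H] conj_set_subset[OF _ S] by auto
  have "S = conj_set (inv g) T" using g gc S by (simp add: conj_set_inv)
  then have S': "S \<in> conj_orbit H T"
    unfolding conj_orbit_def by (rule image_eqI) (rule subgroup.m_inv_closed[OF H g(1)])
  show ?thesis
  proof (rule equalityI)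
    show "conj_orbit H T \<subseteq> conj_orbit H S"
      using conj_orbit_closed[OF H S T] by (auto simp: conj_orbit_def)
    show "conj_orbit H S \<subseteq> conj_orbit H T"
      using conj_orbit_closed[OF H TS S'] by (auto simp: conj_orbit_def)
  qed
qed

text \<open>Orbit-stabilizer: \<open>H\<close> is partitioned into the fibres of
  \<open>g \<mapsto> conj_set g S\<close>, and each fibre is a left coset of the stabilizer
  \<open>H \<inter> normr S\<close>.\<close>

lemma card_conj_orbit:
  assumes fin: "finite (carrier G)" and H: "subgroup H G" and S: "S \<subseteq> carrier G"
  shows "card (conj_orbit H S) * card (H \<inter> normr S) = card H"
proof -
  have Hc: "H \<subseteq> carrier G" using subgroup.subset[OF H] .
  then have finH: "finite H" using fin finite_subset by blast
  have fib: "card {g \<in> H. conj_set g S = T} = card (H \<inter> normr S)" if T: "T \<in> conj_orbit H S" for T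
  proof -
    obtain a where a: "a \<in> H" "T = conj_set a S" using T by (auto simp: conj_orbit_def)
    have ac: "a \<in> carrier G" using a Hc by blast
    have "bij_betw ((\<otimes>) a) (H \<inter> normr S) {g \<in> H. conj_set g S = T}"
    proof (rule bij_betwI[where g = "(\<otimes>) (inv a)"])
      show "(\<otimes>) a \<in> H \<inter> normr S \<rightarrow> {g \<in> H. conj_set g S = T}"
        using a ac S subgroup.m_closed[OF H] by (auto simp: normr_def simp flip: conj_set_mult)
      show "(\<otimes>) (inv a) \<in> {g \<in> H. conj_set g S = T} \<rightarrow> H \<inter> normr S"
        using a ac S Hc subgroup.m_closed[OF H] subgroup.m_inv_closed[OF H]
        by (auto simp: normr_def subset_iff conj_set_inv simp flip: conj_set_mult)
    qed (use a ac Hc in \<open>auto simp: subset_iff normr_def simp flip: m_assoc\<close>)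
    then show ?thesis by (simp add: bij_betw_same_card)
  qed
  have "card H = card (\<Union>T\<in>conj_orbit H S. {g \<in> H. conj_set g S = T})"
    by (rule arg_cong[of _ _ card]) (auto simp: conj_orbit_def)
  also have "\<dots> = (\<Sum>T\<in>conj_orbit H S. card {g \<in> H. conj_set g S = T})"
    by (rule card_UN_disjoint) (use finH in \<open>auto simp: finite_conj_orbit\<close>)
  also have "\<dots> = card (conj_orbit H S) * card (H \<inter> normr S)"
    using fib by simp
  finally show ?thesis by simp
qed

text \<open>The invariant family \<open>E\<close> is a disjoint union of \<open>H\<close>-orbits,
  and \<open>k\<close> divides the length of each.\<close>

lemma dvd_card_conj_invariant:
  assumes H: "subgroup H G" and fE: "finite E" and E: "E \<subseteq> Pow (carrier G)"
    and inv: "\<And>g S. g \<in> H \<Longrightarrow> S \<in> E \<Longrightarrow> conj_set g S \<in> E"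
    and dvd: "\<And>S. S \<in> E \<Longrightarrow> k dvd card (conj_orbit H S)"
  shows "k dvd card E"
proof -
  have U: "\<Union>(conj_orbit H ` E) = E"
  proof (intro equalityI subsetI)
    show "T \<in> E" if "T \<in> \<Union>(conj_orbit H ` E)" for T
      using that inv by (auto simp: conj_orbit_def)
    show "T \<in> \<Union>(conj_orbit H ` E)" if "T \<in> E" for T
      using that conj_orbit_self[OF H, of T] E by blast
  qed
  have disj: "A \<inter> B = {}" if AB: "A \<in> conj_orbit H ` E" "B \<in> conj_orbit H ` E" "A \<noteq> B" for A B
  proof (rule ccontr)
    assume "A \<inter> B \<noteq> {}"
    then obtain R where R: "R \<in> A" "R \<in> B" by blast
    obtain S T where S: "A = conj_orbit H S" "S \<subseteq> carrier G" and T: "B = conj_orbit H T" "T \<subseteq> carrier G"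
      using AB(1,2) E by auto
    have "conj_orbit H R = A" unfolding S(1) by (rule conj_orbit_eq[OF H S(2)]) (use R S(1) in simp)
    moreover have "conj_orbit H R = B" unfolding T(1) by (rule conj_orbit_eq[OF H T(2)]) (use R T(1) in simp)
    ultimately show False using AB(3) by simp
  qed
  have "k dvd card (\<Union>(conj_orbit H ` E))"
    by (rule dvd_partition) (use U fE dvd disj in auto)
  then show ?thesis by (simp add: U)
qed

text \<open>Orbits of a \<open>p\<close>-group other than fixed points have length a positive power
  of \<open>p\<close>. The Sylow theorems and the central elements below all come from this
  congruence.\<close>

lemma card_fixed_cong:
  assumes fin: "finite (carrier G)" and H: "subgroup H G" and cH: "card H = p ^ k" and p: "prime p"
    and fE: "finite E" and E: "E \<subseteq> Pow (carrier G)"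
    and inv: "\<And>g S. g \<in> H \<Longrightarrow> S \<in> E \<Longrightarrow> conj_set g S \<in> E"
  shows "card {S \<in> E. H \<subseteq> normr S} mod p = card E mod p"
proof -
  define F where "F = {S \<in> E. H \<subseteq> normr S}"
  have FE: "F \<subseteq> E" by (auto simp: F_def)
  have Hc: "H \<subseteq> carrier G" using subgroup.subset[OF H] .
  have "p dvd card (E - F)"
  proof (rule dvd_card_conj_invariant[OF H])
    fix S assume S: "S \<in> E - F"
    then have Sc: "S \<subseteq> carrier G" using E by blast
    have eq: "card (conj_orbit H S) * card (H \<inter> normr S) = p ^ k"
      using card_conj_orbit[OF fin H Sc] cH by simp
    then obtain i where i: "card (conj_orbit H S) = p ^ i"
      using divides_primepow_nat[OF p] by (metis dvd_triv_left)
    have "card (conj_orbit H S) \<noteq> 1"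
    proof
      assume "card (conj_orbit H S) = 1"
      then have "conj_orbit H S = {S}"
        using conj_orbit_self[OF H Sc] by (metis card_1_singletonE singletonD)
      then have "H \<subseteq> normr S" using Hc by (auto simp: conj_orbit_def normr_def)
      then show False using S by (simp add: F_def)
    qed
    then show "p dvd card (conj_orbit H S)" using i by (cases i) auto
  next
    fix g S assume g: "g \<in> H" and S: "S \<in> E - F"
    have Sc: "S \<subseteq> carrier G" and gc: "g \<in> carrier G" using S E g Hc by auto
    show "conj_set g S \<in> E - F"
    proof
      show "conj_set g S \<in> E" using inv g S by blast
      show "conj_set g S \<notin> F"
      proof
        assume "conj_set g S \<in> F"
        then have "conj_set (inv g) (conj_set g S) = conj_set g S"
          using subgroup.m_inv_closed[OF H g] by (auto simp: F_def normr_def)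
        then have "conj_set g S = S" using conj_set_inv gc Sc by simp
        then show False using \<open>conj_set g S \<in> F\<close> S by simp
      qed
    qed
  qed (use fE E in auto)
  moreover have "card E = card F + card (E - F)"
    using FE fE card_Un_disjoint[of F "E - F"] finite_subset by (metis Diff_disjoint Diff_partition finite_Diff)
  ultimately show ?thesis unfolding F_def[symmetric] by (metis dvd_imp_mod_0 mod_add_right_eq add.right_neutral)
qed

end

section \<open>Subgroups of cyclic groups\<close>

context group
begin

text \<open>For cyclic \<open>C\<close> and \<open>d\<close> dividing its order this is the unique
  subgroup of order \<open>d\<close>. Defining it by an equation, without a generator, makes its
  invariance under conjugation evident.\<close>

definition torsion_part :: "nat \<Rightarrow> 'a set \<Rightarrow> 'a set" where
  "torsion_part d C = {x \<in> C. x [^] d = \<one>}"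

lemma cyclic_elements:
  assumes "finite (carrier G)" "c \<in> carrier G"
  shows "generate G {c} = {c [^] k | k. k \<in> (UNIV :: nat set)}"
  using generate_pow_nat[OF assms(2)] ord_ge_1[OF assms] by simp

lemma torsion_part_cyclic:
  assumes fin: "finite (carrier G)" and c: "c \<in> carrier G" and C: "C = generate G {c}"
    and d: "d dvd card C"
  shows "torsion_part d C = generate G {c [^] (card C div d)}" "card (torsion_part d C) = d"
proof -
  have n: "card C = ord c" using c C generate_pow_card by simp
  have n0: "ord c > 0" using ord_ge_1[OF fin c] by simp
  define e where "e = ord c div d"
  have e: "ord c = d * e" "e > 0" "d > 0" using d n n0 unfolding e_def by (auto elim!: dvdE)
  have iff: "(c [^] k) [^] d = \<one> \<longleftrightarrow> e dvd k" for k :: nat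
  proof -
    have "(c [^] k) [^] d = \<one> \<longleftrightarrow> d * e dvd d * k"
      using c pow_eq_id[OF c, of "k * d"] e(1) by (simp add: nat_pow_pow mult.commute)
    then show ?thesis using e(3) by simp
  qed
  have "torsion_part d C = {(c [^] e) [^] k | k. k \<in> (UNIV :: nat set)}" (is "?L = ?R")
  proof (intro equalityI subsetI)
    fix x assume "x \<in> ?L"
    then obtain k :: nat where k: "x = c [^] k" "(c [^] k) [^] d = \<one>"
      using cyclic_elements[OF fin c] C by (auto simp: torsion_part_def)
    then obtain j where "k = e * j" using iff by blast
    then show "x \<in> ?R" using k c by (auto simp: nat_pow_pow)
  next
    fix x assume "x \<in> ?R"
    then obtain j :: nat where j: "x = c [^] (e * j)" using c by (auto simp: nat_pow_pow)
    then show "x \<in> ?L" using iff[of "e * j"] cyclic_elements[OF fin c] C by (auto simp: torsion_part_def)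
  qed
  then show 1: "torsion_part d C = generate G {c [^] (card C div d)}"
    using cyclic_elements[OF fin, of "c [^] e"] c unfolding n e_def by simp
  have "card (torsion_part d C) = ord (c [^] e)"
    using 1 c generate_pow_card[of "c [^] e"] unfolding n e_def by simp
  also have "\<dots> = d" using ord_pow[OF c, of e] e by simp
  finally show "card (torsion_part d C) = d" .
qed

lemma torsion_part_subset: "torsion_part d C \<subseteq> C"
  by (auto simp: torsion_part_def)

lemma subgroup_cyclic: "c \<in> carrier G \<Longrightarrow> subgroup (generate G {c}) G"
  by (rule generate_is_subgroup) simp

lemma subgroup_torsion_part:
  assumes "finite (carrier G)" "c \<in> carrier G" "C = generate G {c}" "d dvd card C"
  shows "subgroup (torsion_part d C) G"
  using torsion_part_cyclic(1)[OF assms] subgroup_cyclic assms(2) by simp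

text \<open>Conjugation preserves the equation \<open>x [^] d = \<one>\<close>, so whatever
  normalizes \<open>C\<close> normalizes its torsion parts.\<close>

lemma normr_torsion_part:
  assumes C: "C \<subseteq> carrier G"
  shows "normr C \<subseteq> normr (torsion_part d C)"
proof -
  have sub: "conj_set g (torsion_part d C) \<subseteq> torsion_part d C" if "g \<in> normr C" for g
  proof
    fix y assume "y \<in> conj_set g (torsion_part d C)"
    then obtain x where x: "x \<in> C" "x [^] d = \<one>" "y = g \<otimes> x \<otimes> inv g"
      by (auto simp: conj_set_def torsion_part_def)
    have g: "g \<in> carrier G" "conj_set g C = C" using that by (auto simp: normr_def)
    have "y \<in> C" using x g by (auto simp: conj_set_def)
    moreover have "y [^] d = \<one>" using x g C by (simp add: conj_pow subset_iff)
    ultimately show "y \<in> torsion_part d C" by (simp add: torsion_part_def)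
  qed
  show ?thesis
  proof
    fix g assume g: "g \<in> normr C"
    then have gc: "g \<in> carrier G" by (simp add: normr_def)
    have T: "torsion_part d C \<subseteq> carrier G" using C torsion_part_subset by blast
    \<comment> \<open>Only an inclusion is known for each normalizing element; using it for the
      inverse gives the opposite inclusion.\<close>
    have "inv g \<in> normr C" using subgroup.m_inv_closed[OF subgroup_normr[OF C] g] .
    then have "conj_set g (conj_set (inv g) (torsion_part d C)) \<subseteq> conj_set g (torsion_part d C)"
      using image_mono[OF sub] by (simp add: conj_set_def)
    then have "torsion_part d C \<subseteq> conj_set g (torsion_part d C)" using conj_set_inv(2)[OF gc T] by simp
    then show "g \<in> normr (torsion_part d C)" using sub[OF g] gc by (auto simp: normr_def)
  qed
qed

lemma subgroup_pow_card:
  assumes "subgroup H G" "x \<in> H"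
  shows "x [^] card H = \<one>"
proof -
  interpret H: group "G\<lparr>carrier := H\<rparr>" using subgroup_imp_group[OF assms(1)] .
  show ?thesis
    using H.pow_order_eq_1[of x] assms by (simp add: order_def nat_pow_consistent[symmetric])
qed

lemma card_subgroup_dvd:
  assumes "subgroup H G" "subgroup K G" "H \<subseteq> K"
  shows "card H dvd card K"
proof -
  interpret K: group "G\<lparr>carrier := K\<rparr>" using subgroup_imp_group[OF assms(2)] .
  have "subgroup H (G\<lparr>carrier := K\<rparr>)" using subgroup_incl[OF assms] .
  then have "card (rcosets\<^bsub>G\<lparr>carrier := K\<rparr>\<^esub> H) * card H = card K"
    using K.lagrange[of H] by (simp add: order_def)
  then show ?thesis using dvd_triv_right by (rule subst)
qed

text \<open>Lagrange puts \<open>H\<close> inside the torsion part of exponent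
  \<open>card H\<close>, and both have that many elements.\<close>

lemma subgroup_of_cyclic:
  assumes fin: "finite (carrier G)" and c: "c \<in> carrier G" and C: "C = generate G {c}"
    and H: "subgroup H G" "H \<subseteq> C"
  shows "H = torsion_part (card H) C"
proof -
  have sC: "subgroup C G" using C c subgroup_cyclic by simp
  have d: "card H dvd card C" using card_subgroup_dvd[OF H(1) sC H(2)] .
  have "H \<subseteq> torsion_part (card H) C" using subgroup_pow_card[OF H(1)] H(2) by (auto simp: torsion_part_def)
  moreover have "finite (torsion_part (card H) C)"
    using finite_subset[OF torsion_part_subset finite_subset[OF subgroup.subset[OF sC] fin]] .
  ultimately show ?thesis using torsion_part_cyclic(2)[OF fin c C d] by (intro card_subset_eq) auto
qed

text \<open>Used with prime \<open>d\<close>: a subgroup of \<open>C\<close> of order divisible by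
  \<open>d\<close> must contain the subgroup of order \<open>d\<close> of \<open>C\<close>.\<close>

lemma torsion_part_mono:
  assumes "finite (carrier G)" "c \<in> carrier G" "C = generate G {c}" "subgroup H G" "H \<subseteq> C" "d dvd card H"
  shows "torsion_part d C \<subseteq> H"
proof -
  have CG: "C \<subseteq> carrier G" using subgroup.subset[OF subgroup_cyclic[OF assms(2)]] assms(3) by simp
  have "torsion_part d C \<subseteq> torsion_part (card H) C"
  proof
    fix x assume x: "x \<in> torsion_part d C"
    obtain k where "card H = d * k" using assms(6) by blast
    moreover have "x \<in> carrier G" "x [^] d = \<one>" using x CG by (auto simp: torsion_part_def)
    ultimately have "x [^] card H = \<one>" by (simp flip: nat_pow_pow)
    then show "x \<in> torsion_part (card H) C" using x by (simp add: torsion_part_def)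
  qed
  then show ?thesis using subgroup_of_cyclic[OF assms(1-5)] by simp
qed

lemma cyclic_commute:
  assumes "finite (carrier G)" "c \<in> carrier G" "x \<in> generate G {c}" "y \<in> generate G {c}"
  shows "x \<otimes> y = y \<otimes> x"
  using assms(2-4) unfolding cyclic_elements[OF assms(1,2)] by (auto simp: nat_pow_mult add.commute)

lemma conj_generate:
  assumes fin: "finite (carrier G)" and x: "x \<in> carrier G" and g: "g \<in> carrier G"
  shows "conj_set g (generate G {x}) = generate G {g \<otimes> x \<otimes> inv g}"
proof -
  have "conj_set g (generate G {x}) = {g \<otimes> x [^] k \<otimes> inv g | k. k \<in> (UNIV :: nat set)}"
    unfolding cyclic_elements[OF fin x] conj_set_def by blast
  also have "\<dots> = {(g \<otimes> x \<otimes> inv g) [^] k | k. k \<in> (UNIV :: nat set)}" using g x by (simp add: conj_pow)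
  finally show ?thesis using cyclic_elements[OF fin, of "g \<otimes> x \<otimes> inv g"] g x by simp
qed

end

section \<open>Non-abelian simple groups\<close>

locale nonabelian_simple_group = simple_group +
  assumes finite_carrier: "finite (carrier G)"
    and not_comm: "\<not> comm_group G"
begin

lemma order_pos: "0 < order G"
  using order_gt_one by simp

lemma finite_subset_carrier: "S \<subseteq> carrier G \<Longrightarrow> finite S"
  using finite_carrier finite_subset by blast

lemma noncommuting: obtains x y where "x \<in> carrier G" "y \<in> carrier G" "x \<otimes> y \<noteq> y \<otimes> x"
  using not_comm group_comm_groupI by blast

text \<open>The kernel is normal, hence trivial or everything; a trivial one would embed
  \<open>G\<close> into an abelian group. The target used later is the group of signs.\<close>

lemma hom_to_commutative_trivial:
  assumes K: "comm_group K" and f: "f \<in> hom G K" and x: "x \<in> carrier G"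
  shows "f x = \<one>\<^bsub>K\<^esub>"
proof -
  interpret K: comm_group K by fact
  interpret f: group_hom G K f by unfold_locales (rule f)
  obtain a b where ab: "a \<in> carrier G" "b \<in> carrier G" "a \<otimes> b \<noteq> b \<otimes> a" using noncommuting by blast
  have "kernel G K f \<noteq> {\<one>}"
  proof
    assume "kernel G K f = {\<one>}"
    then have "inj_on f (carrier G)" by (rule f.trivial_ker_imp_inj)
    moreover have "f (a \<otimes> b) = f (b \<otimes> a)" using ab by (simp add: K.m_comm)
    ultimately show False using ab by (simp add: inj_on_def)
  qed
  then have "kernel G K f = carrier G" using no_real_normal_subgroup[OF f.normal_kernel] by blast
  then show ?thesis using x by (auto simp: kernel_def)
qed

lemma invariant_subgroup:
  assumes H: "subgroup H G" and inv: "carrier G \<subseteq> normr H"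
  shows "H = carrier G \<or> H = {\<one>}"
proof -
  have "H \<lhd> G"
  proof (rule normal_invI[OF H])
    fix x h assume x: "x \<in> carrier G" and h: "h \<in> H"
    have "conj_set x H = H" using x inv by (auto simp: normr_def)
    then show "x \<otimes> h \<otimes> inv x \<in> H" using h by (auto simp: conj_set_def)
  qed
  then show ?thesis by (rule no_real_normal_subgroup)
qed

section \<open>Faithful actions on invariant families of subsets\<close>

context
  fixes E :: "'a set set"
  assumes fE: "finite E" and E: "E \<subseteq> Pow (carrier G)"
    and invE: "\<And>g S. g \<in> carrier G \<Longrightarrow> S \<in> E \<Longrightarrow> conj_set g S \<in> E"
    and moved: "\<exists>S\<in>E. \<exists>g\<in>carrier G. conj_set g S \<noteq> S"
begin

text \<open>Numbering \<open>E\<close> by \<open>{1..m}\<close> turns the conjugation action into a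
  homomorphism to \<open>sym_group m\<close>, whose permutations act on natural numbers and fix
  everything outside \<open>{1..m}\<close>.\<close>

lemma conj_action_permutation:
  obtains \<Phi> where "\<Phi> \<in> hom G (sym_group (card E))"
    and "\<And>g. g \<in> carrier G \<Longrightarrow> \<Phi> g = id \<longleftrightarrow> (\<forall>S\<in>E. conj_set g S = S)"
proof -
  define m where "m = card E"
  obtain h where h: "bij_betw h {1..m} E" using ex_bij_betw_nat_finite_1[OF fE] m_def by blast
  define k where "k = the_inv_into {1..m} h"
  have k: "k S \<in> {1..m}" "h (k S) = S" if "S \<in> E" for S
    using that h unfolding k_def
    by (metis bij_betw_the_inv_into bij_betwE, metis f_the_inv_into_f_bij_betw)
  have kh: "k (h i) = i" if "i \<in> {1..m}" for i
    using that h unfolding k_def by (simp add: bij_betw_def the_inv_into_f_f)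
  have hE: "h i \<in> E" if "i \<in> {1..m}" for i using h that bij_betwE by blast
  define \<Phi> where "\<Phi> g i = (if i \<in> {1..m} then k (conj_set g (h i)) else i)" for g i
  have comp: "\<Phi> (g \<otimes> g') = \<Phi> g \<circ> \<Phi> g'" if "g \<in> carrier G" "g' \<in> carrier G" for g g'
  proof
    fix i
    show "\<Phi> (g \<otimes> g') i = (\<Phi> g \<circ> \<Phi> g') i"
    proof (cases "i \<in> {1..m}")
      case True
      have "h i \<subseteq> carrier G" using hE[OF True] E by blast
      then show ?thesis
        using True k[OF invE[OF that(2) hE[OF True]]] that by (simp add: \<Phi>_def conj_set_mult)
    qed (auto simp: \<Phi>_def)
  qed
  have one: "\<Phi> \<one> = id"
  proof
    fix i show "\<Phi> \<one> i = id i"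
      using hE[of i] E kh[of i] by (auto simp: \<Phi>_def conj_set_one)
  qed
  have perm: "\<Phi> g permutes {1..m}" if g: "g \<in> carrier G" for g
  proof -
    have "\<Phi> g \<circ> \<Phi> (inv g) = id" "\<Phi> (inv g) \<circ> \<Phi> g = id"
      using comp[of g "inv g"] comp[of "inv g" g] g one by auto
    then have "bij (\<Phi> g)" using o_bij by blast
    then show ?thesis unfolding permutes_def by (auto simp: \<Phi>_def bij_iff)
  qed
  show thesis
  proof (rule that[of \<Phi>])
    show "\<Phi> \<in> hom G (sym_group (card E))"
      using perm comp by (auto simp: hom_def sym_group_def m_def)
    fix g assume g: "g \<in> carrier G"
    show "\<Phi> g = id \<longleftrightarrow> (\<forall>S\<in>E. conj_set g S = S)"
    proof
      assume id: "\<Phi> g = id"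
      show "\<forall>S\<in>E. conj_set g S = S"
      proof
        fix S assume S: "S \<in> E"
        have "k (conj_set g S) = k S" using fun_cong[OF id, of "k S"] k[OF S] by (simp add: \<Phi>_def)
        then show "conj_set g S = S" using k(2)[OF S] k(2)[OF invE[OF g S]] by simp
      qed
    next
      assume "\<forall>S\<in>E. conj_set g S = S"
      then show "\<Phi> g = id" using hE kh by (auto simp: \<Phi>_def)
    qed
  qed
qed

text \<open>The kernel of the action is a normal subgroup, and \<open>moved\<close> prevents it from
  being the whole group.\<close>

lemma conj_action_faithful:
  assumes x: "x \<in> carrier G" and fixed: "\<And>S. S \<in> E \<Longrightarrow> conj_set x S = S"
  shows "x = \<one>"
proof -
  obtain \<Phi> where \<Phi>: "\<Phi> \<in> hom G (sym_group (card E))"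
    and id: "\<And>g. g \<in> carrier G \<Longrightarrow> \<Phi> g = id \<longleftrightarrow> (\<forall>S\<in>E. conj_set g S = S)"
    using conj_action_permutation by blast
  interpret \<Phi>: group_hom G "sym_group (card E)" \<Phi>
    by (intro group_hom.intro group_hom_axioms.intro is_group sym_group_is_group \<Phi>)
  have ker: "kernel G (sym_group (card E)) \<Phi> = {g \<in> carrier G. \<forall>S\<in>E. conj_set g S = S}"
    using id by (auto simp: kernel_def sym_group_one)
  moreover have "kernel G (sym_group (card E)) \<Phi> \<noteq> carrier G" using moved ker by blast
  ultimately have "{g \<in> carrier G. \<forall>S\<in>E. conj_set g S = S} = {\<one>}"
    using no_real_normal_subgroup[OF \<Phi>.normal_kernel] by blast
  then show ?thesis using x fixed by blast
qed

text \<open>The action is by even permutations, since the sign is a homomorphism to an abelian group.\<close>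

lemma order_dvd_fact: "2 * order G dvd fact (card E)"
proof -
  define m where "m = card E"
  obtain \<Phi> where \<Phi>: "\<Phi> \<in> hom G (sym_group m)"
    and id: "\<And>g. g \<in> carrier G \<Longrightarrow> \<Phi> g = id \<longleftrightarrow> (\<forall>S\<in>E. conj_set g S = S)"
    using conj_action_permutation m_def by blast
  obtain S g where Sg: "S \<in> E" "g \<in> carrier G" "conj_set g S \<noteq> S" using moved by blast
  have "card {S, conj_set g S} \<le> m" unfolding m_def
    using Sg invE[of g S] by (intro card_mono[OF fE]) auto
  then have m2: "m \<ge> 2" using Sg by simp
  have sign: "comm_group sign_img"
    by (rule group.group_comm_groupI[OF sign_img_is_group]) (auto simp: sign_img_def)
  have even: "evenperm (\<Phi> x)" if "x \<in> carrier G" for x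
  proof -
    have "sign \<circ> \<Phi> \<in> hom G sign_img" using Group.hom_compose[OF \<Phi> sign_is_hom] .
    from hom_to_commutative_trivial[OF sign this that] show ?thesis
      by (auto simp: sign_img_def sign_def split: if_splits)
  qed
  have alt: "\<Phi> \<in> hom G (alt_group m)"
    using \<Phi> even by (auto simp: hom_def sym_group_def alt_group_def)
  interpret A: group "alt_group m" by (rule alt_group_is_group)
  interpret \<Phi>: group_hom G "alt_group m" \<Phi> by unfold_locales (rule alt)
  have "kernel G (alt_group m) \<Phi> = {\<one>}"
    using id conj_action_faithful \<Phi>.hom_one by (auto simp: kernel_def alt_group_one)
  then have inj: "inj_on \<Phi> (carrier G)" by (rule \<Phi>.trivial_ker_imp_inj)
  have "card (\<Phi> ` carrier G) dvd order (alt_group m)"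
    using A.lagrange[OF \<Phi>.img_is_subgroup] by (metis dvd_triv_right)
  then have "order G dvd card (carrier (alt_group m))"
    by (simp add: order_def card_image[OF inj])
  then show ?thesis
    unfolding m_def[symmetric] alt_group_card_carrier[OF m2, symmetric] by simp
qed

end

text \<open>Supplies the assumptions of the preceding context for the conjugacy class of a single
  set.\<close>

lemma conj_orbit_invariant:
  assumes S: "S \<subseteq> carrier G" and n: "card (conj_orbit (carrier G) S) \<noteq> 1"
  defines "E \<equiv> conj_orbit (carrier G) S"
  shows "finite E" "E \<subseteq> Pow (carrier G)" "\<And>g T. g \<in> carrier G \<Longrightarrow> T \<in> E \<Longrightarrow> conj_set g T \<in> E"
    "\<exists>T\<in>E. \<exists>g\<in>carrier G. conj_set g T \<noteq> T"
proof -
  show "finite E" unfolding E_def by (rule finite_conj_orbit[OF finite_carrier])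
  show "E \<subseteq> Pow (carrier G)" unfolding E_def by (rule conj_orbit_subset[OF subset_refl S])
  show "\<And>g T. g \<in> carrier G \<Longrightarrow> T \<in> E \<Longrightarrow> conj_set g T \<in> E"
    unfolding E_def by (rule conj_orbit_closed[OF subgroup_self S])
  have SE: "S \<in> E" unfolding E_def by (rule conj_orbit_self[OF subgroup_self S])
  show "\<exists>T\<in>E. \<exists>g\<in>carrier G. conj_set g T \<noteq> T"
  proof (rule ccontr)
    assume "\<not> ?thesis"
    then have "E = {S}" using SE by (auto simp: E_def conj_orbit_def)
    then show False using n by (simp add: E_def)
  qed
qed

lemma order_dvd_fact_orbit:
  assumes "S \<subseteq> carrier G" "card (conj_orbit (carrier G) S) \<noteq> 1"
  shows "2 * order G dvd fact (card (conj_orbit (carrier G) S))"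
  using order_dvd_fact[OF conj_orbit_invariant[OF assms]] .

lemma card_conj_class:
  assumes "S \<subseteq> carrier G"
  shows "card (conj_orbit (carrier G) S) * card (normr S) = order G"
proof -
  have "carrier G \<inter> normr S = normr S" by (auto simp: normr_def)
  then show ?thesis using card_conj_orbit[OF finite_carrier subgroup_self assms] by (simp add: order_def)
qed

lemma card_conj_class_gt_1:
  assumes H: "subgroup H G" and "H \<noteq> {\<one>}" "H \<noteq> carrier G"
  shows "card (conj_orbit (carrier G) H) > 1"
proof -
  have HG: "H \<subseteq> carrier G" using subgroup.subset[OF H] .
  have "card (conj_orbit (carrier G) H) \<noteq> 0" using card_conj_class[OF HG] order_pos by (metis mult_zero_left less_irrefl)
  moreover have "card (conj_orbit (carrier G) H) \<noteq> 1"
  proof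
    assume 1: "card (conj_orbit (carrier G) H) = 1"
    then have "card (normr H) = card (carrier G)" using card_conj_class[OF HG] by (simp add: order_def)
    then have "normr H = carrier G" by (intro card_subset_eq[OF finite_carrier]) (auto simp: normr_def)
    then show False using invariant_subgroup[OF H] assms by simp
  qed
  ultimately show ?thesis by simp
qed

lemma cyclic_not_carrier:
  assumes "c \<in> carrier G" shows "generate G {c} \<noteq> carrier G"
proof
  assume "generate G {c} = carrier G"
  then show False using noncommuting cyclic_commute[OF finite_carrier assms] by metis
qed

end

section \<open>Sylow subgroups\<close>

lemma (in group) subgroup_nat_pow_closed:
  assumes "subgroup H G" "x \<in> H" shows "x [^] (n::nat) \<in> H"
  by (induction n) (simp_all add: assms subgroup.one_closed subgroup.m_closed)

context nonabelian_simple_group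
begin

definition sylow_subgroup :: "nat \<Rightarrow> 'a set \<Rightarrow> bool" where
  "sylow_subgroup p P \<longleftrightarrow> subgroup P G \<and> card P = p ^ multiplicity p (order G)"

text \<open>The class of one chosen Sylow subgroup. That it contains all of them is Sylow's
  conjugacy theorem, \<open>sylow_class_iff\<close>.\<close>

definition sylow_class :: "nat \<Rightarrow> 'a set set" where
  "sylow_class p = conj_orbit (carrier G) (SOME P. sylow_subgroup p P)"

definition sylow_number :: "nat \<Rightarrow> nat" where
  "sylow_number p = card (sylow_class p)"

lemma sylow_subset: "sylow_subgroup p P \<Longrightarrow> P \<subseteq> carrier G"
  using subgroup.subset by (auto simp: sylow_subgroup_def)

lemma sylow_exists:
  assumes "prime p" shows "sylow_subgroup p (SOME P. sylow_subgroup p P)"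
proof (rule someI_ex)
  obtain m where "order G = p ^ multiplicity p (order G) * m"
    using multiplicity_dvd[of p "order G"] by blast
  then show "\<exists>P. sylow_subgroup p P"
    using sylow_thm[OF assms is_group _ finite_carrier] unfolding sylow_subgroup_def by blast
qed

lemma dvd_card_sylow:
  assumes "prime p" "p dvd order G" "sylow_subgroup p P"
  shows "p dvd card P"
proof -
  have "multiplicity p (order G) > 0"
    using assms order_pos by (simp add: prime_multiplicity_gt_zero_iff)
  then show ?thesis using assms(3) by (simp add: sylow_subgroup_def dvd_power)
qed

text \<open>In the normalizer \<open>K\<close> of \<open>P\<close> the quotient by \<open>P\<close>
  has order \<open>d\<close> prime to \<open>p\<close>. For \<open>x\<close> in \<open>Q\<close> the
  power \<open>x [^] d\<close> lies in \<open>P\<close>, and \<open>x\<close>, having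
  \<open>p\<close>-power order, is a power of it.\<close>

lemma p_subgroup_normalizing_sylow:
  assumes p: "prime p" and P: "sylow_subgroup p P"
    and Q: "subgroup Q G" "card Q = p ^ k" "Q \<subseteq> normr P"
  shows "Q \<subseteq> P"
proof
  fix x assume x: "x \<in> Q"
  define K where "K = normr P"
  have PG: "subgroup P G" "P \<subseteq> carrier G" using P sylow_subset by (auto simp: sylow_subgroup_def)
  have K: "subgroup K G" using subgroup_normr[OF PG(2)] by (simp add: K_def)
  interpret K: group "G\<lparr>carrier := K\<rparr>" using subgroup_imp_group[OF K] .
  have PK: "P \<subseteq> K" using subgroup_subset_normr[OF PG(1)] by (simp add: K_def)
  have PGK: "subgroup P (G\<lparr>carrier := K\<rparr>)" using subgroup_incl[OF PG(1) K PK] .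
  have nrm: "P \<lhd> G\<lparr>carrier := K\<rparr>"
  proof (rule K.normal_invI[OF PGK])
    fix g h assume g: "g \<in> carrier (G\<lparr>carrier := K\<rparr>)" and h: "h \<in> P"
    then have "conj_set g P = P" by (simp add: K_def normr_def)
    then have "g \<otimes> h \<otimes> inv g \<in> P" using h by (auto simp: conj_set_def)
    then show "g \<otimes>\<^bsub>G\<lparr>carrier := K\<rparr>\<^esub> h \<otimes>\<^bsub>G\<lparr>carrier := K\<rparr>\<^esub> inv\<^bsub>G\<lparr>carrier := K\<rparr>\<^esub> g \<in> P"
      using m_inv_consistent[OF K] g by simp
  qed
  interpret N: normal P "G\<lparr>carrier := K\<rparr>" by (rule nrm)
  interpret F: group "G\<lparr>carrier := K\<rparr> Mod P" by (rule N.factorgroup_is_group)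
  define d where "d = order (G\<lparr>carrier := K\<rparr> Mod P)"
  have d: "d * card P = card K"
    using K.lagrange[OF PGK] by (simp add: d_def order_def FactGroup_def)
  have "\<not> p dvd d"
  proof
    assume "p dvd d"
    then have "p * card P dvd card K" using d by (metis mult_dvd_mono dvd_refl)
    also have "card K dvd order G" using lagrange[OF K] by (metis dvd_triv_right)
    finally have "p ^ Suc (multiplicity p (order G)) dvd order G"
      using P by (simp add: sylow_subgroup_def)
    then have "Suc (multiplicity p (order G)) \<le> multiplicity p (order G)"
      using order_pos p by (intro multiplicity_geI) auto
    then show False by simp
  qed
  then have cop: "coprime d (p ^ k)" using prime_imp_coprime[OF p] by (simp add: coprime_commute)
  have xK: "x \<in> K" using x Q(3) by (auto simp: K_def)
  then have xG: "x \<in> carrier G" using subgroup.mem_carrier[OF K] by blast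
  have "P #>\<^bsub>G\<lparr>carrier := K\<rparr>\<^esub> x \<in> carrier (G\<lparr>carrier := K\<rparr> Mod P)"
    using xK by (auto simp: carrier_FactGroup)
  then have "(P #>\<^bsub>G\<lparr>carrier := K\<rparr>\<^esub> x) [^]\<^bsub>G\<lparr>carrier := K\<rparr> Mod P\<^esub> d = P"
    using F.pow_order_eq_1 by (simp add: d_def)
  then have "P #>\<^bsub>G\<lparr>carrier := K\<rparr>\<^esub> (x [^]\<^bsub>G\<lparr>carrier := K\<rparr>\<^esub> d) = P"
    using N.FactGroup_pow[of x d] xK by simp
  then have "P #>\<^bsub>G\<lparr>carrier := K\<rparr>\<^esub> (x [^] d) = P"
    by (simp add: nat_pow_consistent[symmetric])
  moreover have "x [^] d \<in> P #>\<^bsub>G\<lparr>carrier := K\<rparr>\<^esub> (x [^] d)"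
    using subgroup.one_closed[OF PG(1)] xG by (force simp: r_coset_def)
  ultimately have xd: "x [^] d \<in> P" by simp
  have d0: "d \<noteq> 0" unfolding d_def
    using F.order_gt_0_iff_finite \<open>\<not> p dvd d\<close> by (metis d_def dvd_0_right)
  \<comment> \<open>\<open>u\<close> inverts \<open>d\<close> modulo the order of \<open>Q\<close>,
    so the exponent \<open>d * u\<close> acts on \<open>x\<close> like 1.\<close>
  obtain u v where uv: "d * u = p ^ k * v + 1"
    using bezout_nat[of d "p ^ k"] d0 cop by (auto simp: coprime_iff_gcd_eq_1)
  have "x [^] (d * u) = x [^] (p ^ k * v) \<otimes> x" using uv xG by simp
  also have "x [^] (p ^ k * v) = \<one>"
    using subgroup_pow_card[OF Q(1) x] Q(2) xG by (simp flip: nat_pow_pow)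
  finally have "x = (x [^] d) [^] u" using xG by (simp add: nat_pow_pow)
  moreover have "(x [^] d) [^] u \<in> P"
    by (rule subgroup_nat_pow_closed[OF PG(1) xd])
  ultimately show "x \<in> P" by simp
qed

lemma sylow_conj: "sylow_subgroup p P \<Longrightarrow> g \<in> carrier G \<Longrightarrow> sylow_subgroup p (conj_set g P)"
  using subgroup_conj_set card_conj_set sylow_subset by (simp add: sylow_subgroup_def)

lemma sylow_in_class: "prime p \<Longrightarrow> S \<in> sylow_class p \<Longrightarrow> sylow_subgroup p S"
  using sylow_conj[OF sylow_exists] by (auto simp: sylow_class_def conj_orbit_def)

lemma sylow_eqI:
  assumes "prime p" "sylow_subgroup p P" "sylow_subgroup p S" "P \<subseteq> normr S"
  shows "P = S"
proof -
  have "P \<subseteq> S"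
    using p_subgroup_normalizing_sylow[OF assms(1,3) _ _ assms(4)] assms(2) by (simp add: sylow_subgroup_def)
  then show ?thesis
    using assms(2,3) sylow_subset finite_subset_carrier by (intro card_subset_eq) (auto simp: sylow_subgroup_def)
qed

text \<open>The only member of \<open>E\<close> normalized by \<open>P\<close> is \<open>P\<close>
  itself. The family is general because the lemma is applied to \<open>sylow_class\<close> and to a
  class under a normalizer in \<open>order_ne_144\<close>.\<close>

lemma sylow_family_card:
  assumes p: "prime p" and P: "sylow_subgroup p P" and fE: "finite E" "P \<in> E"
    and E: "\<And>S. S \<in> E \<Longrightarrow> sylow_subgroup p S"
    and inv: "\<And>g S. g \<in> P \<Longrightarrow> S \<in> E \<Longrightarrow> conj_set g S \<in> E"
  shows "card E mod p = 1"
proof -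
  have PG: "subgroup P G" using P by (simp add: sylow_subgroup_def)
  have "{S \<in> E. P \<subseteq> normr S} = {P}"
    using sylow_eqI[OF p P E] fE(2) subgroup_subset_normr[OF PG] by blast
  moreover have "card {S \<in> E. P \<subseteq> normr S} mod p = card E mod p"
  proof (rule card_fixed_cong[OF finite_carrier PG _ p fE(1) _ inv])
    show "card P = p ^ multiplicity p (order G)" using P by (simp add: sylow_subgroup_def)
    show "E \<subseteq> Pow (carrier G)" using E sylow_subset by blast
  qed
  ultimately show ?thesis using prime_gt_1_nat[OF p] by simp
qed

lemma sylow_class_invariant:
  assumes "prime p"
  shows "finite (sylow_class p)" "sylow_class p \<subseteq> Pow (carrier G)" "sylow_class p \<noteq> {}"
    "\<And>g S. g \<in> carrier G \<Longrightarrow> S \<in> sylow_class p \<Longrightarrow> conj_set g S \<in> sylow_class p"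
proof -
  note P = sylow_subset[OF sylow_exists[OF assms]]
  show "finite (sylow_class p)" unfolding sylow_class_def by (rule finite_conj_orbit[OF finite_carrier])
  show "sylow_class p \<subseteq> Pow (carrier G)"
    unfolding sylow_class_def by (rule conj_orbit_subset[OF subset_refl P])
  show "sylow_class p \<noteq> {}" unfolding sylow_class_def using conj_orbit_self[OF subgroup_self P] by blast
  show "\<And>g S. g \<in> carrier G \<Longrightarrow> S \<in> sylow_class p \<Longrightarrow> conj_set g S \<in> sylow_class p"
    unfolding sylow_class_def by (rule conj_orbit_closed[OF subgroup_self P])
qed

lemma sylow_number_mod: assumes p: "prime p" shows "sylow_number p mod p = 1"
proof -
  obtain P where P: "P \<in> sylow_class p" using sylow_class_invariant(3)[OF p] by blast
  show ?thesis unfolding sylow_number_def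
    by (rule sylow_family_card[OF p sylow_in_class[OF p P] sylow_class_invariant(1)[OF p] P sylow_in_class[OF p]])
      (use sylow_class_invariant(4)[OF p] sylow_subset[OF sylow_in_class[OF p P]] in auto)
qed

text \<open>\<open>Q\<close> acts on the Sylow class, whose size is 1 modulo \<open>p\<close>, so it
  normalizes some member and hence lies in it.\<close>

lemma p_subgroup_in_sylow:
  assumes p: "prime p" and Q: "subgroup Q G" "card Q = p ^ k"
  obtains S where "S \<in> sylow_class p" "Q \<subseteq> S"
proof -
  have QG: "Q \<subseteq> carrier G" using subgroup.subset[OF Q(1)] .
  have "card {S \<in> sylow_class p. Q \<subseteq> normr S} mod p = sylow_number p mod p"
    unfolding sylow_number_def
    by (rule card_fixed_cong[OF finite_carrier Q p sylow_class_invariant(1,2)[OF p]])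
      (use sylow_class_invariant(4)[OF p] QG in auto)
  then have "{S \<in> sylow_class p. Q \<subseteq> normr S} \<noteq> {}" using sylow_number_mod[OF p] by (metis card.empty mod_0 zero_neq_one)
  then obtain S where "S \<in> sylow_class p" "Q \<subseteq> normr S" by blast
  then show thesis
    using that p_subgroup_normalizing_sylow[OF p sylow_in_class[OF p] Q] by blast
qed

lemma sylow_class_iff:
  assumes p: "prime p" shows "S \<in> sylow_class p \<longleftrightarrow> sylow_subgroup p S"
proof
  assume S: "sylow_subgroup p S"
  then obtain T where T: "T \<in> sylow_class p" "S \<subseteq> T"
    using p_subgroup_in_sylow[OF p] unfolding sylow_subgroup_def by blast
  have "S = T"
    using T sylow_in_class[OF p T(1)] S finite_subset_carrier[OF sylow_subset]
    by (intro card_subset_eq) (auto simp: sylow_subgroup_def)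
  then show "S \<in> sylow_class p" using T by simp
qed (rule sylow_in_class[OF p])

lemma sylow_orbit:
  assumes p: "prime p" and P: "sylow_subgroup p P"
  shows "conj_orbit (carrier G) P = sylow_class p"
proof -
  have "P \<in> conj_orbit (carrier G) (SOME P. sylow_subgroup p P)"
    using P sylow_class_iff[OF p, of P] unfolding sylow_class_def by blast
  then show ?thesis
    unfolding sylow_class_def by (rule conj_orbit_eq[OF subgroup_self sylow_subset[OF sylow_exists[OF p]]])
qed

text \<open>\<open>P\<close> acts on its own elements; the fixed points form the centre, and their
  number is divisible by \<open>p\<close>. Elements are wrapped as singletons so that the congruence
  for families of sets applies.\<close>

lemma sylow_central_element:
  assumes p: "prime p" "p dvd order G" and P: "sylow_subgroup p P"
  obtains z where "z \<in> P" "ord z = p" "\<And>x. x \<in> P \<Longrightarrow> x \<otimes> z = z \<otimes> x"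
proof -
  have PG: "subgroup P G" "P \<subseteq> carrier G" using P sylow_subset by (auto simp: sylow_subgroup_def)
  have fP: "finite P" using finite_subset_carrier[OF PG(2)] .
  define E where "E = (\<lambda>x. {x}) ` P"
  define F where "F = {S \<in> E. P \<subseteq> normr S}"
  have cong: "card F mod p = card E mod p"
    unfolding F_def
  proof (rule card_fixed_cong[OF finite_carrier PG(1) _ p(1)])
    show "card P = p ^ multiplicity p (order G)" using P by (simp add: sylow_subgroup_def)
    show "finite E" "E \<subseteq> Pow (carrier G)" using fP PG(2) by (auto simp: E_def)
    show "conj_set g S \<in> E" if "g \<in> P" "S \<in> E" for g S
      using that subgroup.m_closed[OF PG(1)] subgroup.m_inv_closed[OF PG(1)] by (auto simp: E_def conj_set_def)
  qed
  have "card E = card P" unfolding E_def by (rule card_image) auto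
  then have "p dvd card F" using cong dvd_card_sylow[OF p P] by (simp add: dvd_eq_mod_eq_0)
  moreover have F1: "{\<one>} \<in> F"
    using subgroup.one_closed[OF PG(1)] PG(2) by (auto simp: F_def E_def normr_def conj_set_def)
  ultimately have "F \<noteq> {{\<one>}}" using prime_gt_1_nat[OF p(1)] by auto
  then obtain S where S: "S \<in> F" "S \<noteq> {\<one>}" using F1 by blast
  then obtain y where y: "S = {y}" "y \<in> P" by (auto simp: F_def E_def)
  have yG: "y \<in> carrier G" and y1: "y \<noteq> \<one>" using y S PG(2) by auto
  have comm: "x \<otimes> y = y \<otimes> x" if x: "x \<in> P" for x
  proof -
    have "x \<otimes> y \<otimes> inv x = y" using x S y by (auto simp: F_def normr_def conj_set_def)
    then show ?thesis using x PG(2) yG by (metis inv_solve_right subsetD m_closed)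
  qed
  have "ord y dvd card P" using subgroup_pow_card[OF PG(1) y(2)] pow_eq_id[OF yG] by simp
  then obtain i where i: "ord y = p ^ i"
    using P divides_primepow_nat[OF p(1)] by (auto simp: sylow_subgroup_def)
  have "i \<noteq> 0" using i y1 ord_eq_1[OF yG] by (metis power_0)
  then obtain j where j: "i = Suc j" by (cases i) auto
  \<comment> \<open>The power of \<open>y\<close> that lowers its order from
    \<open>p ^ Suc j\<close> to \<open>p\<close>.\<close>
  define z where "z = y [^] (p ^ j)"
  have p0: "p > 0" using prime_gt_0_nat[OF p(1)] .
  have "ord z = p" unfolding z_def using ord_pow[OF yG, of "p ^ j"] i j p0 by simp
  moreover have "z \<in> P"
    unfolding z_def by (rule subgroup_nat_pow_closed[OF PG(1) y(2)])
  moreover have "x \<otimes> z = z \<otimes> x" if x: "x \<in> P" for x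
    unfolding z_def using group_commutes_pow[OF comm[OF x, symmetric] yG] PG(2) x by auto
  ultimately show thesis using that by blast
qed

end

section \<open>Maximal cyclic subgroups\<close>

text \<open>Rests on \<open>a + b \<le> a * b\<close> for \<open>a, b \<ge> 2\<close>. It serves
  \<open>landau_bound\<close> when one orbit accounts for several primes.\<close>

lemma sum_le_prod_nat:
  fixes f :: "'b \<Rightarrow> nat"
  assumes "finite A" "\<And>x. x \<in> A \<Longrightarrow> 2 \<le> f x"
  shows "A = {} \<or> sum f A \<le> prod f A"
  using assms
proof (induction A rule: finite_induct)
  case (insert x A)
  show ?case
  proof (cases "A = {}")
    case False
    then have le: "sum f A \<le> prod f A" using insert by auto
    have "2 \<le> f x" using insert.prems by simp
    moreover have "prod f A \<ge> 2"
    proof -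
      obtain y where "y \<in> A" using False by blast
      then have "2 \<le> sum f A" using insert by (metis insertCI member_le_sum le_trans zero_le)
      then show ?thesis using le by simp
    qed
    ultimately obtain i j where "f x = 2 + i" "prod f A = 2 + j" by (metis le_Suc_ex)
    then have "f x + prod f A \<le> f x * prod f A" by (simp add: algebra_simps)
    then show ?thesis using le insert.hyps by simp
  qed (use insert.hyps in auto)
qed simp

lemma prod_coprime_dvd:
  fixes f :: "'b \<Rightarrow> nat"
  assumes "finite A" "\<And>x. x \<in> A \<Longrightarrow> f x dvd n"
    and "\<And>x y. x \<in> A \<Longrightarrow> y \<in> A \<Longrightarrow> x \<noteq> y \<Longrightarrow> coprime (f x) (f y)"
  shows "prod f A dvd n"
  using assms
proof (induction A rule: finite_induct)
  case (insert x A)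
  have "coprime (f x) (prod f A)"
    by (rule prod_coprime_right) (use insert in auto)
  moreover have "f x dvd n" "prod f A dvd n" using insert by auto
  ultimately show ?case using insert.hyps by (simp add: divides_mult)
qed simp

context group
begin

definition max_cyclics :: "'a set set" where
  "max_cyclics = {C. \<exists>c\<in>carrier G. C = generate G {c} \<and>
     (\<forall>x\<in>carrier G. C \<subseteq> generate G {x} \<longrightarrow> generate G {x} = C)}"

text \<open>The notion that is carried to subgroups and quotients: a set of generators can be
  intersected or projected, whereas maximality of cyclic subgroups need not survive.
  \<open>card_max_cyclics_le\<close> leads back to maximal cyclic subgroups.\<close>

definition cyclic_cover :: "'a set \<Rightarrow> bool" where
  "cyclic_cover S \<longleftrightarrow> finite S \<and> S \<subseteq> carrier G \<and> (\<forall>x\<in>carrier G. \<exists>s\<in>S. x \<in> generate G {s})"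

lemma generate_self: "x \<in> generate G {x}"
  by (rule generate.incl) simp

lemma generate_subsetI: "y \<in> carrier G \<Longrightarrow> x \<in> generate G {y} \<Longrightarrow> generate G {x} \<subseteq> generate G {y}"
  using generate_subgroup_incl[OF _ subgroup_cyclic] by simp

lemma max_cyclicsE:
  assumes "C \<in> max_cyclics"
  obtains c where "c \<in> carrier G" "C = generate G {c}"
    "\<And>x. x \<in> carrier G \<Longrightarrow> C \<subseteq> generate G {x} \<Longrightarrow> generate G {x} = C"
  using assms unfolding max_cyclics_def by blast

lemma max_cyclic_subgroup: "C \<in> max_cyclics \<Longrightarrow> subgroup C G"
  using subgroup_cyclic by (auto simp: max_cyclics_def)

lemma finite_max_cyclics: "finite (carrier G) \<Longrightarrow> finite max_cyclics"
  by (rule finite_subset[of _ "Pow (carrier G)"]) (use subgroup.subset[OF max_cyclic_subgroup] in auto)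

text \<open>Among the cyclic subgroups containing \<open>x\<close>, one of greatest order is
  maximal.\<close>

lemma max_cyclic_above:
  assumes fin: "finite (carrier G)" and x: "x \<in> carrier G"
  obtains C where "C \<in> max_cyclics" "x \<in> C"
proof -
  define A where "A = {c \<in> carrier G. x \<in> generate G {c}}"
  have "x \<in> A" using x generate_self by (simp add: A_def)
  moreover have fA: "finite A" using fin by (simp add: A_def)
  ultimately have "Max ((\<lambda>y. card (generate G {y})) ` A) \<in> (\<lambda>y. card (generate G {y})) ` A"
    by (intro Max_in) auto
  then obtain c where c: "c \<in> A" and m: "Max ((\<lambda>y. card (generate G {y})) ` A) = card (generate G {c})"
    by (auto simp del: Max_in)
  have c2: "card (generate G {y}) \<le> card (generate G {c})" if "y \<in> A" for y
    unfolding m[symmetric] using that fA by (intro Max_ge) auto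
  have cG: "c \<in> carrier G" "x \<in> generate G {c}" using c by (auto simp: A_def)
  have "generate G {y} = generate G {c}"
    if y: "y \<in> carrier G" "generate G {c} \<subseteq> generate G {y}" for y
  proof -
    have "y \<in> A" using y cG by (auto simp: A_def)
    moreover have "finite (generate G {y})"
      using finite_subset[OF subgroup.subset[OF subgroup_cyclic[OF y(1)]] fin] .
    ultimately show ?thesis using c2[of y] y(2) card_seteq by metis
  qed
  then have "generate G {c} \<in> max_cyclics" using cG by (auto simp: max_cyclics_def)
  then show thesis using that cG by blast
qed

text \<open>A generator of a maximal cyclic \<open>C\<close> lies in some covering subgroup, which
  by maximality equals \<open>C\<close>.\<close>

lemma card_max_cyclics_le:
  assumes "cyclic_cover S" shows "card max_cyclics \<le> card S"
proof -
  have S: "finite S" "S \<subseteq> carrier G" using assms by (auto simp: cyclic_cover_def)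
  have "max_cyclics \<subseteq> (\<lambda>s. generate G {s}) ` S"
  proof
    fix C assume "C \<in> max_cyclics"
    from max_cyclicsE[OF this] obtain c where c: "c \<in> carrier G" "C = generate G {c}"
      "\<And>x. x \<in> carrier G \<Longrightarrow> C \<subseteq> generate G {x} \<Longrightarrow> generate G {x} = C"
      by metis
    obtain s where s: "s \<in> S" "c \<in> generate G {s}" using assms c(1) by (auto simp: cyclic_cover_def)
    have "s \<in> carrier G" using s S by blast
    then have "generate G {s} = C" using c generate_subsetI s(2) by blast
    then show "C \<in> (\<lambda>s. generate G {s}) ` S" using s(1) by blast
  qed
  then show ?thesis using surj_card_le[OF S(1)] by blast
qed

lemma max_cyclics_conj:
  assumes fin: "finite (carrier G)" and C: "C \<in> max_cyclics" and g: "g \<in> carrier G"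
  shows "conj_set g C \<in> max_cyclics"
proof -
  obtain c where c: "c \<in> carrier G" "C = generate G {c}"
      "\<And>x. x \<in> carrier G \<Longrightarrow> C \<subseteq> generate G {x} \<Longrightarrow> generate G {x} = C"
    using max_cyclicsE[OF C] by metis
  have CG: "C \<subseteq> carrier G" using subgroup.subset[OF max_cyclic_subgroup[OF C]] .
  have "generate G {x} = conj_set g C"
    if x: "x \<in> carrier G" "conj_set g C \<subseteq> generate G {x}" for x
  proof -
    have "conj_set (inv g) (conj_set g C) \<subseteq> conj_set (inv g) (generate G {x})"
      using x(2) unfolding conj_set_def by (rule image_mono)
    then have "C \<subseteq> generate G {inv g \<otimes> x \<otimes> inv (inv g)}"
      using conj_set_inv(1)[OF g CG] conj_generate[OF fin x(1), of "inv g"] g by simp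
    then have "conj_set (inv g) (generate G {x}) = C"
      using c(3)[of "inv g \<otimes> x \<otimes> inv (inv g)"] conj_generate[OF fin x(1), of "inv g"] g x by simp
    then show ?thesis
      using conj_set_inv(2)[OF g subgroup.subset[OF subgroup_cyclic[OF x(1)]]] by simp
  qed
  then show ?thesis
    using conj_generate[OF fin c(1) g] c(1,2) g unfolding max_cyclics_def by force
qed

end

context nonabelian_simple_group
begin

lemma card_conj_class_dvd:
  assumes "S \<subseteq> carrier G" "T \<subseteq> carrier G" "normr S \<subseteq> normr T"
  shows "card (conj_orbit (carrier G) T) dvd card (conj_orbit (carrier G) S)"
proof -
  obtain t where "card (normr T) = card (normr S) * t"
    using card_subgroup_dvd[OF subgroup_normr[OF assms(1)] subgroup_normr[OF assms(2)] assms(3)] by blast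
  then have "card (conj_orbit (carrier G) T) * t * card (normr S) = card (conj_orbit (carrier G) S) * card (normr S)"
    using card_conj_class[OF assms(1)] card_conj_class[OF assms(2)] by (simp add: ac_simps)
  moreover have "card (normr S) \<noteq> 0" using card_conj_class[OF assms(1)] order_pos by (metis mult_0_right less_irrefl)
  ultimately have "card (conj_orbit (carrier G) T) * t = card (conj_orbit (carrier G) S)" by simp
  then show ?thesis by (metis dvd_triv_left)
qed

lemma max_cyclic_nontrivial:
  assumes C: "C \<in> max_cyclics" shows "C \<noteq> {\<one>}" "C \<noteq> carrier G" "1 < card C"
proof -
  obtain c where c: "c \<in> carrier G" "C = generate G {c}"
    "\<And>x. x \<in> carrier G \<Longrightarrow> C \<subseteq> generate G {x} \<Longrightarrow> generate G {x} = C"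
    using max_cyclicsE[OF C] by metis
  show "C \<noteq> carrier G" using cyclic_not_carrier c by simp
  show 1: "C \<noteq> {\<one>}"
  proof
    assume C1: "C = {\<one>}"
    have "x = \<one>" if x: "x \<in> carrier G" for x
    proof -
      have "\<one> \<in> generate G {x}" using subgroup.one_closed[OF subgroup_cyclic[OF x]] .
      then have "generate G {x} = {\<one>}" using c(3)[OF x] C1 by simp
      then show ?thesis using generate_self[of x] by simp
    qed
    then have "carrier G = {\<one>}" by auto
    then show False using simple_not_triv by simp
  qed
  have sC: "subgroup C G" using max_cyclic_subgroup[OF C] .
  have "card {\<one>} < card C"
    using 1 subgroup.one_closed[OF sC] finite_subset_carrier[OF subgroup.subset[OF sC]]
    by (intro psubset_card_mono) auto
  then show "1 < card C" by simp
qed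

section \<open>The action of one maximal cyclic subgroup\<close>

context
  fixes C assumes C: "C \<in> max_cyclics"
begin

lemma CG: "subgroup C G" "C \<subseteq> carrier G"
  using max_cyclic_subgroup[OF C] subgroup.subset by auto

lemma index_max_cyclic:
  "1 < card (conj_orbit (carrier G) C)" "card (conj_orbit (carrier G) C) * card C dvd order G"
  "2 * order G dvd fact (card (conj_orbit (carrier G) C))"
proof -
  show 1: "1 < card (conj_orbit (carrier G) C)"
    using card_conj_class_gt_1[OF CG(1)] max_cyclic_nontrivial[OF C] by simp
  show "2 * order G dvd fact (card (conj_orbit (carrier G) C))" using order_dvd_fact_orbit[OF CG(2)] 1 by simp
  show "card (conj_orbit (carrier G) C) * card C dvd order G"
    using card_subgroup_dvd[OF CG(1) subgroup_normr[OF CG(2)] subgroup_subset_normr[OF CG(1)]]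
      card_conj_class[OF CG(2)] by (metis mult_dvd_mono dvd_refl)
qed

text \<open>Every subgroup of \<open>C\<close> has a normalizer at least as large as that of
  \<open>C\<close>, so its class length divides the orbit length; this is why divisors of orbit
  lengths are searched.\<close>

lemma torsion_normr:
  assumes "d dvd card C"
  shows "subgroup (torsion_part d C) G" "card (torsion_part d C) = d" "normr C \<subseteq> normr (torsion_part d C)"
    "card (conj_orbit (carrier G) (torsion_part d C)) dvd card (conj_orbit (carrier G) C)"
proof -
  obtain c where c: "c \<in> carrier G" "C = generate G {c}" using max_cyclicsE[OF C] by metis
  show 1: "subgroup (torsion_part d C) G" using subgroup_torsion_part[OF finite_carrier c assms] .
  show "card (torsion_part d C) = d" using torsion_part_cyclic(2)[OF finite_carrier c assms] .
  show "normr C \<subseteq> normr (torsion_part d C)" using normr_torsion_part[OF CG(2)] .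
  then show "card (conj_orbit (carrier G) (torsion_part d C)) dvd card (conj_orbit (carrier G) C)"
    by (rule card_conj_class_dvd[OF CG(2) subgroup.subset[OF 1]])
qed

lemma sylow_number_dvd:
  assumes p: "prime p" and d: "p ^ multiplicity p (order G) dvd card C"
  shows "sylow_number p dvd card (conj_orbit (carrier G) C)"
    and "card C = p ^ multiplicity p (order G) \<Longrightarrow> conj_orbit (carrier G) C = sylow_class p"
proof -
  have "sylow_subgroup p (torsion_part (p ^ multiplicity p (order G)) C)"
    using torsion_normr[OF d] by (simp add: sylow_subgroup_def)
  then show "sylow_number p dvd card (conj_orbit (carrier G) C)"
    using torsion_normr(4)[OF d] sylow_orbit[OF p] by (simp add: sylow_number_def)
  show "conj_orbit (carrier G) C = sylow_class p" if "card C = p ^ multiplicity p (order G)"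
    using sylow_orbit[OF p, of C] that CG by (simp add: sylow_subgroup_def)
qed

text \<open>By faithfulness, a non-trivial element of the subgroup of order \<open>q\<close> of
  \<open>C\<close> moves some \<open>S\<close>. If \<open>q\<close> divided the order of the
  stabilizer of \<open>S\<close> in \<open>C\<close>, the stabilizer would contain that unique
  subgroup; so the full power of \<open>q\<close> goes into the orbit length.\<close>

lemma prime_avoiding_stabilizer:
  assumes E: "finite E" "E \<subseteq> Pow (carrier G)" "\<And>g S. g \<in> carrier G \<Longrightarrow> S \<in> E \<Longrightarrow> conj_set g S \<in> E"
    "\<exists>S\<in>E. \<exists>g\<in>carrier G. conj_set g S \<noteq> S"
    and q: "prime q" "q dvd card C"
  obtains S where "S \<in> E" "\<not> q dvd card (C \<inter> normr S)" "q ^ multiplicity q (card C) dvd card (conj_orbit C S)"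
proof -
  obtain c where c: "c \<in> carrier G" "C = generate G {c}" using max_cyclicsE[OF C] by metis
  have "torsion_part q C \<noteq> {\<one>}" using torsion_normr(2)[OF q(2)] prime_gt_1_nat[OF q(1)] by auto
  then obtain y where y: "y \<in> torsion_part q C" "y \<noteq> \<one>"
    using subgroup.one_closed[OF torsion_normr(1)[OF q(2)]] by blast
  have yG: "y \<in> carrier G" using y torsion_part_subset CG(2) by blast
  then obtain S where S: "S \<in> E" "conj_set y S \<noteq> S" using conj_action_faithful[OF E yG] y(2) by blast
  have SG: "S \<subseteq> carrier G" using S E(2) by blast
  have nq: "\<not> q dvd card (C \<inter> normr S)"
  proof
    assume d: "q dvd card (C \<inter> normr S)"
    have "subgroup (C \<inter> normr S) G" using subgroups_Inter_pair[OF CG(1) subgroup_normr[OF SG]] .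
    then have "torsion_part q C \<subseteq> C \<inter> normr S" using torsion_part_mono[OF finite_carrier c _ _ d] by blast
    then show False using y S by (auto simp: normr_def)
  qed
  have "card (conj_orbit C S) * card (C \<inter> normr S) = card C" using card_conj_orbit[OF finite_carrier CG(1) SG] .
  then have "q ^ multiplicity q (card C) dvd card (conj_orbit C S) * card (C \<inter> normr S)"
    using multiplicity_dvd by simp
  moreover have "coprime (q ^ multiplicity q (card C)) (card (C \<inter> normr S))"
    using prime_imp_coprime[OF q(1) nq] by simp
  ultimately have "q ^ multiplicity q (card C) dvd card (conj_orbit C S)"
    by (simp add: coprime_dvd_mult_left_iff)
  then show thesis using that S nq by blast
qed

text \<open>Each prime power part of \<open>card C\<close> divides the length of some
  \<open>C\<close>-orbit on \<open>E\<close>. Parts assigned to the same orbit are coprime, so their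
  product, and a fortiori their sum, is at most its length; distinct orbits are disjoint.\<close>

lemma landau_bound:
  assumes E: "finite E" "E \<subseteq> Pow (carrier G)" "\<And>g S. g \<in> carrier G \<Longrightarrow> S \<in> E \<Longrightarrow> conj_set g S \<in> E"
    "\<exists>S\<in>E. \<exists>g\<in>carrier G. conj_set g S \<noteq> S"
  shows "(\<Sum>q\<in>prime_factors (card C). q ^ multiplicity q (card C)) \<le> card E"
proof -
  define Q where "Q = prime_factors (card C)"
  define f where "f q = q ^ multiplicity q (card C)" for q
  have fQ: "finite Q" by (simp add: Q_def)
  have Qp: "prime q" "q dvd card C" if "q \<in> Q" for q using that by (auto simp: Q_def)
  have "\<forall>q\<in>Q. \<exists>S\<in>E. f q dvd card (conj_orbit C S)"
    using prime_avoiding_stabilizer[OF E Qp] unfolding f_def by metis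
  then obtain S where S: "\<And>q. q \<in> Q \<Longrightarrow> S q \<in> E" "\<And>q. q \<in> Q \<Longrightarrow> f q dvd card (conj_orbit C (S q))" by metis
  define O' where "O' q = conj_orbit C (S q)" for q
  have OE: "O' q \<subseteq> E" if "q \<in> Q" for q
    using E(3) S(1)[OF that] CG(2) by (auto simp: O'_def conj_orbit_def)
  have disj: "A \<inter> B = {}" if AB: "A \<in> O' ` Q" "B \<in> O' ` Q" "A \<noteq> B" for A B
  proof (rule ccontr)
    assume "A \<inter> B \<noteq> {}"
    then obtain R where R: "R \<in> A" "R \<in> B" by blast
    obtain q r where q: "A = conj_orbit C (S q)" "q \<in> Q" and r: "B = conj_orbit C (S r)" "r \<in> Q"
      using AB(1,2) by (auto simp: O'_def)
    have "S q \<subseteq> carrier G" "S r \<subseteq> carrier G" using S(1) q r E(2) by blast+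
    then have "conj_orbit C R = A" "conj_orbit C R = B"
      using conj_orbit_eq[OF CG(1) _ R(1)[unfolded q(1)]] conj_orbit_eq[OF CG(1) _ R(2)[unfolded r(1)]] q r by simp_all
    then show False using AB(3) by simp
  qed
  \<comment> \<open>The primes are grouped by the orbit chosen for them.\<close>
  have "sum f Q = (\<Sum>A\<in>O' ` Q. sum f {q \<in> Q. O' q = A})"
    by (rule sum.image_gen[OF fQ])
  also have "\<dots> \<le> (\<Sum>A\<in>O' ` Q. card A)"
  proof (rule sum_mono)
    fix A assume A: "A \<in> O' ` Q"
    define R where "R = {q \<in> Q. O' q = A}"
    have R: "finite R" "R \<noteq> {}" using fQ A by (auto simp: R_def)
    have f2: "2 \<le> f q" if "q \<in> R" for q
    proof -
      have q: "q \<in> Q" using that by (simp add: R_def)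
      have "multiplicity q (card C) > 0"
        using Qp[OF q] max_cyclic_nontrivial(3)[OF C] by (simp add: prime_multiplicity_gt_zero_iff)
      then have "q \<le> f q" unfolding f_def using prime_gt_0_nat[OF Qp(1)[OF q]] by (simp add: self_le_power)
      then show ?thesis using prime_ge_2_nat[OF Qp(1)[OF q]] by simp
    qed
    have "prod f R dvd card A"
    proof (rule prod_coprime_dvd[OF R(1)])
      show "f q dvd card A" if "q \<in> R" for q using that S(2) by (auto simp: R_def O'_def)
      show "coprime (f q) (f r)" if "q \<in> R" "r \<in> R" "q \<noteq> r" for q r
        using that Qp primes_coprime[of q r] by (simp add: R_def f_def)
    qed
    moreover have "card A \<noteq> 0"
    proof -
      obtain q where q: "q \<in> Q" "A = O' q" using A by blast
      have "finite A" using finite_subset[OF OE[OF q(1)] E(1)] q by simp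
      moreover have "S q \<in> A" unfolding q O'_def
        by (rule conj_orbit_self[OF CG(1)]) (use S(1)[OF q(1)] E(2) in blast)
      ultimately show ?thesis by auto
    qed
    ultimately have "prod f R \<le> card A" by (simp add: dvd_imp_le)
    moreover have "sum f R \<le> prod f R" using sum_le_prod_nat[of R f] R f2 by auto
    ultimately show "sum f {q \<in> Q. O' q = A} \<le> card A" by (simp add: R_def)
  qed
  also have "\<dots> = card (\<Union>(O' ` Q))"
  proof (rule card_Union_disjoint[symmetric])
    show "pairwise disjnt (O' ` Q)" using disj by (auto simp: pairwise_def disjnt_def)
    show "\<And>A. A \<in> O' ` Q \<Longrightarrow> finite A" using OE E(1) finite_subset by blast
  qed
  also have "\<dots> \<le> card E" using OE E(1) by (intro card_mono) auto
  finally show ?thesis by (simp add: Q_def f_def)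
qed

end

lemma sylow_number_facts:
  assumes p: "prime p" "p dvd order G"
  shows "1 < sylow_number p" "sylow_number p * p ^ multiplicity p (order G) dvd order G"
    "2 * order G dvd fact (sylow_number p)"
    "\<exists>S\<in>sylow_class p. \<exists>g\<in>carrier G. conj_set g S \<noteq> S"
proof -
  obtain P where P: "sylow_subgroup p P" using sylow_exists[OF p(1)] by blast
  have PG: "subgroup P G" "P \<subseteq> carrier G" using P sylow_subset by (auto simp: sylow_subgroup_def)
  have orb: "conj_orbit (carrier G) P = sylow_class p" using sylow_orbit[OF p(1) P] .
  obtain z where z: "z \<in> P" "ord z = p" "\<And>x. x \<in> P \<Longrightarrow> x \<otimes> z = z \<otimes> x"
    using sylow_central_element[OF p P] by blast
  have zG: "z \<in> carrier G" using z PG by blast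
  have P1: "P \<noteq> {\<one>}" using dvd_card_sylow[OF p P] prime_gt_1_nat[OF p(1)] by auto
  have PC: "P \<noteq> carrier G"
  proof
    assume P: "P = carrier G"
    \<comment> \<open>If \<open>P\<close> were all of \<open>G\<close>, the central \<open>z\<close>
      would generate a normal subgroup, which is neither trivial nor everything.\<close>
    have "carrier G \<subseteq> normr (generate G {z})"
    proof
      fix x assume x: "x \<in> carrier G"
      then have "x \<otimes> z \<otimes> inv x = z" using z(3) P zG by (simp add: m_assoc)
      then show "x \<in> normr (generate G {z})"
        using conj_generate[OF finite_carrier zG x] x by (simp add: normr_def)
    qed
    then have "generate G {z} = {\<one>}"
      using invariant_subgroup[OF subgroup_cyclic[OF zG]] cyclic_not_carrier[OF zG] by blast
    then have "z = \<one>" using generate_self[of z] by simp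
    then show False using z(2) prime_gt_1_nat[OF p(1)] by simp
  qed
  show 1: "1 < sylow_number p"
    using card_conj_class_gt_1[OF PG(1) P1 PC] orb by (simp add: sylow_number_def)
  then show "2 * order G dvd fact (sylow_number p)"
    using order_dvd_fact_orbit[OF PG(2)] orb by (simp add: sylow_number_def)
  show "\<exists>S\<in>sylow_class p. \<exists>g\<in>carrier G. conj_set g S \<noteq> S"
    using conj_orbit_invariant(4)[OF PG(2)] orb 1 by (simp add: sylow_number_def)
  have "card P dvd card (normr P)"
    using card_subgroup_dvd[OF PG(1) subgroup_normr[OF PG(2)] subgroup_subset_normr[OF PG(1)]] .
  then show "sylow_number p * p ^ multiplicity p (order G) dvd order G"
    using card_conj_class[OF PG(2)] orb P
    unfolding sylow_number_def sylow_subgroup_def by (metis mult_dvd_mono dvd_refl)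
qed

text \<open>The class of the subgroup generated by a central element of order \<open>p\<close> of a Sylow subgroup has
  length prime to \<open>p\<close>.\<close>

lemma central_class:
  assumes p: "prime p" "p dvd order G"
  obtains C m where "C \<in> max_cyclics" "m dvd card (conj_orbit (carrier G) C)" "1 < m" "\<not> p dvd m"
    "p dvd card C" "2 * order G dvd fact m"
proof -
  obtain P where P: "sylow_subgroup p P" using sylow_exists[OF p(1)] by blast
  have PG: "subgroup P G" "P \<subseteq> carrier G" using P sylow_subset by (auto simp: sylow_subgroup_def)
  obtain z where z: "z \<in> P" "ord z = p" "\<And>x. x \<in> P \<Longrightarrow> x \<otimes> z = z \<otimes> x"
    using sylow_central_element[OF p P] by blast
  have zG: "z \<in> carrier G" using z PG by blast
  obtain C where C: "C \<in> max_cyclics" "z \<in> C" using max_cyclic_above[OF finite_carrier zG] by blast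
  note CG = CG[OF C(1)]
  have zC: "generate G {z} \<subseteq> C" using generate_subgroup_incl[of "{z}" C] CG C(2) by simp
  have cz: "card (generate G {z}) = p" using generate_pow_card[OF zG] z(2) by simp
  then have pC: "p dvd card C" using card_subgroup_dvd[OF subgroup_cyclic[OF zG] CG(1) zC] by simp
  define Q where "Q = torsion_part p C"
  have Q: "subgroup Q G" "card Q = p" "card (conj_orbit (carrier G) Q) dvd card (conj_orbit (carrier G) C)"
    using torsion_normr[OF C(1) pC] by (auto simp: Q_def)
  have QG: "Q \<subseteq> carrier G" using subgroup.subset[OF Q(1)] .
  have "generate G {z} \<subseteq> Q"
    using subgroup_pow_card[OF subgroup_cyclic[OF zG]] cz zC by (auto simp: Q_def torsion_part_def)
  then have Qz: "generate G {z} = Q"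
    using cz Q finite_subset_carrier[OF QG] by (intro card_subset_eq) auto
  have "P \<subseteq> normr Q"
  proof
    fix x assume x: "x \<in> P"
    then have xG: "x \<in> carrier G" using PG by blast
    then have "x \<otimes> z \<otimes> inv x = z" using z(3)[OF x] zG by (simp add: m_assoc)
    then show "x \<in> normr Q"
      using conj_generate[OF finite_carrier zG xG] xG by (simp add: normr_def flip: Qz)
  qed
  then have "card P dvd card (normr Q)" using card_subgroup_dvd[OF PG(1) subgroup_normr[OF QG]] by blast
  then obtain t where t: "card (normr Q) = card P * t" by blast
  define m where "m = card (conj_orbit (carrier G) Q)"
  have "m * (card P * t) = order G" using card_conj_class[OF QG] t by (simp add: m_def)
  have "\<not> p dvd m"
  proof
    assume "p dvd m"
    then have "p * card P dvd m * (card P * t)" by (simp add: mult_dvd_mono)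
    then have "p ^ Suc (multiplicity p (order G)) dvd order G"
      using P \<open>m * (card P * t) = order G\<close> by (simp add: sylow_subgroup_def)
    then have "Suc (multiplicity p (order G)) \<le> multiplicity p (order G)"
      using order_pos p by (intro multiplicity_geI) auto
    then show False by simp
  qed
  moreover have m1: "1 < m"
    unfolding m_def
  proof (rule card_conj_class_gt_1[OF Q(1)])
    show "Q \<noteq> {\<one>}" using Q(2) prime_gt_1_nat[OF p(1)] by auto
    show "Q \<noteq> carrier G" using cyclic_not_carrier[OF zG] Qz by simp
  qed
  moreover have "2 * order G dvd fact m"
    unfolding m_def using order_dvd_fact_orbit[OF QG] m1 by (simp add: m_def)
  ultimately show thesis using that[OF C(1), of m] Q(3) pC by (simp add: m_def)
qed

text \<open>\<open>C\<close> acts by conjugation on the Sylow \<open>p\<close>-subgroups other than its own one; some orbit has length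
  divisible by \<open>p\<close> and by the full power of \<open>q\<close>.\<close>

lemma sylow_number_gt:
  assumes C: "C \<in> max_cyclics" and p: "prime p" "multiplicity p (order G) = 1" "p dvd card C"
    and q: "prime q" "q \<noteq> p" "q dvd card C"
  shows "p * q ^ multiplicity q (card C) < sylow_number p"
proof -
  note CG = CG[OF C]
  have po: "p dvd order G" using p(2) by (metis not_dvd_imp_multiplicity_0 zero_neq_one)
  note inv = sylow_class_invariant[OF p(1)]
  obtain S where S: "S \<in> sylow_class p" "\<not> q dvd card (C \<inter> normr S)"
    "q ^ multiplicity q (card C) dvd card (conj_orbit C S)"
    using prime_avoiding_stabilizer[OF C inv(1,2,4) sylow_number_facts(4)[OF p(1) po] q(1,3)] by blast
  have SG: "S \<subseteq> carrier G" using S inv(2) by blast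
  have sS: "sylow_subgroup p S" using sylow_in_class[OF p(1) S(1)] .
  define P where "P = torsion_part p C"
  have P: "subgroup P G" "card P = p" "normr C \<subseteq> normr P"
    using torsion_normr[OF C p(3)] by (auto simp: P_def)
  have sP: "sylow_subgroup p P" using P p(2) by (simp add: sylow_subgroup_def)
  have CP: "C \<subseteq> normr P" using P(3) subgroup_subset_normr[OF CG(1)] by blast
  have PS: "P \<noteq> S"
  proof
    assume "P = S"
    then have "C \<inter> normr S = C" using CP by blast
    then show False using S(2) q(3) by simp
  qed
  have orb: "card (conj_orbit C S) * card (C \<inter> normr S) = card C"
    using card_conj_orbit[OF finite_carrier CG(1) SG] .
  have np: "\<not> p dvd card (C \<inter> normr S)"
  proof
    assume d: "p dvd card (C \<inter> normr S)"
    obtain c where c: "c \<in> carrier G" "C = generate G {c}" using max_cyclicsE[OF C] by metis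
    have "subgroup (C \<inter> normr S) G" using subgroups_Inter_pair[OF CG(1) subgroup_normr[OF SG]] .
    then have "P \<subseteq> normr S" using torsion_part_mono[OF finite_carrier c _ _ d] by (auto simp: P_def)
    then show False using sylow_eqI[OF p(1) sP sS] PS by blast
  qed
  then have "p dvd card (conj_orbit C S)" using orb p(1,3) prime_dvd_mult_iff by metis
  moreover have "coprime p (q ^ multiplicity q (card C))" using primes_coprime[OF p(1) q(1)] q(2) by simp
  ultimately have d: "p * q ^ multiplicity q (card C) dvd card (conj_orbit C S)"
    using S(3) by (simp add: divides_mult)
  have sub: "conj_orbit C S \<subseteq> sylow_class p"
    using inv(4) S(1) CG(2) by (auto simp: conj_orbit_def)
  have "P \<notin> conj_orbit C S"
  proof
    assume P': "P \<in> conj_orbit C S"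
    have "conj_orbit C P = conj_orbit C S" by (rule conj_orbit_eq[OF CG(1) SG P'])
    moreover have "conj_orbit C P \<subseteq> {P}" using CP by (auto simp: conj_orbit_def normr_def)
    ultimately show False using PS conj_orbit_self[OF CG(1) SG] by blast
  qed
  then have "conj_orbit C S \<subset> sylow_class p" using sub sP sylow_class_iff[OF p(1)] by blast
  then have "card (conj_orbit C S) < sylow_number p"
    unfolding sylow_number_def by (rule psubset_card_mono[OF inv(1)])
  moreover have "card (conj_orbit C S) > 0"
    using orb max_cyclic_nontrivial(3)[OF C] by (metis mult_0 not_gr0 not_less_zero)
  ultimately show ?thesis using dvd_imp_le[OF d] by simp
qed

lemma count_max_cyclics: "order G + card max_cyclics \<le> 1 + (\<Sum>C\<in>max_cyclics. card C)"
proof -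
  have fin: "finite max_cyclics" using finite_max_cyclics[OF finite_carrier] .
  have fC: "finite C" if "C \<in> max_cyclics" for C
    using finite_subset_carrier CG(2)[OF that] by blast
  have "carrier G - {\<one>} \<subseteq> (\<Union>C\<in>max_cyclics. C - {\<one>})"
    using max_cyclic_above[OF finite_carrier] by blast
  then have "card (carrier G - {\<one>}) \<le> card (\<Union>C\<in>max_cyclics. C - {\<one>})"
    using fin fC by (intro card_mono) auto
  also have "\<dots> \<le> (\<Sum>C\<in>max_cyclics. card (C - {\<one>}))" by (rule card_UN_le[OF fin])
  finally have le: "order G - 1 \<le> (\<Sum>C\<in>max_cyclics. card (C - {\<one>}))"
    using finite_carrier by (simp add: order_def)
  have "(\<Sum>C\<in>max_cyclics. card C) = (\<Sum>C\<in>max_cyclics. card (C - {\<one>}) + 1)"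
  proof (rule sum.cong[OF refl])
    fix C assume C: "C \<in> max_cyclics"
    show "card C = card (C - {\<one>}) + 1"
      using card_Suc_Diff1[OF fC[OF C] subgroup.one_closed[OF CG(1)[OF C]]] by simp
  qed
  also have "\<dots> = (\<Sum>C\<in>max_cyclics. card (C - {\<one>})) + card max_cyclics" by (subst sum.distrib) simp
  finally show ?thesis using le by simp
qed

end

section \<open>Elements of prime power order\<close>

context nonabelian_simple_group
begin

text \<open>The non-trivial elements of \<open>p\<close>-power order; by Lagrange the
  \<open>p\<close>-part of the group order is a common exponent for them.\<close>

definition p_elements :: "nat \<Rightarrow> 'a set" where
  "p_elements p = {x \<in> carrier G. x \<noteq> \<one> \<and> x [^] (p ^ multiplicity p (order G)) = \<one>}"

lemma sylow_subset_p_elements: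
  assumes "sylow_subgroup p S" shows "S - {\<one>} \<subseteq> p_elements p"
  using assms subgroup_pow_card[of S] sylow_subset[OF assms]
  by (auto simp: p_elements_def sylow_subgroup_def)

lemma p_elements_disjoint:
  assumes "prime p" "prime q" "p \<noteq> q" shows "p_elements p \<inter> p_elements q = {}"
proof (rule ccontr)
  assume "\<not> ?thesis"
  then obtain x where x: "x \<in> carrier G" "x \<noteq> \<one>"
    "ord x dvd p ^ multiplicity p (order G)" "ord x dvd q ^ multiplicity q (order G)"
    by (auto simp: p_elements_def pow_eq_id)
  have "coprime (p ^ multiplicity p (order G)) (q ^ multiplicity q (order G))"
    using primes_coprime[OF assms] by simp
  then have "ord x = 1" using x by (metis coprime_common_divisor_nat nat_dvd_1_iff_1 coprime_def)
  then show False using x ord_eq_1 by simp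
qed

lemma prime_card_subgroup_cyclic:
  assumes S: "subgroup S G" "card S = p" "prime p" and x: "x \<in> S" "x \<noteq> \<one>"
  shows "generate G {x} = S" "ord x = p"
proof -
  have SG: "S \<subseteq> carrier G" using subgroup.subset[OF S(1)] .
  have xG: "x \<in> carrier G" using x SG by blast
  have "ord x dvd p" using subgroup_pow_card[OF S(1) x(1)] S(2) pow_eq_id[OF xG] by simp
  then show o: "ord x = p" using S(3) ord_eq_1[OF xG] x(2) by (metis prime_nat_iff)
  have "generate G {x} \<subseteq> S" using generate_subgroup_incl[of "{x}" S] S(1) x(1) by simp
  then show "generate G {x} = S"
    using generate_pow_card[OF xG] o S(2) finite_subset_carrier[OF SG] by (intro card_subset_eq) auto
qed

text \<open>Sylow subgroups of order \<open>p\<close> meet trivially and can be counted in full. For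
  larger ones, the non-trivial elements of one subgroup and a single further element from another
  already give \<open>p ^ multiplicity p (order G)\<close>.\<close>

lemma card_p_elements:
  assumes p: "prime p" "p dvd order G"
  shows "(if multiplicity p (order G) = 1 then sylow_number p * (p - 1) else p ^ multiplicity p (order G))
    \<le> card (p_elements p)"
proof -
  have fin: "finite (p_elements p)" using finite_carrier by (simp add: p_elements_def)
  note inv = sylow_class_invariant[OF p(1)]
  have syl: "subgroup S G" "card S = p ^ multiplicity p (order G)" "finite S" "\<one> \<in> S"
    if "S \<in> sylow_class p" for S
    using sylow_in_class[OF p(1) that] finite_subset_carrier[OF sylow_subset] subgroup.one_closed
    by (auto simp: sylow_subgroup_def)
  show ?thesis
  proof (cases "multiplicity p (order G) = 1")
    case True
    have "(\<Union>S\<in>sylow_class p. S - {\<one>}) \<subseteq> p_elements p"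
      using sylow_subset_p_elements sylow_in_class[OF p(1)] by blast
    then have "card (\<Union>S\<in>sylow_class p. S - {\<one>}) \<le> card (p_elements p)" using fin by (intro card_mono)
    moreover have "card (\<Union>S\<in>sylow_class p. S - {\<one>}) = (\<Sum>S\<in>sylow_class p. card (S - {\<one>}))"
    proof (rule card_UN_disjoint[OF inv(1)])
      show "\<forall>S\<in>sylow_class p. finite (S - {\<one>})" using syl by blast
      have "S = T" if "S \<in> sylow_class p" "T \<in> sylow_class p" "x \<in> S" "x \<in> T" "x \<noteq> \<one>" for S T x
        using prime_card_subgroup_cyclic(1)[OF syl(1)[OF that(1)] _ p(1) that(3,5)]
          prime_card_subgroup_cyclic(1)[OF syl(1)[OF that(2)] _ p(1) that(4,5)] syl(2)[OF that(1)] syl(2)[OF that(2)] True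
        by simp
      then show "\<forall>S\<in>sylow_class p. \<forall>T\<in>sylow_class p. S \<noteq> T \<longrightarrow> (S - {\<one>}) \<inter> (T - {\<one>}) = {}" by blast
    qed
    moreover have "(\<Sum>S\<in>sylow_class p. card (S - {\<one>})) = sylow_number p * (p - 1)"
      using syl True by (simp add: sylow_number_def)
    ultimately show ?thesis using True by simp
  next
    case False
    obtain S where S: "S \<in> sylow_class p" using inv(3) by blast
    have "sylow_class p \<noteq> {S}"
      using sylow_number_facts(1)[OF p] by (auto simp: sylow_number_def)
    then obtain T where T: "T \<in> sylow_class p" "T \<noteq> S" using S by blast
    have "\<not> T \<subseteq> S" using T syl(2)[OF S] syl(2)[OF T(1)] card_subset_eq[OF syl(3)[OF S]] by metis
    then obtain x where x: "x \<in> T" "x \<notin> S" by blast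
    have "insert x (S - {\<one>}) \<subseteq> p_elements p"
      using sylow_subset_p_elements[OF sylow_in_class[OF p(1) S]]
        sylow_subset_p_elements[OF sylow_in_class[OF p(1) T(1)]] x syl(4)[OF S] by blast
    then have "card (insert x (S - {\<one>})) \<le> card (p_elements p)" using fin by (intro card_mono)
    then have "card S \<le> card (p_elements p)"
      using x syl(3,4)[OF S] card_Suc_Diff1[OF syl(3,4)[OF S]] by simp
    then show ?thesis using False syl(2)[OF S] by simp
  qed
qed

text \<open>The set \<open>A\<close> leaves room for further elements: it is empty in
  \<open>orbit_data\<close> and consists of the elements of order 6 in
  \<open>order_60_no_sixes\<close>.\<close>

lemma sum_p_elements:
  assumes A: "finite A" "A \<subseteq> carrier G - {\<one>}" and P: "finite P" "\<And>p. p \<in> P \<Longrightarrow> prime p \<and> p dvd order G"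
    and disj: "\<And>p. p \<in> P \<Longrightarrow> p_elements p \<inter> A = {}"
  shows "1 + card A + (\<Sum>p\<in>P. if multiplicity p (order G) = 1 then sylow_number p * (p - 1)
    else p ^ multiplicity p (order G)) \<le> order G"
proof -
  have fin: "finite (p_elements p)" for p using finite_carrier by (simp add: p_elements_def)
  have "(\<Sum>p\<in>P. if multiplicity p (order G) = 1 then sylow_number p * (p - 1) else p ^ multiplicity p (order G))
      \<le> (\<Sum>p\<in>P. card (p_elements p))"
    using card_p_elements P(2) by (intro sum_mono) blast
  also have "\<dots> = card (\<Union>p\<in>P. p_elements p)"
  proof (rule card_UN_disjoint[symmetric, OF P(1)])
    show "\<forall>p\<in>P. finite (p_elements p)" using fin by blast
    show "\<forall>p\<in>P. \<forall>q\<in>P. p \<noteq> q \<longrightarrow> p_elements p \<inter> p_elements q = {}"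
      using p_elements_disjoint P(2) by blast
  qed
  finally have 1: "(\<Sum>p\<in>P. if multiplicity p (order G) = 1 then sylow_number p * (p - 1) else p ^ multiplicity p (order G))
      \<le> card (\<Union>p\<in>P. p_elements p)" .
  have "card (\<Union>p\<in>P. p_elements p) + card A = card ((\<Union>p\<in>P. p_elements p) \<union> A)"
    by (rule card_Un_disjoint[symmetric]) (use fin P(1) A(1) disj in auto)
  also have "\<dots> \<le> card (carrier G - {\<one>})"
    using finite_carrier A(2) by (intro card_mono) (auto simp: p_elements_def)
  also have "\<dots> + 1 = order G" using card_Suc_Diff1[OF finite_carrier one_closed] by (simp add: order_def)
  finally show ?thesis using 1 by simp
qed

text \<open>There would be 16 Sylow 3-subgroups. As 16 is not 1 modulo 9, two of them have a non-trivial
  intersection; both are abelian, so its normalizer contains both and has index at most 4.\<close>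

lemma order_ne_144: "order G \<noteq> 144"
proof
  assume N: "order G = 144"
  have m3: "3 ^ multiplicity 3 (order G) = (9::nat)"
  proof -
    have "multiplicity 3 (144 :: nat) = 2" by (rule multiplicity_eqI) simp_all
    then show ?thesis by (simp add: N)
  qed
  have p3: "prime (3::nat)" "3 dvd order G" by (simp_all add: N)
  note inv = sylow_class_invariant[OF p3(1)]
  define s where "s = sylow_number 3"
  have s: "s mod 3 = 1" "1 < s" "s * 9 dvd 144" "2 * 144 dvd (fact s :: nat)"
    using sylow_number_mod[OF p3(1)] sylow_number_facts[OF p3] m3 N by (auto simp: s_def)
  obtain j where "144 = s * 9 * j" using s(3) by blast
  then have "16 = s * j" by (simp add: mult.commute)
  then have "s dvd 16" by (rule dvdI)
  then have "s \<le> 16" by (simp add: dvd_imp_le)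
  then have "s \<in> {2..16}" using s(2) by simp
  then have "s \<in> {2,3,4,5,6,7,8,9,10,11,12,13,14,15,16}"
    unfolding insert_iff empty_iff atLeastAtMost_iff by presburger
  then have "s = 4 \<or> s = 16" using \<open>s dvd 16\<close> s(1) by auto
  \<comment> \<open>Degree 4 fails because 288 does not divide 24.\<close>
  moreover have "s \<noteq> 4" using s(4) by (auto simp: fact_numeral)
  ultimately have s16: "s = 16" by simp
  obtain P where P: "P \<in> sylow_class 3" using inv(3) by blast
  have sP: "sylow_subgroup 3 P" using sylow_in_class[OF p3(1) P] .
  have PG: "subgroup P G" "P \<subseteq> carrier G" "card P = 9" using sP sylow_subset m3 by (auto simp: sylow_subgroup_def)
  have abel: "x \<otimes> y = y \<otimes> x" if Q: "sylow_subgroup 3 Q" and x: "x \<in> Q" and y: "y \<in> Q" for Q x y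
  proof -
    have QG: "subgroup Q G" "Q \<subseteq> carrier G" "card Q = 9"
      using Q sylow_subset m3 by (auto simp: sylow_subgroup_def)
    \<comment> \<open>\<open>Z\<close> is the centralizer of \<open>y\<close> in \<open>Q\<close>.
      It contains the central subgroup of order 3; if it were no larger, \<open>y\<close> would be a
      power of the central element \<open>z\<close>, so \<open>Z\<close> would be all of
      \<open>Q\<close> after all.\<close>
    define Z where "Z = Q \<inter> normr {y}"
    have yG: "y \<in> carrier G" using y QG by blast
    have Zs: "subgroup Z G" unfolding Z_def
      by (rule subgroups_Inter_pair[OF QG(1) subgroup_normr]) (use yG in simp)
    have Ziff: "u \<in> Z \<longleftrightarrow> u \<in> Q \<and> u \<otimes> y = y \<otimes> u" for u
    proof (cases "u \<in> Q")
      case True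
      then have "u \<in> carrier G" using QG by blast
      then have "u \<otimes> y \<otimes> inv u = y \<longleftrightarrow> u \<otimes> y = y \<otimes> u" using yG by (metis inv_solve_right m_closed)
      then show ?thesis using True \<open>u \<in> carrier G\<close> by (auto simp: Z_def normr_def conj_set_def)
    qed (simp add: Z_def)
    obtain z where z: "z \<in> Q" "ord z = 3" "\<And>u. u \<in> Q \<Longrightarrow> u \<otimes> z = z \<otimes> u"
      using sylow_central_element[OF p3 Q] by blast
    have zG: "z \<in> carrier G" using z QG by blast
    have gz: "generate G {z} \<subseteq> Z"
      using generate_subgroup_incl[of "{z}" Z] Zs z(1,3) y Ziff by simp
    have cz: "card (generate G {z}) = 3" using generate_pow_card[OF zG] z(2) by simp
    have "card Z dvd 9" using card_subgroup_dvd[OF Zs QG(1)] QG(3) by (simp add: Z_def)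
    moreover have "3 dvd card Z" using card_subgroup_dvd[OF subgroup_cyclic[OF zG] Zs gz] cz by simp
    ultimately have "card Z = 3 \<or> card Z = 9"
    proof -
      obtain t where t: "card Z = 3 * t" using \<open>3 dvd card Z\<close> by blast
      obtain j where "9 = card Z * j" using \<open>card Z dvd 9\<close> by blast
      then have "3 = t * j" using t by (simp add: mult.commute)
      then have "t dvd 3" by (rule dvdI)
      then have "t \<le> 3" by (simp add: dvd_imp_le)
      then have "t = 0 \<or> t = 1 \<or> t = 2 \<or> t = 3" by presburger
      then show ?thesis using t \<open>t dvd 3\<close> by auto
    qed
    then have "Z = Q"
    proof
      assume "card Z = 9"
      then show ?thesis using finite_subset_carrier[OF QG(2)] QG(3) by (intro card_subset_eq) (auto simp: Z_def)
    next
      assume "card Z = 3"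
      then have "generate G {z} = Z"
        using cz gz finite_subset_carrier[OF subgroup.subset[OF Zs]] by (intro card_subset_eq) auto
      moreover have "y \<in> Z" using y Ziff by simp
      ultimately obtain k :: nat where k: "y = z [^] k"
        using cyclic_elements[OF finite_carrier zG] by blast
      have "u \<otimes> y = y \<otimes> u" if "u \<in> Q" for u
        using group_commutes_pow[OF z(3)[OF that, symmetric] zG, of k] that QG(2) k by auto
      then show ?thesis using Ziff by blast
    qed
    then show ?thesis using x Ziff by blast
  qed
  \<comment> \<open>The remaining class members number 15.\<close>
  have "\<not> 9 dvd card (sylow_class 3 - {P})"
    using s16 P inv(1) by (simp add: s_def sylow_number_def)
  \<comment> \<open>If \<open>P\<close> met every other Sylow subgroup trivially, it would act on
    them with trivial stabilizers, since \<open>P \<inter> normr Q\<close> is a 3-group normalizing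
    \<open>Q\<close> and hence lies in \<open>Q\<close>.\<close>
  moreover have "9 dvd card (sylow_class 3 - {P})" if triv: "\<And>Q. Q \<in> sylow_class 3 \<Longrightarrow> Q \<noteq> P \<Longrightarrow> P \<inter> Q = {\<one>}"
  proof (rule dvd_card_conj_invariant[OF PG(1)])
    show "finite (sylow_class 3 - {P})" "sylow_class 3 - {P} \<subseteq> Pow (carrier G)" using inv by auto
    fix g Q assume g: "g \<in> P" and Q: "Q \<in> sylow_class 3 - {P}"
    have gG: "g \<in> carrier G" using g PG by blast
    have "conj_set g Q \<noteq> P"
    proof
      assume "conj_set g Q = P"
      moreover have "Q \<subseteq> carrier G" using Q inv(2) by blast
      ultimately have "Q = conj_set (inv g) P" using conj_set_inv(1)[OF gG, of Q] by simp
      also have "\<dots> = P"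
        using subgroup_subset_normr[OF PG(1)] subgroup.m_inv_closed[OF PG(1) g] by (auto simp: normr_def)
      finally show False using Q by simp
    qed
    then show "conj_set g Q \<in> sylow_class 3 - {P}" using inv(4)[OF gG] Q by blast
  next
    fix Q assume Q: "Q \<in> sylow_class 3 - {P}"
    have QG: "Q \<subseteq> carrier G" using Q inv(2) by blast
    have sQ: "sylow_subgroup 3 Q" using sylow_in_class[OF p3(1)] Q by blast
    have I: "subgroup (P \<inter> normr Q) G" using subgroups_Inter_pair[OF PG(1) subgroup_normr[OF QG]] .
    have "card (P \<inter> normr Q) dvd 3 ^ 2" using card_subgroup_dvd[OF I PG(1)] PG(3) by simp
    then obtain i where "card (P \<inter> normr Q) = 3 ^ i" using divides_primepow_nat[OF p3(1)] by blast
    then have "P \<inter> normr Q \<subseteq> Q" using p_subgroup_normalizing_sylow[OF p3(1) sQ I] by blast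
    then have "P \<inter> normr Q \<subseteq> {\<one>}" using triv[of Q] Q by blast
    then have "P \<inter> normr Q = {\<one>}" using subgroup.one_closed[OF I] by blast
    then show "9 dvd card (conj_orbit P Q)"
      using card_conj_orbit[OF finite_carrier PG(1) QG] PG(3) by simp
  qed
  ultimately obtain Q where Q: "Q \<in> sylow_class 3" "Q \<noteq> P" "P \<inter> Q \<noteq> {\<one>}" by blast
  have sQ: "sylow_subgroup 3 Q" using sylow_in_class[OF p3(1) Q(1)] .
  have QG: "subgroup Q G" "Q \<subseteq> carrier G" "card Q = 9" using sQ sylow_subset m3 by (auto simp: sylow_subgroup_def)
  define D where "D = P \<inter> Q"
  have D: "subgroup D G" "D \<subseteq> carrier G"
    unfolding D_def using subgroups_Inter_pair[OF PG(1) QG(1)] PG(2) by auto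
  have D_norm: "R \<subseteq> normr D" if "sylow_subgroup 3 R" "D \<subseteq> R" for R
  proof
    fix u assume u: "u \<in> R"
    have uG: "u \<in> carrier G" using u sylow_subset that by blast
    have "u \<otimes> d \<otimes> inv u = d" if d: "d \<in> D" for d
      using abel[OF \<open>sylow_subgroup 3 R\<close> u, of d] d \<open>D \<subseteq> R\<close> D(2) uG by (metis inv_solve_right m_closed subsetD)
    then have "conj_set u D = D" unfolding conj_set_def by (simp add: image_cong[of D D _ "\<lambda>x. x"])
    then show "u \<in> normr D" using uG by (simp add: normr_def)
  qed
  define K where "K = normr D"
  have K: "subgroup K G" using subgroup_normr[OF D(2)] by (simp add: K_def)
  have PK: "P \<subseteq> K" and QK: "Q \<subseteq> K" using D_norm sP sQ by (auto simp: K_def D_def)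
  have KG: "K \<subseteq> carrier G" using subgroup.subset[OF K] .
  define i where "i = card (conj_orbit (carrier G) D)"
  have iK: "i * card K = 144" using card_conj_class[OF D(2)] N by (simp add: i_def K_def)
  have "1 < i" unfolding i_def
  proof (rule card_conj_class_gt_1[OF D(1)])
    show "D \<noteq> {\<one>}" using Q by (simp add: D_def)
    show "D \<noteq> carrier G"
    proof
      assume "D = carrier G"
      then have "P = carrier G" using PG by (auto simp: D_def)
      then show False using PG(3) N by (simp add: order_def)
    qed
  qed
  then have di: "2 * 144 dvd (fact i :: nat)" using order_dvd_fact_orbit[OF D(2)] N by (simp add: i_def)
  have i5: "5 \<le> i"
  proof (rule ccontr)
    assume "\<not> 5 \<le> i"
    then have "i \<in> {2, 3, 4}" using \<open>1 < i\<close> by auto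
    then show False using di by (auto simp: fact_numeral)
  qed
  have "card P dvd card K" using card_subgroup_dvd[OF PG(1) K PK] .
  then obtain t where t: "card K = 9 * t" using PG(3) by auto
  then have it: "i * t = 16" using iK by simp
  then have "t \<le> 3"
  proof -
    have "5 * t \<le> i * t" using i5 by simp
    then show ?thesis using it by simp
  qed
  \<comment> \<open>The number of conjugates of \<open>P\<close> in \<open>K\<close> divides
    \<open>t \<le> 3\<close> and is 1 modulo 3. So \<open>P\<close> is normal in \<open>K\<close>,
    which contains the different Sylow subgroup \<open>Q\<close>.\<close>
  have orbP: "card (conj_orbit K P) * card (K \<inter> normr P) = card K"
    using card_conj_orbit[OF finite_carrier K PG(2)] .
  have "P \<subseteq> K \<inter> normr P" using PK subgroup_subset_normr[OF PG(1)] by blast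
  then have "9 dvd card (K \<inter> normr P)"
    using card_subgroup_dvd[OF PG(1) subgroups_Inter_pair[OF K subgroup_normr[OF PG(2)]]] PG(3) by simp
  then have "9 * card (conj_orbit K P) dvd 9 * t" using orbP t by (metis mult.commute mult_dvd_mono dvd_refl)
  then have "card (conj_orbit K P) dvd t" by simp
  moreover have "0 < t" using it by (cases t) auto
  ultimately have "card (conj_orbit K P) \<le> 3"
    using \<open>t \<le> 3\<close> dvd_imp_le[of "card (conj_orbit K P)" t] by linarith
  moreover have "card (conj_orbit K P) mod 3 = 1"
  proof (rule sylow_family_card[OF p3(1) sP])
    show "finite (conj_orbit K P)" using finite_conj_orbit[OF finite_subset_carrier[OF KG]] .
    show "P \<in> conj_orbit K P" using conj_orbit_self[OF K PG(2)] .
    show "sylow_subgroup 3 S" if "S \<in> conj_orbit K P" for S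
      using that sylow_conj[OF sP] KG by (auto simp: conj_orbit_def)
    show "conj_set g S \<in> conj_orbit K P" if "g \<in> P" "S \<in> conj_orbit K P" for g S
      using conj_orbit_closed[OF K PG(2)] that PK by blast
  qed
  ultimately have "card (conj_orbit K P) = 1" by presburger
  then have "card (K \<inter> normr P) = card K" using orbP by simp
  then have "K \<inter> normr P = K" using finite_subset_carrier[OF KG] by (intro card_subset_eq) auto
  then have "Q \<subseteq> normr P" using QK by blast
  then show False using sylow_eqI[OF p3(1) sQ sP] Q(2) by simp
qed

end

section \<open>Simple groups have more than 30 maximal cyclic subgroups\<close>

context nonabelian_simple_group
begin

definition orbits :: "'a set set set" where
  "orbits = conj_orbit (carrier G) ` max_cyclics"

text \<open>Sorted by length, so that the head yields the least orbit length \<open>k\<close> of the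
  locale \<open>orbit_data\<close>.\<close>

definition orbit_list :: "'a set set list" where
  "orbit_list = sort_key card (SOME xs. set xs = orbits \<and> distinct xs)"

text \<open>Any member may represent the orbit, since conjugates have equal order.\<close>

definition orbit_shape :: "'a set set \<Rightarrow> nat \<times> nat" where
  "orbit_shape T = (card T, card (SOME C. C \<in> T))"

lemma finite_orbits: "finite orbits"
  using finite_max_cyclics[OF finite_carrier] by (simp add: orbits_def)

lemma orbit_list: "set orbit_list = orbits" "distinct orbit_list" "sorted (map card orbit_list)"
proof -
  have "\<exists>xs. set xs = orbits \<and> distinct xs" using finite_distinct_list[OF finite_orbits] .
  from someI_ex[OF this] show "set orbit_list = orbits" "distinct orbit_list"
    by (simp_all add: orbit_list_def)
  show "sorted (map card orbit_list)" by (simp add: orbit_list_def)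
qed

lemma orbit_shape:
  assumes C: "C \<in> max_cyclics"
  shows "orbit_shape (conj_orbit (carrier G) C) = (card (conj_orbit (carrier G) C), card C)"
proof -
  have "C \<in> conj_orbit (carrier G) C" by (rule conj_orbit_self[OF subgroup_self CG(2)[OF C]])
  then have "(SOME D. D \<in> conj_orbit (carrier G) C) \<in> conj_orbit (carrier G) C" by (rule someI)
  then obtain g where "g \<in> carrier G" "(SOME D. D \<in> conj_orbit (carrier G) C) = conj_set g C"
    by (auto simp: conj_orbit_def)
  then show ?thesis using card_conj_set CG(2)[OF C] by (simp add: orbit_shape_def)
qed

lemma orbit_shapes:
  "(n, c) \<in> set (map orbit_shape orbit_list) \<longleftrightarrow>
   (\<exists>C\<in>max_cyclics. n = card (conj_orbit (carrier G) C) \<and> c = card C)"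
  unfolding set_map orbit_list(1) orbits_def image_image using orbit_shape by (auto simp: image_iff)

lemma sum_orbits:
  fixes f :: "'a set \<Rightarrow> nat"
  shows "(\<Sum>T\<in>orbits. \<Sum>C\<in>T. f C) = (\<Sum>C\<in>max_cyclics. f C)"
proof -
  have U: "\<Union>orbits = max_cyclics"
  proof (intro equalityI subsetI)
    show "C \<in> max_cyclics" if "C \<in> \<Union>orbits" for C
      using that max_cyclics_conj[OF finite_carrier] by (auto simp: orbits_def conj_orbit_def)
    show "C \<in> \<Union>orbits" if "C \<in> max_cyclics" for C
      using conj_orbit_self[OF subgroup_self CG(2)[OF that]] that by (auto simp: orbits_def)
  qed
  have "\<forall>S\<in>orbits. \<forall>T\<in>orbits. S \<noteq> T \<longrightarrow> S \<inter> T = {}"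
  proof (intro ballI impI, rule ccontr)
    fix S T assume S: "S \<in> orbits" and T: "T \<in> orbits" and ne: "S \<noteq> T" and I: "S \<inter> T \<noteq> {}"
    obtain C D where C: "C \<in> max_cyclics" "S = conj_orbit (carrier G) C"
      and D: "D \<in> max_cyclics" "T = conj_orbit (carrier G) D" using S T by (auto simp: orbits_def)
    obtain R where R: "R \<in> S" "R \<in> T" using I by blast
    have "conj_orbit (carrier G) R = S"
      unfolding C(2) by (rule conj_orbit_eq[OF subgroup_self CG(2)[OF C(1)] R(1)[unfolded C(2)]])
    moreover have "conj_orbit (carrier G) R = T"
      unfolding D(2) by (rule conj_orbit_eq[OF subgroup_self CG(2)[OF D(1)] R(2)[unfolded D(2)]])
    ultimately show False using ne by simp
  qed
  moreover have "\<forall>T\<in>orbits. finite T"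
    unfolding U[symmetric] using finite_conj_orbit[OF finite_carrier] by (auto simp: orbits_def)
  ultimately show ?thesis using sum.Union_disjoint[of orbits f] U by simp
qed

lemma sum_orbit_shapes:
  "sum_list (map fst (map orbit_shape orbit_list)) = card max_cyclics"
  "sum_list (map (\<lambda>(n, c). n * c) (map orbit_shape orbit_list)) = (\<Sum>C\<in>max_cyclics. card C)"
proof -
  have "sum_list (map fst (map orbit_shape orbit_list)) = (\<Sum>T\<in>orbits. card T)"
    by (simp add: o_def orbit_shape_def sum_list_distinct_conv_sum_set[OF orbit_list(2)] orbit_list(1))
  also have "\<dots> = card max_cyclics" using sum_orbits[of "\<lambda>_. 1"] by simp
  finally show "sum_list (map fst (map orbit_shape orbit_list)) = card max_cyclics" .
  have "sum_list (map (\<lambda>(n, c). n * c) (map orbit_shape orbit_list))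
      = (\<Sum>T\<in>orbits. fst (orbit_shape T) * snd (orbit_shape T))"
    by (simp add: o_def case_prod_beta sum_list_distinct_conv_sum_set[OF orbit_list(2)] orbit_list(1))
  also have "\<dots> = (\<Sum>T\<in>orbits. \<Sum>C\<in>T. card C)"
  proof (rule sum.cong[OF refl])
    fix T assume "T \<in> orbits"
    then obtain C where C: "C \<in> max_cyclics" "T = conj_orbit (carrier G) C" by (auto simp: orbits_def)
    have "card D = card C" if "D \<in> T" for D
      using that card_conj_set CG(2)[OF C(1)] by (auto simp: C(2) conj_orbit_def)
    then show "fst (orbit_shape T) * snd (orbit_shape T) = (\<Sum>C\<in>T. card C)"
      using orbit_shape[OF C(1)] C(2) by simp
  qed
  also have "\<dots> = (\<Sum>C\<in>max_cyclics. card C)" by (rule sum_orbits)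
  finally show "sum_list (map (\<lambda>(n, c). n * c) (map orbit_shape orbit_list)) = (\<Sum>C\<in>max_cyclics. card C)" .
qed

text \<open>The bridge from groups to arithmetic: each locale assumption is discharged by a fact
  about maximal cyclic or Sylow subgroups.\<close>

lemma orbit_data:
  assumes le: "card max_cyclics \<le> 30"
  shows "orbit_data (order G) (map orbit_shape orbit_list) sylow_number"
proof
  let ?os = "map orbit_shape orbit_list"
  have "map fst ?os = map card orbit_list" by (simp add: orbit_shape_def o_def)
  then show "sorted (map fst ?os)" using orbit_list(3) by (simp only:)
  obtain C where "C \<in> max_cyclics" using max_cyclic_above[OF finite_carrier one_closed] by blast
  then show "?os \<noteq> []" using orbit_list(1) by (auto simp: orbits_def)
  show "sum_list (map fst ?os) \<le> 30" using sum_orbit_shapes(1) le by simp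
  show "order G + sum_list (map fst ?os) \<le> 1 + sum_list (map (\<lambda>(n, c). n * c) ?os)"
    unfolding sum_orbit_shapes by (rule count_max_cyclics)
  show "1 < n \<and> 1 < c \<and> n * c dvd order G \<and> 2 * order G dvd fact n" if "(n, c) \<in> set ?os" for n c
    using that index_max_cyclic max_cyclic_nontrivial(3) unfolding orbit_shapes by blast
  show "\<exists>(n, c)\<in>set ?os. \<exists>m. m dvd n \<and> 1 < m \<and> \<not> p dvd m \<and> p dvd c \<and> 2 * order G dvd fact m"
    if p: "prime p" "p dvd order G" for p
  proof -
    obtain C m where C: "C \<in> max_cyclics" "m dvd card (conj_orbit (carrier G) C)" "1 < m" "\<not> p dvd m"
      "p dvd card C" "2 * order G dvd fact m" using central_class[OF p] by blast
    then have "(card (conj_orbit (carrier G) C), card C) \<in> set ?os" unfolding orbit_shapes by blast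
    then show ?thesis using C by blast
  qed
  show "sylow_number p mod p = 1 \<and> 1 < sylow_number p \<and> sylow_number p * p ^ multiplicity p (order G) dvd order G
      \<and> 2 * order G dvd fact (sylow_number p)" if "prime p" "p dvd order G" for p
    using sylow_number_mod sylow_number_facts that by blast
  show "sylow_number p dvd n \<and> (c = p ^ multiplicity p (order G) \<longrightarrow> n = sylow_number p)"
    if p: "prime p" "p dvd order G" and o: "(n, c) \<in> set ?os" and d: "p ^ multiplicity p (order G) dvd c" for p n c
  proof -
    obtain C where C: "C \<in> max_cyclics" "n = card (conj_orbit (carrier G) C)" "c = card C"
      using o unfolding orbit_shapes by blast
    show ?thesis
      using sylow_number_dvd[OF C(1) p(1)] d C(2,3) by (simp add: sylow_number_def)
  qed
  show "length (filter (\<lambda>(n, c). c = p ^ multiplicity p (order G)) ?os) \<le> 1"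
    if p: "prime p" "p dvd order G" for p
  proof -
    \<comment> \<open>An orbit whose members have the order of a Sylow subgroup is the whole Sylow
      class, so a repetition-free list contains it at most once.\<close>
    define xs where "xs = filter (\<lambda>T. snd (orbit_shape T) = p ^ multiplicity p (order G)) orbit_list"
    have "set xs \<subseteq> {sylow_class p}"
    proof
      fix T assume T: "T \<in> set xs"
      then have "T \<in> orbits" by (simp add: xs_def orbit_list(1))
      then obtain C where C: "C \<in> max_cyclics" "T = conj_orbit (carrier G) C" by (auto simp: orbits_def)
      then have "card C = p ^ multiplicity p (order G)" using T orbit_shape[OF C(1)] by (simp add: xs_def)
      then show "T \<in> {sylow_class p}" using sylow_number_dvd(2)[OF C(1) p(1)] C(2) by simp
    qed
    then have "card (set xs) \<le> 1" using card_mono[of "{sylow_class p}" "set xs"] by simp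
    moreover have "distinct xs" using orbit_list(2) by (simp add: xs_def)
    ultimately have "length xs \<le> 1" by (simp add: distinct_card)
    then show ?thesis by (simp add: xs_def filter_map o_def case_prod_beta)
  qed
  show "p * q ^ multiplicity q c < sylow_number p"
    if *: "prime p" "multiplicity p (order G) = 1" "(n, c) \<in> set ?os" "p dvd c" "prime q" "q \<noteq> p" "q dvd c" for p q n c
  proof -
    obtain C where C: "C \<in> max_cyclics" "c = card C" using *(3) unfolding orbit_shapes by blast
    show ?thesis using sylow_number_gt[OF C(1)] * C(2) by blast
  qed
  show "(\<Sum>q\<in>prime_factors c. q ^ multiplicity q c) \<le> n'"
    if *: "(n, c) \<in> set ?os" "(n', c') \<in> set ?os" for n c n' c'
  proof -
    obtain C D where C: "C \<in> max_cyclics" "c = card C"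
      and D: "D \<in> max_cyclics" "n' = card (conj_orbit (carrier G) D)"
      using * unfolding orbit_shapes by blast
    have "card (conj_orbit (carrier G) D) \<noteq> 1" using index_max_cyclic(1)[OF D(1)] by simp
    from landau_bound[OF C(1) conj_orbit_invariant[OF CG(2)[OF D(1)] this]] show ?thesis
      using C(2) D(2) by simp
  qed
  show "1 + (\<Sum>p\<in>prime_factors (order G). if multiplicity p (order G) = 1 then sylow_number p * (p - 1)
      else p ^ multiplicity p (order G)) \<le> order G"
    using sum_p_elements[of "{}" "prime_factors (order G)"] by (auto simp: in_prime_factors_iff)
qed

section \<open>The two surviving configurations of order 60\<close>

text \<open>The Sylow number for 3 divides 20 and is 1 modulo 3; the value 4 is ruled out since 120
  does not divide 24. The one for 5 divides 12 and is 1 modulo 5.\<close>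

lemma order_60_sylow_numbers:
  assumes N: "order G = 60"
  shows "multiplicity 3 (order G) = 1" "multiplicity 5 (order G) = 1" "sylow_number 3 = 10" "sylow_number 5 = 6"
proof -
  show m3: "multiplicity 3 (order G) = 1" and m5: "multiplicity 5 (order G) = 1"
    unfolding N by (auto intro!: multiplicity_eqI)
  have *: "\<nu> \<in> {2..20}" if "\<nu> * q dvd 60" "1 < \<nu>" "3 \<le> q" for \<nu> q :: nat
  proof -
    have "\<nu> * 3 \<le> \<nu> * q" using that by simp
    also have "\<dots> \<le> 60" using that by (simp add: dvd_imp_le)
    finally show ?thesis using that by simp
  qed
  have 20: "\<nu> \<in> {2,3,4,5,6,7,8,9,10,11,12,13,14,15,16,17,18,19,20}" if "\<nu> \<in> {2..20}" for \<nu> :: nat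
    using that unfolding insert_iff empty_iff atLeastAtMost_iff by presburger
  define s t where "s = sylow_number 3" and "t = sylow_number 5"
  have s: "s mod 3 = 1" "1 < s" "s * 3 dvd 60" "2 * 60 dvd (fact s :: nat)"
    using sylow_number_mod[of 3] sylow_number_facts[of 3] m3 N by (auto simp: s_def)
  have t: "t mod 5 = 1" "1 < t" "t * 5 dvd 60"
    using sylow_number_mod[of 5] sylow_number_facts[of 5] m5 N by (auto simp: t_def)
  have "s = 4 \<or> s = 10" using 20[OF *[OF s(3,2)]] s(1,3) by auto
  moreover have "s \<noteq> 4" using s(4) by (auto simp: fact_numeral)
  ultimately show "sylow_number 3 = 10" by (simp add: s_def)
  have "t = 6" using 20[OF *[OF t(3,2)]] t(1,3) by auto
  then show "sylow_number 5 = 6" by (simp add: t_def)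
qed

text \<open>There are 20 elements of order 3, 24 of order 5, and there would be 20 of order 6.\<close>

lemma order_60_no_sixes:
  assumes N: "order G = 60" and C: "C \<in> max_cyclics" "card (conj_orbit (carrier G) C) = 10"
  shows "card C \<noteq> 6"
proof
  assume 6: "card C = 6"
  note n = order_60_sylow_numbers[OF N]
  define A where "A = {x \<in> carrier G. ord x = 6}"
  \<comment> \<open>Sorting the elements of order 6 by the subgroup they generate makes the fibres
    disjoint; each fibre over an orbit member contains a generator and its distinct inverse.\<close>
  define f where "f x = generate G {x}" for x
  have fA: "finite A" using finite_carrier by (simp add: A_def)
  have two: "2 \<le> card {x \<in> A. f x = D}" if D: "D \<in> conj_orbit (carrier G) C" for D
  proof -
    obtain g where g: "g \<in> carrier G" "D = conj_set g C" using D by (auto simp: conj_orbit_def)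
    have DM: "D \<in> max_cyclics" using max_cyclics_conj[OF finite_carrier C(1) g(1)] g(2) by simp
    then obtain d where d: "d \<in> carrier G" "D = generate G {d}" by (auto simp: max_cyclics_def)
    have od: "ord d = 6"
      using generate_pow_card[OF d(1)] d(2) g(2) card_conj_set[OF g(1) CG(2)[OF C(1)]] 6 by simp
    have sD: "subgroup D G" by (rule max_cyclic_subgroup[OF DM])
    have "inv d \<in> D" using subgroup.m_inv_closed[OF sD] generate_self[of d] d(2) by simp
    then have "f (inv d) \<subseteq> D" using generate_subsetI[OF d(1)] d(2) by (simp add: f_def)
    moreover have "card (f (inv d)) = card D"
      using generate_pow_card[of "inv d"] generate_pow_card[OF d(1)] d by (simp add: f_def)
    ultimately have "f (inv d) = D"
      using finite_subset_carrier[OF subgroup.subset[OF sD]] by (intro card_subset_eq)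
    then have "{d, inv d} \<subseteq> {x \<in> A. f x = D}" using d od by (auto simp: A_def f_def)
    then have "card {d, inv d} \<le> card {x \<in> A. f x = D}" using fA by (intro card_mono) auto
    moreover have "d \<noteq> inv d"
    proof
      assume "d = inv d"
      then have "d \<otimes> d = \<one>" using d(1) r_inv by metis
      then have "d [^] (2::nat) = \<one>" using d(1) by (simp add: numeral_2_eq_2)
      then show False using pow_eq_id[OF d(1), of 2] od by simp
    qed
    ultimately show ?thesis by simp
  qed
  have "2 * card (conj_orbit (carrier G) C) = (\<Sum>D\<in>conj_orbit (carrier G) C. 2)" by simp
  also have "\<dots> \<le> (\<Sum>D\<in>conj_orbit (carrier G) C. card {x \<in> A. f x = D})"
    by (rule sum_mono[OF two])
  also have "\<dots> = card (\<Union>D\<in>conj_orbit (carrier G) C. {x \<in> A. f x = D})"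
    by (rule card_UN_disjoint[symmetric]) (use fA finite_conj_orbit[OF finite_carrier] in auto)
  also have "\<dots> \<le> card A" using fA by (intro card_mono) auto
  finally have A20: "20 \<le> card A" using C(2) by simp
  have disj: "p_elements p \<inter> A = {}" if "p \<in> {3, 5}" for p
  proof (rule ccontr)
    assume "\<not> ?thesis"
    then obtain x where "x \<in> carrier G" "ord x = 6" "x [^] (p ^ multiplicity p (order G)) = \<one>"
      by (auto simp: p_elements_def A_def)
    then have "6 dvd p" using that n pow_eq_id[of x "p ^ multiplicity p (order G)"] by auto
    then show False using that by auto
  qed
  have "1 + card A + (\<Sum>p\<in>{3, 5}. if multiplicity p (order G) = 1 then sylow_number p * (p - 1)
    else p ^ multiplicity p (order G)) \<le> order G"
    by (rule sum_p_elements[OF fA _ _ _ disj]) (use N in \<open>auto simp: A_def\<close>)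
  then show False using A20 n N by simp
qed

text \<open>An element of order 3 normalizing \<open>C\<close> would centralize it, but the normalizer of a Sylow 3-subgroup
  has order 6.\<close>

lemma order_60_no_fours:
  assumes N: "order G = 60" and C: "C \<in> max_cyclics" "card (conj_orbit (carrier G) C) = 5"
  shows "card C \<noteq> 4"
proof
  assume 4: "card C = 4"
  note n = order_60_sylow_numbers[OF N]
  note CG = CG[OF C(1)]
  have K: "subgroup (normr C) G" by (rule subgroup_normr[OF CG(2)])
  have "card (normr C) = 12" using card_conj_class[OF CG(2)] C(2) N by simp
  then have "order (G\<lparr>carrier := normr C\<rparr>) = 3 ^ 1 * 4" by (simp add: order_def)
  moreover have "finite (carrier (G\<lparr>carrier := normr C\<rparr>))"
    using finite_subset_carrier[OF subgroup.subset[OF K]] by simp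
  ultimately have "\<exists>H. subgroup H (G\<lparr>carrier := normr C\<rparr>) \<and> card H = 3 ^ 1"
    by (intro sylow_thm[OF _ subgroup_imp_group[OF K]]) simp_all
  then obtain H where H': "subgroup H (G\<lparr>carrier := normr C\<rparr>)" "card H = 3 ^ 1" by blast
  have H: "subgroup H G" "H \<subseteq> normr C" "card H = 3"
    using incl_subgroup[OF K H'(1)] subgroup.subset[OF H'(1)] H'(2) by simp_all
  have "H \<noteq> {\<one>}" using H(3) by auto
  then obtain z where z: "z \<in> H" "z \<noteq> \<one>" using subgroup.one_closed[OF H(1)] by blast
  have zG: "z \<in> carrier G" using subgroup.mem_carrier[OF H(1) z(1)] .
  have gz: "generate G {z} = H" "ord z = 3"
    using prime_card_subgroup_cyclic[OF H(1,3) _ z] by simp_all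
  have z3: "z [^] (3::nat) = \<one>" using pow_ord_eq_1[OF zG] gz(2) by simp
  obtain c where c: "c \<in> carrier G" "C = generate G {c}" using max_cyclicsE[OF C(1)] by metis
  have oc: "ord c = 4" using generate_pow_card[OF c(1)] c(2) 4 by simp
  define \<sigma> where "\<sigma> x = z \<otimes> x \<otimes> inv z" for x
  have \<sigma>_pow: "\<sigma> (c [^] (k::nat)) = \<sigma> c [^] k" for k
    using conj_pow[OF zG c(1)] by (simp add: \<sigma>_def)
  have "\<sigma> c \<in> C"
  proof -
    have "conj_set z C = C" using z(1) H(2) by (auto simp: normr_def)
    then show ?thesis using generate_self[of c] c(2) by (auto simp: \<sigma>_def conj_set_def)
  qed
  then obtain k :: nat where k: "\<sigma> c = c [^] k" using cyclic_elements[OF finite_carrier c(1)] c(2) by blast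
  have "\<sigma> (\<sigma> (\<sigma> c)) = c"
  proof -
    have "\<sigma> (\<sigma> (\<sigma> c)) = (z \<otimes> z \<otimes> z) \<otimes> c \<otimes> inv (z \<otimes> z \<otimes> z)"
      using zG c(1) by (simp add: \<sigma>_def inv_mult_group m_assoc)
    moreover have "z \<otimes> z \<otimes> z = \<one>" using z3 zG by (simp add: numeral_3_eq_3)
    ultimately show ?thesis using c(1) by simp
  qed
  moreover have "\<sigma> (\<sigma> (\<sigma> c)) = c [^] (k * k * k)"
    using c(1) by (simp add: k \<sigma>_pow nat_pow_pow mult.assoc)
  ultimately have ck: "c [^] (k * k * k) = c [^] (1::nat)" using c(1) by simp
  \<comment> \<open>Equal powers mean congruent exponents modulo 4, stated with integers for
    \<open>int_pow_eq\<close>. The cube of \<open>k\<close> is 1 modulo 4 only if \<open>k\<close>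
    is: a cyclic group of order 4 has no automorphism of order 3.\<close>
  have "c [^] int (k * k * k) = c [^] int 1" using ck by (simp only: int_pow_int)
  then have "int (ord c) dvd int 1 - int (k * k * k)" using int_pow_eq[OF c(1)] by blast
  then have "int 4 dvd int 1 - int (k * k * k)" by (simp only: oc)
  then have "(k * k * k) mod 4 = 1" by presburger
  moreover have "(k * k * k) mod 4 = ((k mod 4) * (k mod 4) * (k mod 4)) mod 4"
    using power_mod[of k 4 3] by (simp add: power3_eq_cube)
  moreover have "k mod 4 = 0 \<or> k mod 4 = 1 \<or> k mod 4 = 2 \<or> k mod 4 = 3" by presburger
  ultimately have "k mod 4 = 1" by auto
  then have "int (ord c) dvd int 1 - int k" unfolding oc by presburger
  then have "c [^] int k = c [^] int 1" using int_pow_eq[OF c(1)] by blast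
  then have "c [^] k = c [^] (1::nat)" by (simp only: int_pow_int)
  then have "c [^] k = c" using c(1) by simp
  then have comm: "z \<otimes> c = c \<otimes> z" using k c(1) zG by (metis \<sigma>_def inv_solve_right m_closed)
  have "c \<otimes> z \<otimes> inv c = z" using comm c(1) zG by (metis inv_solve_right m_closed)
  then have "c \<in> normr H"
    using conj_generate[OF finite_carrier zG c(1)] c(1) gz(1) by (simp add: normr_def)
  then have "C \<subseteq> normr H"
    using generate_subgroup_incl[of "{c}" "normr H"] subgroup_normr[OF subgroup.subset[OF H(1)]] c(2) by simp
  then have "4 dvd card (normr H)"
    using card_subgroup_dvd[OF CG(1) subgroup_normr[OF subgroup.subset[OF H(1)]]] 4 by simp
  moreover have "10 * card (normr H) = 60"
  proof -
    have "sylow_subgroup 3 H" using H n by (simp add: sylow_subgroup_def)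
    then have "card (conj_orbit (carrier G) H) = 10" using sylow_orbit[of 3 H] n by (simp add: sylow_number_def)
    then show ?thesis using card_conj_class[OF subgroup.subset[OF H(1)]] N by simp
  qed
  ultimately show False by presburger
qed

text \<open>The alternating group on five letters shows that 30 cannot be improved.\<close>

lemma card_max_cyclics_gt_30: "30 < card max_cyclics"
proof (rule ccontr)
  assume "\<not> ?thesis"
  then interpret orbit_data "order G" "map orbit_shape orbit_list" sylow_number
    by (intro orbit_data) simp
  have "outcome (order G) (map orbit_shape orbit_list)" by (rule outcome)
  then consider "order G = 144" | "order G = 60" "(10, 6) \<in> set (map orbit_shape orbit_list)"
    | "order G = 60" "(5, 4) \<in> set (map orbit_shape orbit_list)" unfolding outcome_def by blast
  then show False
  proof cases
    case 2
    then show False using order_60_no_sixes unfolding orbit_shapes by metis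
  next
    case 3
    then show False using order_60_no_fours unfolding orbit_shapes by metis
  qed (use order_ne_144 in simp)
qed

end

section \<open>Reduction to simple groups\<close>

text \<open>The intersection of \<open>H\<close> with a covering cyclic subgroup is again cyclic,
  being a torsion part of it; generators of these intersections cover \<open>H\<close>.\<close>

lemma (in group) cyclic_cover_subgroup:
  assumes fin: "finite (carrier G)" and S: "cyclic_cover S" and H: "subgroup H G"
  shows "\<exists>S'. group.cyclic_cover (G\<lparr>carrier := H\<rparr>) S' \<and> card S' \<le> card S"
proof -
  interpret K: group "G\<lparr>carrier := H\<rparr>" by (rule subgroup_imp_group[OF H])
  have "\<exists>g\<in>H. H \<inter> generate G {s} = generate G {g}" if s: "s \<in> S" for s
  proof -
    have sG: "s \<in> carrier G" using s S by (auto simp: cyclic_cover_def)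
    have I: "subgroup (H \<inter> generate G {s}) G" using subgroups_Inter_pair[OF H subgroup_cyclic[OF sG]] .
    let ?d = "card (H \<inter> generate G {s})"
    have d: "?d dvd card (generate G {s})" using card_subgroup_dvd[OF I subgroup_cyclic[OF sG]] by simp
    have "H \<inter> generate G {s} = torsion_part ?d (generate G {s})"
      using subgroup_of_cyclic[OF fin sG refl I] by simp
    also have "\<dots> = generate G {s [^] (card (generate G {s}) div ?d)}"
      using torsion_part_cyclic(1)[OF fin sG refl d] .
    finally show ?thesis using generate_self by blast
  qed
  then obtain g where g: "\<And>s. s \<in> S \<Longrightarrow> g s \<in> H" "\<And>s. s \<in> S \<Longrightarrow> H \<inter> generate G {s} = generate G {g s}"
    by metis
  have "K.cyclic_cover (g ` S)"
    unfolding K.cyclic_cover_def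
  proof (intro conjI ballI)
    show "finite (g ` S)" "g ` S \<subseteq> carrier (G\<lparr>carrier := H\<rparr>)"
      using S g(1) by (auto simp: cyclic_cover_def)
    fix x assume "x \<in> carrier (G\<lparr>carrier := H\<rparr>)"
    then have x: "x \<in> H" by simp
    then have "\<exists>s\<in>S. x \<in> generate G {s}"
      using S subgroup.mem_carrier[OF H] by (simp add: cyclic_cover_def)
    then obtain s where s: "s \<in> S" "x \<in> generate G {s}" by blast
    have "x \<in> generate G {g s}" using x s g(2)[OF s(1)] by blast
    then have "x \<in> generate (G\<lparr>carrier := H\<rparr>) {g s}"
      using generate_consistent[of "{g s}" H] H g(1)[OF s(1)] by simp
    then show "\<exists>s\<in>g ` S. x \<in> generate (G\<lparr>carrier := H\<rparr>) {s}" using s(1) by blast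
  qed
  moreover have "card (g ` S) \<le> card S" using S by (intro card_image_le) (simp add: cyclic_cover_def)
  ultimately show ?thesis by blast
qed

lemma (in normal) cyclic_cover_quotient:
  assumes fin: "finite (carrier G)" and S: "group.cyclic_cover G S"
  shows "\<exists>S'. group.cyclic_cover (G Mod H) S' \<and> card S' \<le> card S"
proof -
  interpret Q: group "G Mod H" by (rule factorgroup_is_group)
  have S': "finite S" "S \<subseteq> carrier G" "\<And>x. x \<in> carrier G \<Longrightarrow> \<exists>s\<in>S. x \<in> generate G {s}"
    using S by (auto simp: cyclic_cover_def)
  have "Q.cyclic_cover ((\<lambda>s. H #> s) ` S)"
    unfolding Q.cyclic_cover_def
  proof (intro conjI ballI)
    show "finite ((\<lambda>s. H #> s) ` S)" "(\<lambda>s. H #> s) ` S \<subseteq> carrier (G Mod H)"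
      using S' by (auto simp: carrier_FactGroup)
    fix Y assume "Y \<in> carrier (G Mod H)"
    then obtain x where x: "x \<in> carrier G" "Y = H #> x" by (auto simp: carrier_FactGroup)
    obtain s where s: "s \<in> S" "x \<in> generate G {s}" using S'(3)[OF x(1)] by blast
    have sG: "s \<in> carrier G" using s S' by blast
    obtain k :: nat where "x = s [^] k" using s(2) cyclic_elements[OF fin sG] by blast
    then have "Y = (H #> s) [^]\<^bsub>G Mod H\<^esub> k" using FactGroup_pow[OF sG] x(2) by simp
    moreover have "H #> s \<in> carrier (G Mod H)" using sG by (auto simp: carrier_FactGroup)
    ultimately have "Y \<in> generate (G Mod H) {H #> s}"
      using Q.subgroup_nat_pow_closed[OF Q.subgroup_cyclic Q.generate_self] by blast
    then show "\<exists>s\<in>(\<lambda>s. H #> s) ` S. Y \<in> generate (G Mod H) {s}" using s(1) by blast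
  qed
  moreover have "card ((\<lambda>s. H #> s) ` S) \<le> card S" using S'(1) by (rule card_image_le)
  ultimately show ?thesis by blast
qed

text \<open>Take a proper normal subgroup \<open>N\<close> of greatest order. The preimage
  \<open>M'\<close> of a normal subgroup of the quotient is normal and contains \<open>N\<close>, so
  it is the whole group or \<open>N\<close>.\<close>

lemma (in group) maximal_normal_quotient_simple:
  assumes fin: "finite (carrier G)" and nontriv: "carrier G \<noteq> {\<one>}"
  obtains N where "N \<lhd> G" "N \<noteq> carrier G" "simple_group (G Mod N)"
proof -
  define A where "A = {N. N \<lhd> G \<and> N \<noteq> carrier G}"
  have sub: "N \<subseteq> carrier G" if "N \<lhd> G" for N
    using subgroup.subset[OF normal_imp_subgroup[OF that]] .
  have fA: "finite A" by (rule finite_subset[of _ "Pow (carrier G)"]) (use sub fin in \<open>auto simp: A_def\<close>)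
  have "{\<one>} \<in> A" using one_is_normal nontriv by (auto simp: A_def)
  then have "Max (card ` A) \<in> card ` A" using fA by (intro Max_in) auto
  then obtain N where N: "N \<in> A" "Max (card ` A) = card N" by (auto simp del: Max_in)
  have max: "card M \<le> card N" if "M \<in> A" for M
    unfolding N(2)[symmetric] using that fA by (intro Max_ge) auto
  have NG: "N \<lhd> G" "N \<noteq> carrier G" using N(1) by (auto simp: A_def)
  interpret N: normal N G by (rule NG(1))
  interpret Q: group "G Mod N" by (rule N.factorgroup_is_group)
  have coset: "N #> x = N \<longleftrightarrow> x \<in> N" if "x \<in> carrier G" for x
    using that coset_join1[OF _ that N.subgroup_axioms] coset_join2[OF that N.subgroup_axioms] by blast
  have "simple_group (G Mod N)"
  proof
    obtain x where x: "x \<in> carrier G" "x \<notin> N" using NG(2) N.subset by blast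
    have "{N, N #> x} \<subseteq> carrier (G Mod N)"
      using x N.subgroup_in_rcosets[OF is_group] by (auto simp: FactGroup_def RCOSETS_def)
    moreover have fQ: "finite (carrier (G Mod N))" using fin by (simp add: carrier_FactGroup)
    ultimately have "card {N, N #> x} \<le> order (G Mod N)" unfolding order_def by (intro card_mono)
    moreover have "N \<noteq> N #> x" using coset x by blast
    ultimately show "1 < order (G Mod N)" by simp
  next
    fix M assume M: "M \<lhd> G Mod N"
    interpret M: normal M "G Mod N" by (rule M)
    define M' where "M' = {x \<in> carrier G. N #> x \<in> M}"
    have hom: "(N #> x) \<otimes>\<^bsub>G Mod N\<^esub> (N #> y) = N #> (x \<otimes> y)" if "x \<in> carrier G" "y \<in> carrier G" for x y
      using N.rcos_sum that by simp
    have inv: "inv\<^bsub>G Mod N\<^esub> (N #> x) = N #> inv x" if "x \<in> carrier G" for x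
      using N.inv_FactGroup[of "N #> x"] N.rcos_inv[OF that] that by (auto simp: carrier_FactGroup)
    have "M' \<lhd> G"
    proof (rule normal_invI)
      show "subgroup M' G"
      proof (rule subgroupI)
        show "M' \<subseteq> carrier G" by (auto simp: M'_def)
        have "N #> \<one> \<in> M" using M.one_closed N.subset by simp
        then show "M' \<noteq> {}" by (auto simp: M'_def)
        show "inv a \<in> M'" if "a \<in> M'" for a
          using that M.m_inv_closed[of "N #> a"] inv by (auto simp: M'_def)
        show "a \<otimes> b \<in> M'" if "a \<in> M'" "b \<in> M'" for a b
          using that M.m_closed[of "N #> a" "N #> b"] hom by (auto simp: M'_def)
      qed
      fix x h assume x: "x \<in> carrier G" and h: "h \<in> M'"
      have "(N #> x) \<otimes>\<^bsub>G Mod N\<^esub> (N #> h) \<otimes>\<^bsub>G Mod N\<^esub> inv\<^bsub>G Mod N\<^esub> (N #> x) \<in> M"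
        by (rule M.inv_op_closed2) (use x h in \<open>auto simp: carrier_FactGroup M'_def\<close>)
      then show "x \<otimes> h \<otimes> inv x \<in> M'" using x h inv hom by (simp add: M'_def)
    qed
    show "M = carrier (G Mod N) \<or> M = {\<one>\<^bsub>G Mod N\<^esub>}"
    proof (cases "M' = carrier G")
      case True
      then have "carrier (G Mod N) \<subseteq> M" by (auto simp: carrier_FactGroup M'_def)
      then show ?thesis using M.subset by blast
    next
      case False
      then have "M' \<in> A" using \<open>M' \<lhd> G\<close> by (simp add: A_def)
      then have le: "card M' \<le> card N" by (rule max)
      have NM: "N \<subseteq> M'"
      proof
        fix x assume x: "x \<in> N"
        then have "x \<in> carrier G" using N.subset by blast
        moreover have "N #> x = N" using coset[OF calculation] x by blast
        ultimately show "x \<in> M'" using M.one_closed by (simp add: M'_def)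
      qed
      have "finite M'" using fin by (simp add: M'_def)
      then have "N = M'" using NM le by (rule card_seteq)
      have "Y = N" if Y: "Y \<in> M" for Y
      proof -
        obtain x where x: "x \<in> carrier G" "Y = N #> x"
          using Y M.subset by (auto simp: carrier_FactGroup)
        then have "x \<in> M'" using Y by (simp add: M'_def)
        then have "x \<in> N" using \<open>N = M'\<close> by blast
        then show ?thesis using coset x by blast
      qed
      moreover have "N \<in> M" using M.one_closed by simp
      ultimately have "M = {N}" by blast
      then show ?thesis by simp
    qed
  qed
  then show thesis using that NG by blast
qed

text \<open>The derived series must become stationary, since orders cannot decrease forever; without
  solvability it does so above the trivial group.\<close>

lemma (in group) perfect_core:
  assumes fin: "finite (carrier G)" and ns: "\<not> solvable G"
  obtains H where "subgroup H G" "H \<noteq> {\<one>}" "derived G H = H"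
proof -
  define D where "D n = (derived G ^^ n) (carrier G)" for n
  have D: "subgroup (D n) G" for n unfolding D_def by (rule exp_of_derived_is_subgroup[OF subgroup_self])
  have Suc: "D (Suc n) = derived G (D n)" for n by (simp add: D_def)
  have le: "D (Suc n) \<subseteq> D n" for n unfolding Suc by (rule derived_incl[OF subset_refl D])
  have fD: "finite (D n)" for n using finite_subset[OF subgroup.subset[OF D] fin] .
  have "\<exists>n. D (Suc n) = D n"
  proof (rule ccontr)
    assume "\<nexists>n. D (Suc n) = D n"
    then have lt: "card (D (Suc n)) < card (D n)" for n using le fD by (intro psubset_card_mono) auto
    have "card (D n) + n \<le> card (D 0)" for n
    proof (induction n)
      case (Suc n)
      then show ?case using lt[of n] by simp
    qed simp
    from this[of "Suc (card (D 0))"] show False by simp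
  qed
  then obtain n where "D (Suc n) = D n" by blast
  moreover have "D n \<noteq> {\<one>}" using ns solvable_iff_trivial_derived_seq by (auto simp: D_def)
  ultimately show thesis using that[OF D[of n]] Suc by simp
qed

lemma (in group) nonsolvable_simple_section:
  assumes fin: "finite (carrier G)" and ns: "\<not> solvable G" and S: "cyclic_cover S"
  obtains Q :: "'a set monoid" and S' where "nonabelian_simple_group Q" "group.cyclic_cover Q S'" "card S' \<le> card S"
proof -
  obtain H where H: "subgroup H G" "H \<noteq> {\<one>}" "derived G H = H" using perfect_core[OF fin ns] by blast
  interpret K: group "G\<lparr>carrier := H\<rparr>" by (rule subgroup_imp_group[OF H(1)])
  have finH: "finite (carrier (G\<lparr>carrier := H\<rparr>))"
    using finite_subset[OF subgroup.subset[OF H(1)] fin] by simp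
  obtain S1 where S1: "K.cyclic_cover S1" "card S1 \<le> card S" using cyclic_cover_subgroup[OF fin S H(1)] by blast
  obtain N where N: "N \<lhd> G\<lparr>carrier := H\<rparr>" "N \<noteq> H" "simple_group (G\<lparr>carrier := H\<rparr> Mod N)"
    using K.maximal_normal_quotient_simple[OF finH] H(2) by auto
  interpret N: normal N "G\<lparr>carrier := H\<rparr>" by (rule N(1))
  obtain S2 where S2: "group.cyclic_cover (G\<lparr>carrier := H\<rparr> Mod N) S2" "card S2 \<le> card S1"
    using N.cyclic_cover_quotient[OF finH S1(1)] by blast
  have "\<not> comm_group (G\<lparr>carrier := H\<rparr> Mod N)"
  proof
    assume "comm_group (G\<lparr>carrier := H\<rparr> Mod N)"
    \<comment> \<open>An abelian quotient would put the derived subgroup, which is all of the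
      perfect group \<open>H\<close>, inside the proper subgroup \<open>N\<close>.\<close>
    then have "derived G H \<subseteq> N" by (rule derived_of_subgroup_minimal[OF N(1) H(1)])
    then show False using H(3) N(2) N.subset by auto
  qed
  moreover have "finite (carrier (G\<lparr>carrier := H\<rparr> Mod N))" unfolding carrier_FactGroup using finH by (rule finite_imageI)
  ultimately have "nonabelian_simple_group (G\<lparr>carrier := H\<rparr> Mod N)"
    using N(3) by (simp add: nonabelian_simple_group_def nonabelian_simple_group_axioms_def)
  then show thesis using that S1(2) S2 by (meson le_trans)
qed

lemma (in group) cyclic_imp_solvable:
  assumes "cyclic_group G" shows "solvable G"
proof -
  interpret comm_group G using cyclic_imp_abelian_group[OF assms] .
  have "(derived G ^^ 1) (carrier G) = {\<one>}" using derived_eq_singleton[OF subset_refl] by simp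
  then show ?thesis unfolding solvable_iff_trivial_derived_seq by blast
qed

text \<open>A generator of a maximal cyclic subgroup lies in no other one, so these subgroups cover the group
  irredundantly.\<close>

lemma (in group) card_max_cyclics_le_covering_lambda:
  assumes fin: "finite (carrier G)" and nc: "\<not> cyclic_group G"
  shows "card max_cyclics \<le> covering_lambda G"
proof -
  define n where "n = card max_cyclics"
  have fM: "finite max_cyclics" by (rule finite_max_cyclics[OF fin])
  obtain h where h: "bij_betw h {1..n} max_cyclics" using ex_bij_betw_nat_finite_1[OF fM] n_def by blast
  have hM: "h i \<in> max_cyclics" if "i \<in> {1..n}" for i using h that bij_betwE by blast
  have im: "h ` {1..n} = max_cyclics" using h by (rule bij_betw_imp_surj_on)
  have U: "\<Union>max_cyclics = carrier G"
  proof (intro equalityI subsetI)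
    show "x \<in> carrier G" if "x \<in> \<Union>max_cyclics" for x
      using that subgroup.subset[OF max_cyclic_subgroup] by blast
    show "x \<in> \<Union>max_cyclics" if "x \<in> carrier G" for x
      using max_cyclic_above[OF fin that] by blast
  qed
  have "n \<noteq> 0"
    using U one_closed fM by (auto simp: n_def)
  \<comment> \<open>A single maximal cyclic subgroup would cover the group and make it
    cyclic.\<close>
  moreover have "n \<noteq> 1"
  proof
    assume "n = 1"
    then obtain C where C: "max_cyclics = {C}" using card_1_singletonE n_def by metis
    then have "C \<in> max_cyclics" by simp
    from max_cyclicsE[OF this] obtain c where c: "c \<in> carrier G" "C = generate G {c}" by metis
    have "generate G {c} = carrier G" using U C c by simp
    moreover have "carrier G \<inter> {c} = {c}" using c by blast
    ultimately have "subgroup_generated G {c} = G" by (simp add: subgroup_generated_def)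
    then show False using nc c(1) unfolding cyclic_group_def by blast
  qed
  ultimately have n2: "2 \<le> n" by simp
  have irr: "\<not> h i \<subseteq> (\<Union>j\<in>{1..n} - {i}. h j)" if i: "i \<in> {1..n}" for i
  proof
    assume sub: "h i \<subseteq> (\<Union>j\<in>{1..n} - {i}. h j)"
    obtain c where c: "c \<in> carrier G" "h i = generate G {c}"
      "\<And>x. x \<in> carrier G \<Longrightarrow> h i \<subseteq> generate G {x} \<Longrightarrow> generate G {x} = h i"
      using max_cyclicsE[OF hM[OF i]] by metis
    obtain j where j: "j \<in> {1..n}" "j \<noteq> i" "c \<in> h j" using sub c(2) generate_self[of c] by blast
    obtain d where d: "d \<in> carrier G" "h j = generate G {d}" using max_cyclicsE[OF hM[OF j(1)]] by metis
    have "h i \<subseteq> generate G {d}" using generate_subsetI[OF d(1)] j(3) c(2) d(2) by simp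
    then have "h j = h i" using c(3)[OF d(1)] d(2) by simp
    then show False using h i j by (metis bij_betw_imp_inj_on inj_onD)
  qed
  have "irredundant_covering G n h"
    unfolding irredundant_covering_def group_covering_def
  proof (intro conjI ballI)
    show "(\<Union>i\<in>{1..n}. h i) = carrier G" using im U by simp
  qed (use n2 max_cyclic_subgroup[OF hM] irr in auto)
  then show ?thesis
    unfolding covering_lambda_def n_def[symmetric]
    using nc finite_irredundant_covering_sizes[OF fin] by (auto intro: Max_ge)
qed

lemma (in group) max_cyclics_cover:
  assumes fin: "finite (carrier G)"
  obtains S where "cyclic_cover S" "card S \<le> card max_cyclics"
proof -
  obtain g where g: "\<And>C. C \<in> max_cyclics \<Longrightarrow> g C \<in> carrier G \<and> C = generate G {g C}"
  proof -
    have "\<forall>C\<in>max_cyclics. \<exists>c. c \<in> carrier G \<and> C = generate G {c}" by (auto simp: max_cyclics_def)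
    from bchoice[OF this] show thesis using that by blast
  qed
  have fM: "finite max_cyclics" by (rule finite_max_cyclics[OF fin])
  have "cyclic_cover (g ` max_cyclics)"
    unfolding cyclic_cover_def
  proof (intro conjI ballI)
    fix x assume "x \<in> carrier G"
    then obtain C where C: "C \<in> max_cyclics" "x \<in> C" using max_cyclic_above[OF fin] by blast
    then have "x \<in> generate G {g C}" using g by blast
    then show "\<exists>s\<in>g ` max_cyclics. x \<in> generate G {s}" using C(1) by blast
  qed (use g fM in auto)
  then show thesis using that card_image_le[OF fM] by blast
qed

theorem theoremD:
  fixes G :: "('a, 'b) monoid_scheme"
  assumes "group G"
    and "finite (carrier G)"
    and "covering_lambda G \<le> 30"
  shows "solvable G"
proof (rule ccontr)
  assume ns: "\<not> solvable G"
  interpret group G by (rule assms(1))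
  have "\<not> cyclic_group G" using ns cyclic_imp_solvable by blast
  then have "card max_cyclics \<le> 30"
    using card_max_cyclics_le_covering_lambda[OF assms(2)] assms(3) by simp
  moreover obtain S where S: "cyclic_cover S" "card S \<le> card max_cyclics"
    by (rule max_cyclics_cover[OF assms(2)])
  \<comment> \<open>The bound 30 now reaches the simple section through its cyclic cover, and there
    it contradicts \<open>card_max_cyclics_gt_30\<close>.\<close>
  obtain Q :: "'a set monoid" and T where Q: "nonabelian_simple_group Q" "group.cyclic_cover Q T" "card T \<le> card S"
    using nonsolvable_simple_section[OF assms(2) ns S(1)] by blast
  interpret Q: nonabelian_simple_group Q by (rule Q(1))
  show False
    using Q.card_max_cyclics_gt_30 Q.card_max_cyclics_le[OF Q(2)] Q(3) S(2) \<open>card max_cyclics \<le> 30\<close>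
    by linarith
qed

end
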